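(* Fix the domain $[n]^d$, let $\epsilon\ge 8\Delta>0$, let $p\ge1$ and let $\mathsf{dist}$ be the normalized $\ell_p$ metric on $[n]^d$. Then there is a $(\mathsf{CC},\mathsf{CC},\Delta)$-diameter-guarded $\epsilon$-tester for identity under $\mathsf{EMD}_{\mathsf{dist}}$ using at most $m(\epsilon)=2^{O(d)}\cdot\widetilde O\!\left(\epsilon^{-\max\{2,d/2\}}\right)$ samples and $q(\epsilon)=O(m(\epsilon))\cdot\left(2^{O(d)}O(n^{d-1})+O(\log n)\right)$ queries, where $\widetilde O(\cdot)$ hides polylogarithmic factors in $1/\epsilon$.
   Context: The normalized $\ell_p$ metric on $[n]^d$ is $\mathsf{dist}(x,y)=\|x-y\|_p/(d^{1/p}n)$. For distributions $\mu,\nu$, $\mathsf{EMD}_{\mathsf{dist}}(\mu,\nu)=\inf_\pi\mathbb{E}_{(x,y)\sim\pi}[\mathsf{dist}(x,y)]$ over couplings $\pi$ of $\mu,\nu$. A clustering of a domain $\mathcal X$ is a pair $(\Gamma,\mathsf{rep})$ where $\Gamma=\{\Gamma_1,\dots,\Gamma_k\}$ partitions $\mathcal X$ into cells and $\mathsf{rep}(i)\in\Gamma_i$; $\gamma(x)$ is the index of the cell containing $x$. For a distribution $\mu$ the clustered-sample oracle returns independent samples $\mathsf{rep}(\gamma(x))$, $x\sim\mu$; the label oracle on query $x$ returns $\mathsf{rep}(\gamma(x))$. Samples are calls to the clustered-sample oracle, queries are calls to the label oracle. $\mathsf{CC}$ is the class of clusterings of $[n]^d$ each of whose cells is connected in the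 grid graph on $[n]^d$ (edges between $x,y$ with $\|x-y\|_1=1$) and convex (equal to the set of points of $[n]^d$ in its convex hull). Let $c=\frac{1}{384\ln 24}$. For a universe $\mathcal U$ of clusterings, a subclass $\mathcal G\subseteq\mathcal U$ and $\Delta>0$: an algorithm is a $(\mathcal U,\mathcal G,\Delta)$-diameter-guarded $\epsilon$-tester for identity (with known target $\nu$) if it outputs ACCEPT, REJECT or CLUSTER-REJECT and, for every input $((\Gamma,\mathsf{rep}),\mu)$ with $(\Gamma,\mathsf{rep})\in\mathcal U$: (1) if $(\Gamma,\mathsf{rep})\in\mathcal G$ and $\Pr_{x\sim\mu}[\mathrm{diam}_{\mathsf{dist}}(\Gamma_{\gamma(x)})>\Delta]\le c\epsilon$, it outputs CLUSTER-REJECT with probability at most $1/6$; (2) if $\mu=\nu$ it outputs ACCEPT or CLUSTER-REJECT with probability at least $5/6$; (3) if $\mathsf{EMD}_{\mathsf{dist}}(\mu,\nu)>\epsilon$ it outputs REJECT or CLUSTER-REJECT with probability at least $5/6$. *)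

theory Defs
  imports "HOL-Probability.Probability" "HOL-Analysis.Finite_Function_Topology"
begin

section \<open>The grid and its metric\<close>

text \<open>A point of \<open>[n]^d\<close> is a function on \<open>{..<d}\<close>, made total by the extensionality convention
  of \<open>PiE\<close>. The dimension is a value, since the asymptotic constants of the result must not depend
  on it.\<close>

type_synonym point = "nat \<Rightarrow> nat"

definition grid :: "nat \<Rightarrow> nat \<Rightarrow> point set" where
  "grid n d = (\<Pi>\<^sub>E i\<in>{..<d}. {1..n})"

definition lp_dist :: "real \<Rightarrow> nat \<Rightarrow> point \<Rightarrow> point \<Rightarrow> real" where
  "lp_dist p d x y = (\<Sum>i<d. \<bar>real (x i) - real (y i)\<bar> powr p) powr (1 / p)"

definition ndist :: "real \<Rightarrow> nat \<Rightarrow> nat \<Rightarrow> point \<Rightarrow> point \<Rightarrow> real" where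
  "ndist p n d x y = lp_dist p d x y / (real d powr (1 / p) * real n)"


section \<open>Earth mover's distance\<close>

definition couplings :: "'a pmf \<Rightarrow> 'a pmf \<Rightarrow> ('a \<times> 'a) pmf set" where
  "couplings \<mu> \<nu> = {\<pi>. map_pmf fst \<pi> = \<mu> \<and> map_pmf snd \<pi> = \<nu>}"

text \<open>The expectation is the Bochner integral, which is 0 for non-integrable functions. This is only
  used for finitely supported \<open>\<mu>\<close> and \<open>\<nu>\<close>, where every coupling has finite support.\<close>

definition EMD :: "('a \<Rightarrow> 'a \<Rightarrow> real) \<Rightarrow> 'a pmf \<Rightarrow> 'a pmf \<Rightarrow> real" where
  "EMD \<delta> \<mu> \<nu> = (INF \<pi>\<in>couplings \<mu> \<nu>. measure_pmf.expectation \<pi> (\<lambda>(x, y). \<delta> x y))"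


section \<open>Clusterings\<close>

text \<open>The cells serve as their own indices: \<open>\<gamma>(x)\<close> is the cell containing \<open>x\<close>, and
  \<open>rep\<close> maps a cell to its representative.\<close>

type_synonym 'a clustering = "'a set set \<times> ('a set \<Rightarrow> 'a)"

definition is_clustering :: "'a set \<Rightarrow> 'a clustering \<Rightarrow> bool" where
  "is_clustering X cl \<longleftrightarrow> partition_on X (fst cl) \<and> (\<forall>C\<in>fst cl. snd cl C \<in> C)"

definition cell_of :: "'a clustering \<Rightarrow> 'a \<Rightarrow> 'a set" where
  "cell_of cl x = (THE C. C \<in> fst cl \<and> x \<in> C)"

definition label :: "'a clustering \<Rightarrow> 'a \<Rightarrow> 'a" where
  "label cl x = snd cl (cell_of cl x)"

definition diam :: "('a \<Rightarrow> 'a \<Rightarrow> real) \<Rightarrow> 'a set \<Rightarrow> real" where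
  "diam \<delta> C = (SUP (x, y)\<in>C \<times> C. \<delta> x y)"

definition grid_connected :: "nat \<Rightarrow> point set \<Rightarrow> bool" where
  "grid_connected d C \<longleftrightarrow>
     (\<forall>x\<in>C. \<forall>y\<in>C. (x, y) \<in> {(u, v). u \<in> C \<and> v \<in> C \<and> lp_dist 1 d u v = 1}\<^sup>*)"

text \<open>The real vector space of finitely supported functions \<open>nat \<Rightarrow>\<^sub>0 real\<close> contains every
  \<open>\<real>^d\<close>; the convex hull is taken there.\<close>

definition to_vec :: "nat \<Rightarrow> point \<Rightarrow> (nat \<Rightarrow>\<^sub>0 real)" where
  "to_vec d x = (\<Sum>i<d. Poly_Mapping.single i (real (x i)))"

definition grid_convex :: "nat \<Rightarrow> nat \<Rightarrow> point set \<Rightarrow> bool" where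
  "grid_convex n d C \<longleftrightarrow> C = {x \<in> grid n d. to_vec d x \<in> convex hull (to_vec d ` C)}"

definition CC :: "nat \<Rightarrow> nat \<Rightarrow> point clustering set" where
  "CC n d = {cl. is_clustering (grid n d) cl \<and>
                 (\<forall>C\<in>fst cl. grid_connected d C \<and> grid_convex n d C)}"


section \<open>Randomized adaptive algorithms with oracle access\<close>

datatype verdict = Accept | Reject | Cluster_Reject

text \<open>\<open>Sample k\<close> calls the clustered-sample oracle, \<open>Query x k\<close> calls the label oracle on \<open>x\<close>, and
  \<open>Random P k\<close> draws internal randomness, which is free of charge; \<open>k\<close> continues with the answer.\<close>

datatype 'a algo =
    Output verdict
  | Sample "'a \<Rightarrow> 'a algo"
  | Query 'a "'a \<Rightarrow> 'a algo"
  | Random "nat pmf" "nat \<Rightarrow> 'a algo"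

primrec run_algo :: "'a clustering \<Rightarrow> 'a pmf \<Rightarrow> 'a algo \<Rightarrow> verdict pmf" where
  "run_algo cl \<mu> (Output v) = return_pmf v"
| "run_algo cl \<mu> (Sample k) = bind_pmf \<mu> (\<lambda>x. run_algo cl \<mu> (k (label cl x)))"
| "run_algo cl \<mu> (Query x k) = run_algo cl \<mu> (k (label cl x))"
| "run_algo cl \<mu> (Random P k) = bind_pmf P (\<lambda>r. run_algo cl \<mu> (k r))"

text \<open>\<open>uses_at_most X m q A\<close>: on every execution path along which the oracles answer with points of the
  domain \<open>X\<close>, the algorithm makes at most \<open>m\<close> samples and at most \<open>q\<close> queries, and it only queries
  points of \<open>X\<close>.\<close>

inductive uses_at_most :: "'a set \<Rightarrow> nat \<Rightarrow> nat \<Rightarrow> 'a algo \<Rightarrow> bool" for X where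
  "uses_at_most X m q (Output v)"
| "(\<And>y. y \<in> X \<Longrightarrow> uses_at_most X m q (k y)) \<Longrightarrow> uses_at_most X (Suc m) q (Sample k)"
| "x \<in> X \<Longrightarrow> (\<And>y. y \<in> X \<Longrightarrow> uses_at_most X m q (k y)) \<Longrightarrow> uses_at_most X m (Suc q) (Query x k)"
| "(\<And>r. r \<in> set_pmf P \<Longrightarrow> uses_at_most X m q (k r)) \<Longrightarrow> uses_at_most X m q (Random P k)"


section \<open>Diameter-guarded testers\<close>

definition guard_const :: real where
  "guard_const = 1 / (384 * ln 24)"

definition diameter_guarded_tester ::
  "'a set \<Rightarrow> ('a \<Rightarrow> 'a \<Rightarrow> real) \<Rightarrow> 'a clustering set \<Rightarrow> 'a clustering set \<Rightarrow> real \<Rightarrow> real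
    \<Rightarrow> 'a pmf \<Rightarrow> 'a algo \<Rightarrow> bool" where
  "diameter_guarded_tester X \<delta> \<U> \<G> \<Delta> \<epsilon> \<nu> A \<longleftrightarrow>
     (\<forall>cl\<in>\<U>. \<forall>\<mu>. set_pmf \<mu> \<subseteq> X \<longrightarrow>
        (cl \<in> \<G> \<and> measure_pmf.prob \<mu> {x. diam \<delta> (cell_of cl x) > \<Delta>} \<le> guard_const * \<epsilon> \<longrightarrow>
           measure_pmf.prob (run_algo cl \<mu> A) {Cluster_Reject} \<le> 1 / 6) \<and>
        (\<mu> = \<nu> \<longrightarrow>
           measure_pmf.prob (run_algo cl \<mu> A) {Accept, Cluster_Reject} \<ge> 5 / 6) \<and>
        (EMD \<delta> \<mu> \<nu> > \<epsilon> \<longrightarrow>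
           measure_pmf.prob (run_algo cl \<mu> A) {Reject, Cluster_Reject} \<ge> 5 / 6))"


section \<open>Asymptotic complexity bounds\<close>

text \<open>All hidden constants, including the exponent of the polylogarithmic factor, are absolute.
  The maximum with 1 keeps that factor meaningful when \<open>\<epsilon>\<close> is close to or above 1.\<close>

definition sample_bound :: "(nat \<Rightarrow> real \<Rightarrow> nat) \<Rightarrow> bool" where
  "sample_bound m \<longleftrightarrow> (\<exists>a C :: real. \<exists>k :: nat. \<forall>d \<epsilon>. d \<ge> 1 \<longrightarrow> \<epsilon> > 0 \<longrightarrow>
     real (m d \<epsilon>) \<le> 2 powr (a * real d) *
       (C * \<epsilon> powr (- max 2 (real d / 2)) * max 1 (ln (1 / \<epsilon>)) ^ k))"

definition query_bound :: "(nat \<Rightarrow> real \<Rightarrow> nat) \<Rightarrow> (nat \<Rightarrow> nat \<Rightarrow> real \<Rightarrow> nat) \<Rightarrow> bool" where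
  "query_bound m q \<longleftrightarrow> (\<exists>b C1 C2 C3 :: real. \<forall>n d \<epsilon>. n \<ge> 1 \<longrightarrow> d \<ge> 1 \<longrightarrow> \<epsilon> > 0 \<longrightarrow>
     real (q n d \<epsilon>) \<le> C1 * real (m d \<epsilon>) *
       (2 powr (b * real d) * (C2 * real n ^ (d - 1)) + C3 * log 2 (real n)))"

end

theory Submission
  imports Defs
begin

text \<open>
  For every sampled representative the tester reconstructs the whole cell. Binary search gives the two
  ends of the line through the representative; from there all points around known boundary points are
  queried. An axis-parallel line leaves a convex cell at most twice, so there are at most
  \<open>2 d n\<^sup>d\<^sup>-\<^sup>1\<close> boundary points, and scanning from line to line shows that what has been seen
  determines the cell. If one of the first \<open>O(1/\<epsilon>)\<close> cells is too wide, the answer is CLUSTER-REJECT.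

  Each further sample is replaced by a point drawn from \<open>\<nu>\<close> conditioned on its cell. If \<open>\<mu> = \<nu>\<close>, the
  resulting distribution is again \<open>\<nu>\<close>; in general it is within \<open>\<Delta> + \<epsilon>/8\<close> of \<open>\<mu>\<close>, unless wide cells are
  so likely that they have been noticed. So it suffices to test identity with \<open>\<nu>\<close> from genuine samples.
  Matching as much mass as possible inside dyadic cubes, from small to large, bounds the earth mover's
  distance by \<open>2\<^sup>-\<^sup>L + \<Sum>\<^sub>j 2\<^sup>1\<^sup>-\<^sup>j \<parallel>\<mu>\<^sub>j - \<nu>\<^sub>j\<parallel>\<^sub>1\<close>. For a distant \<open>\<mu>\<close> some level \<open>j\<close> thus has
  \<open>\<ell>\<^sub>1\<close>-distance at least \<open>2\<^sup>j \<epsilon> / (4 L)\<close>, which a chi-square statistic detects from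
  \<open>O(L\<^sup>3 2\<^sup>j\<^sup>d\<^sup>/\<^sup>2 / (2\<^sup>2\<^sup>j \<epsilon>\<^sup>2))\<close> samples.
\<close>

section \<open>Locating a cell\<close>

text \<open>Reading off a whole cell would cost n^d queries. Only its boundary is affordable, and
  where the boundary runs must be discovered while querying. The exploration therefore moves by
  boxes of at most 3^d points around boundary points already seen.

  The replacement of a sample depends on its own cell only, so replaced samples remain independent
  and can be treated as genuine samples from one fixed distribution. The error budget is \<Delta> +
  \<epsilon>/8 \<le> \<epsilon>/4 for the replacement, \<epsilon>/4 for the finest cubes and
  \<epsilon>/2 for all levels together.

  The exponent comes from 2^(jd/2) / (2^j \<epsilon>)^2, where 2^j ranges up to O(1/\<epsilon>): for
  d < 4 the coarsest level dominates and gives \<epsilon>^(-2), for d > 4 the finest one gives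
  \<epsilon>^(-d/2). The guard constant c is tuned to the number of inspected cells: about 64 ln 24
  / \<epsilon> cells, each too wide with probability at most c \<epsilon>, include a wide one with
  probability at most 64 ln 24 / (384 ln 24) = 1/6.\<close>

lemma finite_grid: "finite (grid n d)"
  unfolding grid_def by (intro finite_PiE) auto

lemma grid_fun_upd_iff:
  assumes "x \<in> grid n d" "i < d"
  shows "x(i := s) \<in> grid n d \<longleftrightarrow> 1 \<le> s \<and> s \<le> n"
  using assms by (auto simp: grid_def PiE_def Pi_def extensional_def)

lemma grid_bounds: "x \<in> grid n d \<Longrightarrow> i < d \<Longrightarrow> 1 \<le> x i \<and> x i \<le> n"
  by (auto simp: grid_def PiE_def Pi_def)

section \<open>Cells as connected sets that are convex along axis-parallel lines\<close>

definition adj :: "nat \<Rightarrow> point \<Rightarrow> point \<Rightarrow> bool" where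
  "adj d x z \<longleftrightarrow> (\<exists>i<d. z = x(i := Suc (x i)) \<or> x = z(i := Suc (z i)))"

definition line_convex :: "nat \<Rightarrow> point set \<Rightarrow> bool" where
  "line_convex d C \<longleftrightarrow>
     (\<forall>x i a b. i < d \<longrightarrow> x(i := a) \<in> C \<longrightarrow> x(i := b) \<in> C \<longrightarrow> (\<forall>s. a \<le> s \<longrightarrow> s \<le> b \<longrightarrow> x(i := s) \<in> C))"

definition adj_connected :: "nat \<Rightarrow> point set \<Rightarrow> bool" where
  "adj_connected d C \<longleftrightarrow> (\<forall>x\<in>C. \<forall>y\<in>C. (x, y) \<in> {(u, v). u \<in> C \<and> v \<in> C \<and> adj d u v}\<^sup>*)"

text \<open>The combinatorial form of a cell of \<open>CC\<close>; real convex hulls and norms do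
  not occur beyond this point of the reconstruction.\<close>

definition region :: "nat \<Rightarrow> nat \<Rightarrow> point set \<Rightarrow> bool" where
  "region n d C \<longleftrightarrow> C \<subseteq> grid n d \<and> line_convex d C \<and> adj_connected d C"

lemma lp_dist_1_adj:
  assumes "x \<in> grid n d" "y \<in> grid n d" "lp_dist 1 d x y = 1"
  shows "adj d x y"
proof -
  have "(\<Sum>i<d. \<bar>real (x i) - real (y i)\<bar>) = 1"
    using assms(3) by (simp add: lp_dist_def sum_nonneg)
  \<comment> \<open>With truncated subtraction one of \<open>x i - y i\<close> and
    \<open>y i - x i\<close> vanishes and the other is their distance. The real equation thus
    becomes one about naturals, where a sum equals 1 only if a single summand does and the others
    vanish.\<close>
  moreover have "(\<Sum>i<d. \<bar>real (x i) - real (y i)\<bar>) = real (\<Sum>i<d. (x i - y i) + (y i - x i))"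
    unfolding of_nat_sum by (intro sum.cong) auto
  ultimately have "(\<Sum>i<d. (x i - y i) + (y i - x i)) = 1"
    by linarith
  then obtain i where i: "i < d" "(x i - y i) + (y i - x i) = 1"
    "\<And>j. j < d \<Longrightarrow> i \<noteq> j \<Longrightarrow> (x j - y j) + (y j - x j) = 0"
    by (subst (asm) sum_eq_1_iff) auto
  have eq: "x j = y j" if "j \<noteq> i" for j
  proof (cases "j < d")
    case True
    then show ?thesis using i(3)[of j] that by linarith
  next
    case False
    then show ?thesis using assms(1,2) by (auto simp: grid_def PiE_def extensional_def)
  qed
  have "y = x(i := Suc (x i)) \<or> x = y(i := Suc (y i))"
  proof (cases "x i < y i")
    case True
    then have "y = x(i := Suc (x i))" using i(2) eq by (intro ext) auto
    then show ?thesis ..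
  next
    case False
    then have "x = y(i := Suc (y i))" using i(2) eq by (intro ext) auto
    then show ?thesis ..
  qed
  then show ?thesis using i(1) by (auto simp: adj_def)
qed

lemma lookup_scaleR: "Poly_Mapping.lookup (c *\<^sub>R u) i = c *\<^sub>R Poly_Mapping.lookup u i"
  for u :: "'a \<Rightarrow>\<^sub>0 'b::real_vector"
  by (simp add: scaleR_poly_mapping_def)

lemma lookup_to_vec: "Poly_Mapping.lookup (to_vec d x) i = (if i < d then real (x i) else 0)"
  by (simp add: to_vec_def lookup_sum lookup_single when_def)

text \<open>A grid point between two cell points on an axis-parallel line is a convex combination of
  them, so it lies in the hull, and \<open>grid_convex\<close> puts it back into the cell.\<close>

lemma grid_convex_line_convex:
  assumes "grid_convex n d C"
  shows "line_convex d C"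
  unfolding line_convex_def
proof (intro allI impI)
  fix x i a b s
  assume i: "i < d" and ab: "x(i := a) \<in> C" "x(i := b) \<in> C" and s: "a \<le> s" "s \<le> b"
  have C: "C = {x \<in> grid n d. to_vec d x \<in> convex hull (to_vec d ` C)}"
    using assms by (simp add: grid_convex_def)
  have g: "x(i := a) \<in> grid n d" "x(i := b) \<in> grid n d" using ab C by blast+
  have "1 \<le> a" "b \<le> n" using grid_bounds[OF g(1) i] grid_bounds[OF g(2) i] by simp_all
  then have gs: "x(i := s) \<in> grid n d"
    using grid_fun_upd_iff[OF g(1) i, of s] s by simp
  show "x(i := s) \<in> C"
  proof (cases "a = b")
    case True
    then show ?thesis using ab s by simp
  next
    case False
    define t where "t = (real s - real a) / (real b - real a)"
    have t: "0 \<le> t" "t \<le> 1" using s False by (auto simp: t_def divide_simps)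
    have "to_vec d (x(i := s)) = (1 - t) *\<^sub>R to_vec d (x(i := a)) + t *\<^sub>R to_vec d (x(i := b))"
    proof (rule poly_mapping_eqI)
      fix j
      have "t * (real b - real a) = real s - real a"
        using False by (simp add: t_def)
      then have "real s = (1 - t) * real a + t * real b"
        by (simp add: algebra_simps)
      then show "Poly_Mapping.lookup (to_vec d (x(i := s))) j =
          Poly_Mapping.lookup ((1 - t) *\<^sub>R to_vec d (x(i := a)) + t *\<^sub>R to_vec d (x(i := b))) j"
        by (simp add: lookup_add lookup_to_vec lookup_scaleR) (simp add: algebra_simps)
    qed
    moreover have "\<dots> \<in> convex hull (to_vec d ` C)"
      using t ab by (intro convexD_alt[OF convex_convex_hull]) (auto intro: hull_inc)
    ultimately show ?thesis using gs by (subst C) simp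
  qed
qed

lemma CC_region:
  assumes "cl \<in> CC n d" "C \<in> fst cl"
  shows "region n d C"
proof -
  have *: "C \<subseteq> grid n d" "grid_connected d C" "grid_convex n d C"
    using assms by (auto simp: CC_def is_clustering_def partition_on_def)
  have "{(u, v). u \<in> C \<and> v \<in> C \<and> lp_dist 1 d u v = 1} \<subseteq> {(u, v). u \<in> C \<and> v \<in> C \<and> adj d u v}"
    using lp_dist_1_adj *(1) by blast
  from rtrancl_mono[OF this] have "adj_connected d C"
    using *(2) unfolding grid_connected_def adj_connected_def by blast
  then show ?thesis using * grid_convex_line_convex by (auto simp: region_def)
qed

section \<open>Exposed boundary points and the scan along two neighbouring lines\<close>

definition king_box :: "nat \<Rightarrow> nat \<Rightarrow> point \<Rightarrow> point set" where
  "king_box n d x = {y \<in> grid n d. \<forall>i<d. y i \<le> Suc (x i) \<and> x i \<le> Suc (y i)}"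

text \<open>\<open>K\<close> is the set of points whose status is known; points outside the grid are known not to
  belong to the cell.\<close>

definition exposed :: "nat \<Rightarrow> nat \<Rightarrow> point set \<Rightarrow> point set \<Rightarrow> point set" where
  "exposed n d C K = {x \<in> C \<inter> K. \<exists>z. adj d x z \<and> z \<notin> C \<and> (z \<in> K \<or> z \<notin> grid n d)}"

definition unexplored :: "nat \<Rightarrow> nat \<Rightarrow> point set \<Rightarrow> point set \<Rightarrow> point set" where
  "unexplored n d C K = (\<Union>x\<in>exposed n d C K. king_box n d x) - K"

text \<open>The algorithm knows only \<open>C \<inter> K\<close>, not \<open>C\<close>; its next
  query can nevertheless be computed, because exposure looks at \<open>C\<close> only at known
  points and outside the grid.\<close>

lemma unexplored_Int: "C \<subseteq> grid n d \<Longrightarrow> unexplored n d (C \<inter> K) K = unexplored n d C K"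
proof -
  assume "C \<subseteq> grid n d"
  then have *: "z \<notin> C \<inter> K \<and> (z \<in> K \<or> z \<notin> grid n d) \<longleftrightarrow> z \<notin> C \<and> (z \<in> K \<or> z \<notin> grid n d)" for z
    by blast
  then have "exposed n d (C \<inter> K) K = exposed n d C K"
    by (simp only: exposed_def * Int_assoc Int_absorb)
  then show ?thesis by (simp add: unexplored_def)
qed

text \<open>Two neighbouring lines meet a cell in \<open>P\<close> and \<open>Q\<close>; \<open>KP\<close> and \<open>KQ\<close> are the positions whose
  status is known.\<close>

locale strip =
  fixes P Q KP KQ :: "int \<Rightarrow> bool"
  assumes expose_P: "P s \<Longrightarrow> KP s \<Longrightarrow> (\<not> Q s \<and> KQ s) \<or> (\<not> P (s - 1) \<and> KP (s - 1)) \<Longrightarrow>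
      \<bar>t - s\<bar> \<le> 1 \<Longrightarrow> KP t \<and> KQ t"
    and expose_Q: "Q s \<Longrightarrow> KQ s \<Longrightarrow> \<not> P s \<Longrightarrow> KP s \<Longrightarrow> \<bar>t - s\<bar> \<le> 1 \<Longrightarrow> KP t \<and> KQ t"
begin

text \<open>While \<open>P\<close> holds and \<open>Q\<close> fails, each known position of
  \<open>P\<close> is exposed by its known neighbour on \<open>Q\<close>, and its box reveals the
  next position of both lines. The first position \<open>a\<close> is exposed by its predecessor on
  its own line.\<close>

lemma scan_in:
  assumes "a \<le> b" "KP a" "\<not> P (a - 1)" "KP (a - 1)"
    "\<And>s. a \<le> s \<Longrightarrow> s \<le> b \<Longrightarrow> P s" "\<And>s. a \<le> s \<Longrightarrow> s < b \<Longrightarrow> \<not> Q s"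
  shows "KP b \<and> KQ b"
  using assms
proof (induction b rule: int_ge_induct)
  case base
  then show ?case using expose_P[of a a] by simp
next
  case (step b)
  then have "KP b \<and> KQ b" by simp
  then show ?case using expose_P[of b "b + 1"] step.prems step.hyps by simp
qed

text \<open>The mirror situation: below \<open>a\<close> the line of \<open>P\<close> has left the
  cell while that of \<open>Q\<close> is still inside. The exposed points now lie on
  \<open>Q\<close>, and knowledge travels downwards, always one position ahead.\<close>

lemma scan_out:
  assumes "s \<le> a" "P a" "KP a" "KP (a - 1)" "\<And>s. s < a \<Longrightarrow> \<not> P s"
    "\<And>t. s \<le> t \<Longrightarrow> t \<le> a \<Longrightarrow> Q t"
  shows "KQ s \<and> KQ (s - 1) \<and> KP (s - 1)"
  using assms
proof (induction s rule: int_le_induct)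
  case base
  then show ?case using expose_P[of a a] expose_P[of a "a - 1"] by simp
next
  case (step s)
  then have "KQ s \<and> KQ (s - 1) \<and> KP (s - 1)" by simp
  then show ?case using expose_Q[of "s - 1" "s - 2"] step.prems step.hyps by simp
qed

text \<open>Passes knowledge of the lower end \<open>a\<close> of \<open>P\<close> to the lower end
  \<open>a'\<close> of \<open>Q\<close>, climbing along \<open>P\<close> or descending along
  \<open>Q\<close> according to which end is lower. The common position \<open>c\<close> ensures
  that the line being followed stays in the cell all the way.\<close>

lemma scan:
  assumes a: "P a" "KP a" "KP (a - 1)" "\<And>s. s < a \<Longrightarrow> \<not> P s"
    and a': "\<And>s. s < a' \<Longrightarrow> \<not> Q s"
    and c: "a \<le> c" "a' \<le> c" "\<And>s. a \<le> s \<Longrightarrow> s \<le> c \<Longrightarrow> P s" "\<And>s. a' \<le> s \<Longrightarrow> s \<le> c \<Longrightarrow> Q s"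
  shows "KQ a' \<and> KQ (a' - 1)"
proof (cases "a < a'")
  case True
  then have "KP (a' - 1) \<and> KQ (a' - 1)"
    using a a' c by (intro scan_in[of a]) auto
  then show ?thesis using expose_P[of "a' - 1" a'] a'[of "a' - 1"] c True by simp
next
  case False
  then show ?thesis using scan_out[of a' a] a c by simp
qed

end

text \<open>Lines in direction 0 are parametrized by integers, not naturals, so that they can be reflected:
  the upper ends are treated by the same scan as the lower ones.\<close>

definition on_line :: "point set \<Rightarrow> point \<Rightarrow> int \<Rightarrow> bool" where
  "on_line C x s \<longleftrightarrow> s \<ge> 0 \<and> x(0 := nat s) \<in> C"

definition known :: "nat \<Rightarrow> point set \<Rightarrow> point \<Rightarrow> int \<Rightarrow> bool" where
  "known n K x s \<longleftrightarrow> s < 1 \<or> s > int n \<or> x(0 := nat s) \<in> K"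

text \<open>The invariant carried from line to line. For a line-convex cell \<open>a\<close> and
  \<open>b\<close> can only be the two ends of its trace, so four known positions describe the
  entire line.\<close>

definition line_known :: "nat \<Rightarrow> point set \<Rightarrow> point set \<Rightarrow> point \<Rightarrow> bool" where
  "line_known n C K x \<longleftrightarrow> (\<exists>a b. on_line C x a \<and> \<not> on_line C x (a - 1) \<and> known n K x a \<and> known n K x (a - 1) \<and>
     on_line C x b \<and> \<not> on_line C x (b + 1) \<and> known n K x b \<and> known n K x (b + 1))"

lemma on_line_upd [simp]: "on_line C (x(0 := t)) = on_line C x"
  by (intro ext) (simp add: on_line_def)

lemma known_upd [simp]: "known n K (x(0 := t)) = known n K x"
  by (intro ext) (simp add: known_def)

lemma line_known_upd [simp]: "line_known n C K (x(0 := t)) = line_known n C K x"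
  by (simp add: line_known_def)

lemma on_line_self [simp]: "on_line C x (int (x 0)) \<longleftrightarrow> x \<in> C"
  by (simp add: on_line_def)

lemma on_line_bounds:
  assumes "C \<subseteq> grid n d" "0 < d" "on_line C x s"
  shows "1 \<le> s \<and> s \<le> int n"
  using assms grid_bounds[of "x(0 := nat s)" n d 0] unfolding on_line_def by fastforce

lemma on_line_interval:
  assumes "line_convex d C" "0 < d" "on_line C x a" "on_line C x b" "a \<le> s" "s \<le> b"
  shows "on_line C x s"
  using assms unfolding on_line_def line_convex_def
  by (smt (verit) nat_le_eq_zle)

lemma line_ends:
  assumes "region n d C" "0 < d" "on_line C x c"
  obtains a b where "a \<le> c" "c \<le> b" "\<And>s. on_line C x s \<longleftrightarrow> a \<le> s \<and> s \<le> b"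
proof -
  have fin: "finite {s. on_line C x s}"
    by (rule finite_subset[of _ "{1..int n}"])
      (use assms on_line_bounds[of C n d x] in \<open>auto simp: region_def\<close>)
  define a where "a = Min {s. on_line C x s}"
  define b where "b = Max {s. on_line C x s}"
  have "on_line C x a" "on_line C x b"
    using Min_in[OF fin] Max_in[OF fin] assms(3) unfolding a_def b_def by auto
  moreover have "a \<le> s" "s \<le> b" if "on_line C x s" for s
    using that fin unfolding a_def b_def by auto
  ultimately show ?thesis using assms that[of a b] on_line_interval[of d C x a b]
    unfolding region_def by blast
qed

section \<open>Knowledge spreads through a closed exploration and determines the cell\<close>

context
  fixes n d :: nat and C K :: "point set"
  assumes d: "0 < d" and C: "region n d C" and closed: "unexplored n d C K = {}"
begin

lemma exposed_box:
  assumes "x \<in> C" "x \<in> K" "adj d x z" "z \<notin> C" "z \<in> K \<or> z \<notin> grid n d" "y \<in> king_box n d x"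
  shows "y \<in> K"
  using assms closed unfolding unexplored_def exposed_def by auto

text \<open>The source of both assumptions of \<open>strip\<close>. Leaving \<open>s'\<close> free
  on either side of \<open>s\<close> covers lower and upper ends alike. The box must contain
  diagonal neighbours, since position \<open>t\<close> of the other line differs from
  \<open>s\<close> in two coordinates.\<close>

lemma known_step:
  assumes x: "x \<in> grid n d" and i: "0 < i" "i < d"
    and y: "y = x(i := Suc (x i)) \<or> x = y(i := Suc (y i))" and yg: "y \<in> grid n d"
    and s: "on_line C x s" "known n K x s"
    and z: "(\<not> on_line C y s \<and> known n K y s) \<or> (\<bar>s' - s\<bar> = 1 \<and> \<not> on_line C x s' \<and> known n K x s')"
    and t: "\<bar>t - s\<bar> \<le> 1"
  shows "known n K x t \<and> known n K y t"
proof -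
  have Cg: "C \<subseteq> grid n d" using C by (simp add: region_def)
  have sb: "1 \<le> s" "s \<le> int n" using on_line_bounds[OF Cg d s(1)] by auto
  have inC: "x(0 := nat s) \<in> C" "x(0 := nat s) \<in> K"
    using s sb by (auto simp: on_line_def known_def)
  obtain z where z: "adj d (x(0 := nat s)) z" "z \<notin> C" "z \<in> K \<or> z \<notin> grid n d"
    using z
  proof (elim disjE conjE)
    assume h: "\<not> on_line C y s" "known n K y s"
    have "adj d (x(0 := nat s)) (y(0 := nat s))"
      unfolding adj_def using y i by (intro exI[of _ i]) (auto simp: fun_upd_twist)
    then show ?thesis using h sb by (intro that[of "y(0 := nat s)"]) (auto simp: on_line_def known_def)
  next
    assume h: "\<bar>s' - s\<bar> = 1" "\<not> on_line C x s'" "known n K x s'"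
    \<comment> \<open>The value 0 is possible: it is the position just outside the grid, and
      \<open>nat\<close> is still faithful there.\<close>
    have "s' \<ge> 0" using h sb by linarith
    have "adj d (x(0 := nat s)) (x(0 := nat s'))"
      unfolding adj_def
    proof (intro exI[of _ 0] conjI d)
      have "nat s' = Suc (nat s) \<or> nat s = Suc (nat s')" using h sb by linarith
      then show "x(0 := nat s') = (x(0 := nat s))(0 := Suc ((x(0 := nat s)) 0)) \<or>
            x(0 := nat s) = (x(0 := nat s'))(0 := Suc ((x(0 := nat s')) 0))" by auto
    qed
    moreover have "x(0 := nat s') \<notin> C" using h \<open>s' \<ge> 0\<close> by (auto simp: on_line_def)
    moreover have "x(0 := nat s') \<in> K \<or> x(0 := nat s') \<notin> grid n d"
    proof (cases "s' < 1 \<or> s' > int n")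
      case True
      then show ?thesis using grid_fun_upd_iff[OF x d, of "nat s'"] by auto
    next
      case False
      then show ?thesis using h by (auto simp: known_def)
    qed
    ultimately show ?thesis using that by blast
  qed
  have king_box: "x(0 := nat t) \<in> king_box n d (x(0 := nat s))" "y(0 := nat t) \<in> king_box n d (x(0 := nat s))"
    if tb: "1 \<le> t" "t \<le> int n"
  proof -
    have "x(0 := nat t) \<in> grid n d" "y(0 := nat t) \<in> grid n d"
      using tb x yg by (auto simp: grid_fun_upd_iff[OF _ d])
    moreover have "nat t \<le> Suc (nat s)" "nat s \<le> Suc (nat t)" using t by linarith+
    moreover have "y j \<le> Suc (x j)" "x j \<le> Suc (y j)" for j
      using y by (metis fun_upd_apply le_SucI order_refl)+
    ultimately show "x(0 := nat t) \<in> king_box n d (x(0 := nat s))" "y(0 := nat t) \<in> king_box n d (x(0 := nat s))"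
      unfolding king_box_def by auto
  qed
  show ?thesis
  proof (cases "1 \<le> t \<and> t \<le> int n")
    case True
    then show ?thesis using exposed_box[OF inC z king_box(1)] exposed_box[OF inC z king_box(2)]
      by (simp add: known_def)
  next
    case False
    then show ?thesis by (auto simp: known_def)
  qed
qed

lemma strip_lines:
  assumes x: "x \<in> grid n d" and i: "0 < i" "i < d"
    and y: "y = x(i := Suc (x i)) \<or> x = y(i := Suc (y i))" and yg: "y \<in> grid n d"
  shows "strip (on_line C x) (on_line C y) (known n K x) (known n K y)"
    and "strip (\<lambda>s. on_line C x (- s)) (\<lambda>s. on_line C y (- s)) (\<lambda>s. known n K x (- s)) (\<lambda>s. known n K y (- s))"
proof -
  have y': "x = y(i := Suc (y i)) \<or> y = x(i := Suc (x i))" using y by blast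
  show "strip (on_line C x) (on_line C y) (known n K x) (known n K y)"
  proof
    fix s t :: int
    assume t: "\<bar>t - s\<bar> \<le> 1"
    show "known n K x t \<and> known n K y t"
      if "on_line C x s" "known n K x s"
        "\<not> on_line C y s \<and> known n K y s \<or> \<not> on_line C x (s - 1) \<and> known n K x (s - 1)"
      using that known_step[OF x i y yg, of s "s - 1" t] t by auto
    show "known n K x t \<and> known n K y t"
      if "on_line C y s" "known n K y s" "\<not> on_line C x s" "known n K x s"
      using that known_step[OF yg i y' x, of s "s - 1" t] t by auto
  qed
  show "strip (\<lambda>s. on_line C x (- s)) (\<lambda>s. on_line C y (- s)) (\<lambda>s. known n K x (- s)) (\<lambda>s. known n K y (- s))"
  proof
    fix s t :: int
    assume t: "\<bar>t - s\<bar> \<le> 1"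
    then have t': "\<bar>- t - - s\<bar> \<le> 1" by linarith
    show "known n K x (- t) \<and> known n K y (- t)"
      if "on_line C x (- s)" "known n K x (- s)"
        "\<not> on_line C y (- s) \<and> known n K y (- s) \<or> \<not> on_line C x (- (s - 1)) \<and> known n K x (- (s - 1))"
      using that known_step[OF x i y yg, of "-s" "-(s-1)" "-t"] t' by auto
    show "known n K x (- t) \<and> known n K y (- t)"
      if "on_line C y (- s)" "known n K y (- s)" "\<not> on_line C x (- s)" "known n K x (- s)"
      using that known_step[OF yg i y' x, of "-s" "-(s-1)" "-t"] t' by auto
  qed
qed

lemma line_knownE:
  assumes "line_known n C K x" "on_line C x c"
  obtains a b where "a \<le> c" "c \<le> b" "\<And>s. on_line C x s \<longleftrightarrow> a \<le> s \<and> s \<le> b"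
    "known n K x a" "known n K x (a - 1)" "known n K x b" "known n K x (b + 1)"
proof -
  obtain a b where ab: "a \<le> c" "c \<le> b" "\<And>s. on_line C x s \<longleftrightarrow> a \<le> s \<and> s \<le> b"
    using line_ends[OF C d assms(2)] by metis
  moreover have "known n K x a \<and> known n K x (a - 1) \<and> known n K x b \<and> known n K x (b + 1)"
  proof -
    from assms(1) obtain a' b' where *: "on_line C x a'" "\<not> on_line C x (a' - 1)"
      "known n K x a'" "known n K x (a' - 1)" "on_line C x b'" "\<not> on_line C x (b' + 1)"
      "known n K x b'" "known n K x (b' + 1)"
      unfolding line_known_def by blast
    have "a' = a" "b' = b" using * ab by force+
    then show ?thesis using * by simp
  qed
  ultimately show ?thesis using that by blast
qed

text \<open>A step in direction 0 stays on the same line. A step in any other direction preserves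
  coordinate 0, so this coordinate is a position at which both lines are in the cell, as
  \<open>strip.scan\<close> requires; one scan handles the lower ends and a reflected one the upper
  ends.\<close>

lemma line_known_adj:
  assumes lk: "line_known n C K x" and xy: "x \<in> C" "y \<in> C" "adj d x y"
  shows "line_known n C K y"
proof -
  have g: "x \<in> grid n d" "y \<in> grid n d" using C xy by (auto simp: region_def)
  obtain i where i: "i < d" "y = x(i := Suc (x i)) \<or> x = y(i := Suc (y i))"
    using xy by (auto simp: adj_def)
  show ?thesis
  proof (cases "i = 0")
    case True
    then show ?thesis using lk i by (metis line_known_upd)
  next
    case False
    then have i0: "0 < i" by simp
    have x0: "x 0 = y 0" using i False by (metis fun_upd_other)
    have cx: "on_line C x (int (x 0))" using xy by simp
    have cy: "on_line C y (int (x 0))" unfolding x0 using xy by simp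
    obtain a b where ab: "a \<le> int (x 0)" "int (x 0) \<le> b" "\<And>s. on_line C x s \<longleftrightarrow> a \<le> s \<and> s \<le> b"
      "known n K x a" "known n K x (a - 1)" "known n K x b" "known n K x (b + 1)"
      using line_knownE[OF lk cx] by metis
    obtain a' b' where ab': "a' \<le> int (x 0)" "int (x 0) \<le> b'" "\<And>s. on_line C y s \<longleftrightarrow> a' \<le> s \<and> s \<le> b'"
      using line_ends[OF C d cy] by metis
    have "known n K y a' \<and> known n K y (a' - 1)"
      by (rule strip.scan[OF strip_lines(1)[OF g(1) i0 i g(2)], where a = a and c = "int (x 0)"])
        (use ab ab' in auto)
    moreover have "known n K y (- (- b')) \<and> known n K y (- (- b' - 1))"
      by (rule strip.scan[OF strip_lines(2)[OF g(1) i0 i g(2)], where a = "- b" and c = "- int (x 0)"])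
        (use ab ab' in \<open>auto simp: algebra_simps\<close>)
    ultimately show ?thesis unfolding line_known_def using ab'
      by (intro exI[of _ a'] exI[of _ b']) (auto simp: algebra_simps)
  qed
qed

lemma all_lines_known:
  assumes "r \<in> C" "line_known n C K r" "x \<in> C"
  shows "line_known n C K x"
proof -
  have "(r, x) \<in> {(u, v). u \<in> C \<and> v \<in> C \<and> adj d u v}\<^sup>*"
    using C assms by (auto simp: region_def adj_connected_def)
  then show ?thesis using assms(2)
    by (induction rule: rtrancl_induct) (auto intro: line_known_adj)
qed

text \<open>Agreement on \<open>K\<close> forces \<open>a\<close> and \<open>b\<close> into
  \<open>C'\<close> and keeps \<open>a - 1\<close> and \<open>b + 1\<close> out of it; line
  convexity of \<open>C'\<close> leaves only the interval from \<open>a\<close> to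
  \<open>b\<close>.\<close>

lemma same_line:
  assumes C': "region n d C'" "C \<inter> K = C' \<inter> K" and lk: "line_known n C K x" and c: "on_line C x c"
  shows "on_line C' x = on_line C x"
proof -
  have Cg: "C \<subseteq> grid n d" and Cg': "C' \<subseteq> grid n d" and lc': "line_convex d C'"
    using C C' by (auto simp: region_def)
  have agree: "on_line C x s \<longleftrightarrow> on_line C' x s" if "known n K x s" for s
  proof (cases "1 \<le> s \<and> s \<le> int n")
    case True
    then have "x(0 := nat s) \<in> K" using that by (simp add: known_def)
    then show ?thesis using C'(2) by (auto simp: on_line_def)
  next
    case False
    then show ?thesis using on_line_bounds[OF Cg d] on_line_bounds[OF Cg' d] by blast
  qed
  obtain a b where ab: "a \<le> c" "c \<le> b" "\<And>s. on_line C x s \<longleftrightarrow> a \<le> s \<and> s \<le> b"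
      "known n K x a" "known n K x (a - 1)" "known n K x b" "known n K x (b + 1)"
    using line_knownE[OF lk c] by metis
  have e: "on_line C' x a" "on_line C' x b" "\<not> on_line C' x (a - 1)" "\<not> on_line C' x (b + 1)"
    using agree ab by force+
  have "on_line C' x s \<longleftrightarrow> a \<le> s \<and> s \<le> b" for s
    using e on_line_interval[OF lc' d, of x a b s] on_line_interval[OF lc' d, of x s a "a - 1"]
      on_line_interval[OF lc' d, of x b s "b + 1"] by force
  then show ?thesis using ab(3) by auto
qed

text \<open>On lines that meet \<open>C\<close> both regions coincide, which gives one inclusion.
  For the other, a walk inside \<open>C'\<close> starting in \<open>r\<close> never leaves
  \<open>C\<close>: a step onto a line that misses \<open>C\<close> would end at a known point,
  where the two regions agree.\<close>

lemma region_determined: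
  assumes C': "region n d C'" "C \<inter> K = C' \<inter> K" and r: "r \<in> C" "r \<in> C'" "line_known n C K r"
  shows "C' = C"
proof
  note lk = all_lines_known[OF r(1,3)]
  have same: "on_line C' x = on_line C x" if "on_line C x c" for x c
  proof -
    have "x(0 := nat c) \<in> C" using that by (simp add: on_line_def)
    then have "line_known n C K (x(0 := nat c))" by (rule lk)
    then show ?thesis using same_line[OF C' _ that] by simp
  qed
  show "C \<subseteq> C'"
  proof
    fix x assume "x \<in> C"
    then have "on_line C x (int (x 0))" by simp
    with same show "x \<in> C'" by (metis on_line_self)
  qed
  show "C' \<subseteq> C"
  proof
    fix x assume "x \<in> C'"
    then have "(r, x) \<in> {(u, v). u \<in> C' \<and> v \<in> C' \<and> adj d u v}\<^sup>*"
      using C' r by (auto simp: region_def adj_connected_def)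
    then show "x \<in> C"
    proof (induction rule: rtrancl_induct)
      case base
      show ?case by (rule r(1))
    next
      case (step x y)
      then have y: "y \<in> C'" "adj d x y" and x: "x \<in> C" by auto
      have g: "x \<in> grid n d" "y \<in> grid n d" using C C' x y by (auto simp: region_def)
      show ?case
      proof (cases "\<exists>c. on_line C y c")
        case True
        then show ?thesis using same y(1) by (metis on_line_self)
      next
        case False
        obtain i where i: "i < d" "y = x(i := Suc (x i)) \<or> x = y(i := Suc (y i))"
          using y by (auto simp: adj_def)
        have "i \<noteq> 0"
        proof
          assume "i = 0"
          then have "on_line C y = on_line C x" using i by (metis on_line_upd)
          then show False using False x by (metis on_line_self)
        qed
        then have i0: "0 < i" by simp
        have x0: "x 0 = y 0" using i \<open>i \<noteq> 0\<close> by (metis fun_upd_other)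
        have cx: "on_line C x (int (x 0))" using x by simp
        obtain a b where ab: "a \<le> int (x 0)" "int (x 0) \<le> b" "\<And>s. on_line C x s \<longleftrightarrow> a \<le> s \<and> s \<le> b"
          "known n K x a" "known n K x (a - 1)" "known n K x b" "known n K x (b + 1)"
          using line_knownE[OF lk[OF x] cx] by metis
        \<comment> \<open>The line of \<open>y\<close> misses \<open>C\<close> altogether, so the
          scan along the line of \<open>x\<close> is never stopped and reaches the position next to
          \<open>x\<close>, which is \<open>y\<close> itself.\<close>
        have "known n K y (int (x 0))"
          using strip.scan_in[OF strip_lines(1)[OF g(1) i0 i g(2)], of a "int (x 0)"] ab False by auto
        then have "y \<in> K" using x0 grid_bounds[OF g(2) d] by (auto simp: known_def)
        then show ?thesis using y(1) C'(2) by blast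
      qed
    qed
  qed
qed

end

section \<open>Counting boundary points and possible queries\<close>

definition boundary :: "nat \<Rightarrow> point set \<Rightarrow> point set" where
  "boundary d C = {x \<in> C. \<exists>z. adj d x z \<and> z \<notin> C}"

lemma card_king_box: "finite (king_box n d x) \<and> card (king_box n d x) \<le> 3 ^ d"
proof -
  let ?S = "\<Pi>\<^sub>E i\<in>{..<d}. {x i - 1..Suc (x i)}"
  have sub: "king_box n d x \<subseteq> ?S"
    by (force simp: king_box_def grid_def PiE_def Pi_def)
  have fin: "finite ?S" by (intro finite_PiE) auto
  have "card ?S = (\<Prod>i<d. card {x i - 1..Suc (x i)})"
    by (subst card_PiE) auto
  also have "\<dots> \<le> (\<Prod>i<d. 3)" by (intro prod_mono) auto
  finally have "card ?S \<le> 3 ^ d" by simp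
  then show ?thesis using card_mono[OF fin sub] finite_subset[OF sub fin] by linarith
qed

text \<open>A line in direction \<open>i\<close> meets this slice exactly once, so the slice counts
  the lines.\<close>

lemma card_grid_slice:
  assumes "i < d"
  shows "finite {y \<in> grid n d. y i = 1} \<and> card {y \<in> grid n d. y i = 1} \<le> n ^ (d - 1)"
proof -
  let ?S = "\<Pi>\<^sub>E j\<in>{..<d}. if j = i then {1} else {1..n}"
  have sub: "{y \<in> grid n d. y i = 1} \<subseteq> ?S"
    by (auto simp: grid_def PiE_def Pi_def)
  have fin: "finite ?S" by (intro finite_PiE) auto
  have "card ?S = (\<Prod>j<d. card (if j = i then {1} else {1..n}))"
    by (subst card_PiE) auto
  also have "\<dots> = (\<Prod>j<d. if j = i then 1 else n)" by (intro prod.cong) auto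
  also have "\<dots> = (\<Prod>j\<in>{..<d} - {i}. if j = i then 1 else n)"
    using assms by (subst prod.remove[of _ i]) auto
  also have "\<dots> = (\<Prod>j\<in>{..<d} - {i}. n)" by (intro prod.cong) auto
  also have "\<dots> = n ^ (d - 1)" using assms by simp
  finally show ?thesis using card_mono[OF fin sub] finite_subset[OF sub fin] by linarith
qed

lemma inj_on_line_end:
  assumes "\<And>x y. x \<in> A \<Longrightarrow> y \<in> A \<Longrightarrow> x(i := 1::nat) = y(i := 1) \<Longrightarrow> \<not> x i < y i"
  shows "inj_on (\<lambda>x. x(i := 1)) A"
proof (rule inj_onI)
  fix x y assume *: "x \<in> A" "y \<in> A" "x(i := 1) = y(i := 1)"
  then have "x i = y i" using assms[of x y] assms[of y x] by force
  moreover have "x j = y j" if "j \<noteq> i" for j using *(3) that by (metis fun_upd_other)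
  ultimately show "x = y" by (intro ext) metis
qed

text \<open>Boundary points are sorted by the direction and orientation in which they leave the
  cell; leaving it through a face of the grid counts as well. On each class, setting coordinate
  \<open>i\<close> to 1 is injective: two of its points on one line would have the missing neighbour
  of one of them between them.\<close>

lemma card_boundary:
  assumes "region n d C"
  shows "finite (boundary d C) \<and> card (boundary d C) \<le> 2 * d * n ^ (d - 1)"
proof -
  define up where "up i = {x \<in> C. x(i := Suc (x i)) \<notin> C}" for i
  define down where "down i = {x \<in> C. x(i := x i - 1) \<notin> C}" for i
  have Cg: "C \<subseteq> grid n d" and lc: "line_convex d C" using assms by (auto simp: region_def)
  have fin: "finite C" using Cg finite_grid finite_subset by blast
  have "boundary d C \<subseteq> (\<Union>i<d. up i \<union> down i)"
  proof
    fix x assume "x \<in> boundary d C"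
    then obtain z i where z: "x \<in> C" "z \<notin> C" "i < d" "z = x(i := Suc (x i)) \<or> x = z(i := Suc (z i))"
      by (auto simp: boundary_def adj_def)
    then show "x \<in> (\<Union>i<d. up i \<union> down i)"
    proof (elim disjE)
      assume "x = z(i := Suc (z i))"
      then have "x(i := x i - 1) = z" by (metis diff_Suc_1 fun_upd_same fun_upd_triv fun_upd_upd)
      then show ?thesis using z by (auto simp: down_def)
    qed (auto simp: up_def)
  qed
  then have "card (boundary d C) \<le> card (\<Union>i<d. up i \<union> down i)"
    by (intro card_mono) (auto simp: up_def down_def fin)
  also have "\<dots> \<le> (\<Sum>i<d. card (up i \<union> down i))" by (rule card_UN_le) simp
  also have "\<dots> \<le> (\<Sum>i<d. 2 * n ^ (d - 1))"
  proof (rule sum_mono)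
    fix i assume "i \<in> {..<d}"
    then have i: "i < d" by simp
    have upd: "y = x(i := y i)" if "x(i := 1) = y(i := 1)" for x y :: point
      using that by (metis fun_upd_triv fun_upd_upd)
    have bound: "card A \<le> n ^ (d - 1)" if "A \<subseteq> C" "inj_on (\<lambda>x. x(i := 1)) A" for A
    proof -
      have "(\<lambda>x. x(i := 1)) ` A \<subseteq> {y \<in> grid n d. y i = 1}"
        using that Cg i by (force simp: grid_def PiE_def Pi_def extensional_def)
      then have "card ((\<lambda>x. x(i := 1)) ` A) \<le> n ^ (d - 1)"
        using card_grid_slice[OF i, of n] card_mono le_trans by blast
      then show ?thesis using card_image[OF that(2)] by simp
    qed
    have "card (up i) \<le> n ^ (d - 1)"
    proof (intro bound inj_on_line_end notI)
      fix x y assume *: "x \<in> up i" "y \<in> up i" "x(i := 1) = y(i := 1)" "x i < y i"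
      have "x(i := x i) \<in> C" "x(i := y i) \<in> C" using * upd[OF *(3)] by (auto simp: up_def)
      then have "x(i := Suc (x i)) \<in> C"
        using lc i * unfolding line_convex_def by (meson Suc_leI le_SucI order_refl)
      then show False using * by (simp add: up_def)
    qed (auto simp: up_def)
    moreover have "card (down i) \<le> n ^ (d - 1)"
    proof (intro bound inj_on_line_end notI)
      fix x y assume *: "x \<in> down i" "y \<in> down i" "x(i := 1) = y(i := 1)" "x i < y i"
      have y: "y = x(i := y i)" by (rule upd[OF *(3)])
      have "x(i := x i) \<in> C" "x(i := y i) \<in> C" using * y by (auto simp: down_def)
      moreover have "x i \<le> y i - 1" "y i - 1 \<le> y i" using * by auto
      ultimately have "x(i := y i - 1) \<in> C"
        using lc i unfolding line_convex_def by blast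
      moreover have "y(i := y i - 1) = x(i := y i - 1)" by (subst (1) y) simp
      ultimately show False using * by (simp add: down_def)
    qed (auto simp: down_def)
    ultimately show "card (up i \<union> down i) \<le> 2 * n ^ (d - 1)"
      using card_Un_le[of "up i" "down i"] by linarith
  qed
  also have "\<dots> = 2 * d * n ^ (d - 1)" by simp
  finally show ?thesis using fin by (auto simp: boundary_def)
qed

definition vicinity :: "nat \<Rightarrow> nat \<Rightarrow> point set \<Rightarrow> point set" where
  "vicinity n d C = (\<Union>x\<in>boundary d C. king_box n d x)"

lemma card_vicinity:
  assumes "region n d C"
  shows "finite (vicinity n d C) \<and> card (vicinity n d C) \<le> 2 * d * n ^ (d - 1) * 3 ^ d"
proof -
  have "card (vicinity n d C) \<le> (\<Sum>x\<in>boundary d C. card (king_box n d x))"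
    unfolding vicinity_def using card_boundary[OF assms] by (intro card_UN_le) auto
  also have "\<dots> \<le> (\<Sum>x\<in>boundary d C. 3 ^ d)" by (intro sum_mono) (use card_king_box in blast)
  also have "\<dots> \<le> 2 * d * n ^ (d - 1) * 3 ^ d" using card_boundary[OF assms] by simp
  finally show ?thesis using card_boundary[OF assms] card_king_box by (simp add: vicinity_def)
qed

text \<open>Every query falls into one set that does not depend on \<open>K\<close> and was not
  queried before, so the size of that set bounds the number of queries.\<close>

lemma unexplored_subset: "unexplored n d C K \<subseteq> vicinity n d C - K"
  by (auto simp: unexplored_def exposed_def vicinity_def boundary_def)

lemma unexplored_in_grid: "unexplored n d C K \<subseteq> grid n d"
  by (auto simp: unexplored_def king_box_def)

section \<open>The reconstruction procedure and its queries\<close>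

lemma uses_at_most_mono:
  assumes "uses_at_most X m q A" "m \<le> m'" "q \<le> q'"
  shows "uses_at_most X m' q' A"
  using assms
proof (induction arbitrary: m' q' rule: uses_at_most.induct)
  case (2 m q k)
  then obtain m'' where "m' = Suc m''" by (cases m') auto
  then show ?case using 2 by (auto intro!: uses_at_most.intros(2))
next
  case (3 x m q k)
  then obtain q'' where "q' = Suc q''" by (cases q') auto
  then show ?case using 3 by (auto intro!: uses_at_most.intros(3))
qed (auto intro: uses_at_most.intros)

lemma cell_of_eq:
  assumes "is_clustering X cl" "C \<in> fst cl" "x \<in> C"
  shows "cell_of cl x = C"
  unfolding cell_of_def using assms
  by (intro the_equality) (auto simp: is_clustering_def partition_on_def disjoint_def)

lemma cell_of_in:
  assumes "is_clustering X cl" "x \<in> X"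
  shows "cell_of cl x \<in> fst cl" "x \<in> cell_of cl x" "cell_of cl x \<subseteq> X"
    "label cl x \<in> cell_of cl x" "label cl x \<in> X"
proof -
  obtain C where "C \<in> fst cl" "x \<in> C"
    using assms by (auto simp: is_clustering_def partition_on_def)
  then show *: "cell_of cl x \<in> fst cl" "x \<in> cell_of cl x" using cell_of_eq[OF assms(1)] by auto
  then show "cell_of cl x \<subseteq> X" "label cl x \<in> cell_of cl x"
    using assms by (auto simp: is_clustering_def partition_on_def label_def)
  then show "label cl x \<in> X" by blast
qed

text \<open>Each representative lies in its own cell, so different cells have different
  representatives and one label query decides membership.\<close>

lemma label_eq_iff:
  assumes "is_clustering X cl" "x \<in> X" "C \<in> fst cl"
  shows "label cl x = snd cl C \<longleftrightarrow> x \<in> C"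
proof
  assume "label cl x = snd cl C"
  then have "cell_of cl x = C"
    using cell_of_eq[OF assms(1), of _ "label cl x"] cell_of_in[OF assms(1,2)] assms
    by (metis is_clustering_def)
  then show "x \<in> C" using cell_of_in[OF assms(1,2)] by simp
qed (use cell_of_eq[OF assms(1,3)] in \<open>simp add: label_def\<close>)

text \<open>Only queries are counted, so the cell may simply be chosen among the regions compatible with the
  answers; by \<open>region_determined\<close> there is only one.\<close>

definition decode :: "nat \<Rightarrow> nat \<Rightarrow> point \<Rightarrow> point set \<Rightarrow> point set \<Rightarrow> point set" where
  "decode n d r I K = (SOME C. region n d C \<and> r \<in> C \<and> C \<inter> K = I)"

text \<open>\<open>I\<close> collects the members found so far and \<open>K\<close> all points whose
  status is known. The fuel makes the recursion primitive and is at the same time the query budget;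
  the label \<open>r\<close> serves as the mark of membership.\<close>

primrec explore :: "nat \<Rightarrow> nat \<Rightarrow> point \<Rightarrow> nat \<Rightarrow> point set \<Rightarrow> point set \<Rightarrow>
    (point set \<Rightarrow> point algo) \<Rightarrow> point algo" where
  "explore n d r 0 I K k = k (decode n d r I K)"
| "explore n d r (Suc f) I K k =
    (if unexplored n d I K = {} then k (decode n d r I K)
     else let y = (SOME y. y \<in> unexplored n d I K) in
       Query y (\<lambda>l. explore n d r f (if l = r then insert y I else I) (insert y K) k))"

lemma decode_eq:
  assumes "0 < d" "region n d C" "unexplored n d C K = {}" "r \<in> C" "line_known n C K r"
  shows "decode n d r (C \<inter> K) K = C"
  unfolding decode_def
proof (rule some_equality)
  show "C' = C" if "region n d C' \<and> r \<in> C' \<and> C' \<inter> K = C \<inter> K" for C'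
    using that assms region_determined[of d n C K C' r] by simp
qed (use assms in simp)

lemma line_known_mono: "line_known n C K x \<Longrightarrow> K \<subseteq> K' \<Longrightarrow> line_known n C K' x"
  unfolding line_known_def known_def by blast

text \<open>The number of points of the vicinity outside \<open>K\<close> drops with every query,
  and the members found are always \<open>C \<inter> K\<close>. When the fuel is exhausted, the
  whole vicinity is known and nothing remains unexplored.\<close>

lemma run_explore:
  assumes d: "0 < d" and cl: "cl \<in> CC n d" "C \<in> fst cl"
    and "line_known n C K (snd cl C)" "card (vicinity n d C - K) \<le> f"
  shows "run_algo cl \<mu> (explore n d (snd cl C) f (C \<inter> K) K k) = run_algo cl \<mu> (k C)"
  using assms(4,5)
proof (induction f arbitrary: K)
  case 0
  have reg: "region n d C" using CC_region cl by blast
  have r: "snd cl C \<in> C" using cl by (auto simp: CC_def is_clustering_def)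
  have "vicinity n d C - K = {}" using 0 card_vicinity[OF reg] by simp
  then have "unexplored n d C K = {}" using unexplored_subset[of n d C K] by auto
  then show ?case using decode_eq[OF d reg _ r] 0 by simp
next
  case (Suc f)
  have reg: "region n d C" using CC_region cl by blast
  have r: "snd cl C \<in> C" using cl by (auto simp: CC_def is_clustering_def)
  have un: "unexplored n d (C \<inter> K) K = unexplored n d C K"
    using reg by (intro unexplored_Int) (simp add: region_def)
  show ?case
  proof (cases "unexplored n d C K = {}")
    case True
    then show ?thesis using decode_eq[OF d reg _ r] Suc un by simp
  next
    case False
    define y where "y = (SOME y. y \<in> unexplored n d C K)"
    have y: "y \<in> unexplored n d C K" using False unfolding y_def by (rule some_in_eq[THEN iffD2])
    then have y': "y \<in> grid n d" "y \<in> vicinity n d C - K"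
      using unexplored_in_grid unexplored_subset by blast+
    have "vicinity n d C - insert y K = (vicinity n d C - K) - {y}" by blast
    then have "card (vicinity n d C - insert y K) = card (vicinity n d C - K) - 1"
      using y'(2) by simp
    then have "card (vicinity n d C - insert y K) \<le> f" using Suc.prems by simp
    moreover have "line_known n C (insert y K) (snd cl C)"
      using Suc.prems line_known_mono by blast
    ultimately have IH: "run_algo cl \<mu> (explore n d (snd cl C) f (C \<inter> insert y K) (insert y K) k) = run_algo cl \<mu> (k C)"
      using Suc.IH by blast
    have "label cl y = snd cl C \<longleftrightarrow> y \<in> C"
      using label_eq_iff[of "grid n d" cl y C] cl y' by (auto simp: CC_def)
    then have "(if label cl y = snd cl C then insert y (C \<inter> K) else C \<inter> K) = C \<inter> insert y K"
      by auto
    with False IH show ?thesis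
      by (simp only: explore.simps un if_False Let_def y_def[symmetric] run_algo.simps)
  qed
qed

text \<open>The budget has to hold for all answers in the grid, including those of no clustering,
  after which \<open>decode\<close> may return any set. Hence the continuation is bounded for every
  \<open>S\<close>.\<close>

lemma uses_explore:
  assumes "\<And>S. uses_at_most (grid n d) m q (k S)"
  shows "uses_at_most (grid n d) m (q + f) (explore n d r f I K k)"
proof (induction f arbitrary: I K)
  case 0
  then show ?case using assms by simp
next
  case (Suc f)
  show ?case
  proof (cases "unexplored n d I K = {}")
    case True
    then show ?thesis using uses_at_most_mono[OF assms] by simp
  next
    case False
    then have "(SOME y. y \<in> unexplored n d I K) \<in> grid n d"
      using unexplored_in_grid some_in_eq by blast
    then show ?thesis using False Suc by (auto simp: Let_def intro!: uses_at_most.intros(3))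
  qed
qed

section \<open>Binary search for the ends of a line\<close>

primrec bsearch :: "point \<Rightarrow> (nat \<Rightarrow> point) \<Rightarrow> nat \<Rightarrow> nat \<Rightarrow> nat \<Rightarrow> (nat \<Rightarrow> point algo) \<Rightarrow> point algo" where
  "bsearch r g 0 lo hi k = k lo"
| "bsearch r g (Suc f) lo hi k =
    (if hi \<le> Suc lo then k lo
     else let mid = (lo + hi) div 2 in
       Query (g mid) (\<lambda>l. if l = r then bsearch r g f mid hi k else bsearch r g f lo mid k))"

text \<open>Position \<open>lo\<close> is always inside and \<open>hi\<close> always outside; the
  last inside position \<open>e\<close> stays between them while the gap of at most
  \<open>2 ^ f\<close> is halved.\<close>

lemma run_bsearch:
  assumes "\<And>s. lo < s \<Longrightarrow> s < hi \<Longrightarrow> label cl (g s) = r \<longleftrightarrow> s \<le> e"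
    and "lo \<le> e" "e < hi" "hi - lo \<le> 2 ^ f"
  shows "run_algo cl \<mu> (bsearch r g f lo hi k) = run_algo cl \<mu> (k e)"
  using assms
proof (induction f arbitrary: lo hi)
  case 0
  then have "lo = e" by simp
  then show ?case by simp
next
  case (Suc f)
  show ?case
  proof (cases "hi \<le> Suc lo")
    case True
    then have "lo = e" using Suc.prems by simp
    then show ?thesis using True by simp
  next
    case False
    define mid where "mid = (lo + hi) div 2"
    have mid: "lo < mid" "mid < hi" "hi - mid \<le> 2 ^ f" "mid - lo \<le> 2 ^ f"
      using False Suc.prems(4) by (auto simp: mid_def)
    show ?thesis
    proof (cases "mid \<le> e")
      case True
      then show ?thesis using False mid Suc by (simp add: Let_def mid_def[symmetric])
    next
      case False
      then show ?thesis using \<open>\<not> hi \<le> Suc lo\<close> mid Suc by (simp add: Let_def mid_def[symmetric])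
    qed
  qed
qed

lemma uses_bsearch:
  assumes "\<And>s. lo < s \<Longrightarrow> s < hi \<Longrightarrow> g s \<in> X" "\<And>e. uses_at_most X m q (k e)"
  shows "uses_at_most X m (q + f) (bsearch r g f lo hi k)"
  using assms(1)
proof (induction f arbitrary: lo hi)
  case 0
  then show ?case using assms(2) by simp
next
  case (Suc f)
  show ?case
  proof (cases "hi \<le> Suc lo")
    case True
    then show ?thesis using uses_at_most_mono[OF assms(2)] by simp
  next
    case False
    define mid where "mid = (lo + hi) div 2"
    have mid: "lo < mid" "mid < hi" using False by (auto simp: mid_def)
    then show ?thesis using False Suc
      by (auto simp: Let_def mid_def[symmetric] intro!: uses_at_most.intros(3))
  qed
qed

text \<open>The second search finds the lower end as the upper end of the reflected line, under s ->
  n + 1 - s. The positions just beyond the ends enter \<open>K\<close> without further queries,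
  since the searches have shown that they are outside. The fuel of the exploration is the bound of
  \<open>card_vicinity\<close>.\<close>

definition locate :: "nat \<Rightarrow> nat \<Rightarrow> point \<Rightarrow> (point set \<Rightarrow> point algo) \<Rightarrow> point algo" where
  "locate n d r k =
    (let f = nat \<lceil>log 2 (real n)\<rceil> in
     bsearch r (\<lambda>s. r(0 := s)) f (r 0) (Suc n) (\<lambda>b.
     bsearch r (\<lambda>s. r(0 := Suc n - s)) f (Suc n - r 0) (Suc n) (\<lambda>a'.
     let a = Suc n - a' in
     explore n d r (2 * d * n ^ (d - 1) * 3 ^ d) {r(0 := a), r(0 := b)}
       {r(0 := a), r(0 := b), r(0 := a - 1), r(0 := Suc b)} k)))"

definition locate_cost :: "nat \<Rightarrow> nat \<Rightarrow> nat" where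
  "locate_cost n d = 2 * nat \<lceil>log 2 (real n)\<rceil> + 2 * d * n ^ (d - 1) * 3 ^ d"

lemma run_locate:
  assumes d: "0 < d" and cl: "cl \<in> CC n d" "C \<in> fst cl"
  shows "run_algo cl \<mu> (locate n d (snd cl C) k) = run_algo cl \<mu> (k C)"
proof -
  define r where "r = snd cl C"
  define f where "f = nat \<lceil>log 2 (real n)\<rceil>"
  have reg: "region n d C" using CC_region cl by blast
  have Cg: "C \<subseteq> grid n d" using reg by (simp add: region_def)
  have r: "r \<in> C" "r \<in> grid n d" using cl Cg by (auto simp: CC_def is_clustering_def r_def)
  have r0: "1 \<le> r 0" "r 0 \<le> n" using grid_bounds[OF r(2) d] by auto
  have "log 2 (real n) \<le> real f" unfolding f_def by linarith
  then have "2 powr (log 2 (real n)) \<le> 2 powr real f" by simp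
  then have "real n \<le> 2 ^ f" using r0 by (simp add: powr_realpow)
  then have nf: "n \<le> 2 ^ f" by (metis of_nat_le_iff of_nat_numeral of_nat_power)
  obtain a b where ab: "a \<le> int (r 0)" "int (r 0) \<le> b" "\<And>s. on_line C r s \<longleftrightarrow> a \<le> s \<and> s \<le> b"
    using line_ends[OF reg d, of r "int (r 0)"] r(1) by auto
  have "on_line C r a" "on_line C r b" using ab by auto
  then have bnds: "1 \<le> a" "b \<le> int n" using on_line_bounds[OF Cg d] by blast+
  have line: "r(0 := s) \<in> C \<longleftrightarrow> nat a \<le> s \<and> s \<le> nat b" for s
    using ab(3)[of "int s"] bnds by (auto simp: on_line_def)
  have lab: "label cl (r(0 := s)) = r \<longleftrightarrow> nat a \<le> s \<and> s \<le> nat b" if "1 \<le> s" "s \<le> n" for s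
    using label_eq_iff[of "grid n d" cl "r(0 := s)" C] grid_fun_upd_iff[OF r(2) d] that cl line
    by (auto simp: CC_def r_def)
  let ?K = "{r(0 := nat a), r(0 := nat b), r(0 := nat a - 1), r(0 := Suc (nat b))}"
  have K: "C \<inter> ?K = {r(0 := nat a), r(0 := nat b)}"
    using line ab(1,2) bnds by auto
  have lk: "line_known n C ?K r"
    unfolding line_known_def
  proof (rule exI[of _ a], rule exI[of _ b], intro conjI)
    have "nat (a - 1) = nat a - 1" "nat (b + 1) = Suc (nat b)" using ab bnds by auto
    then show "known n ?K r a" "known n ?K r (a - 1)" "known n ?K r b" "known n ?K r (b + 1)"
      by (auto simp: known_def)
  qed (use ab in auto)
  have e: "Suc n - (Suc n - nat a) = nat a" using bnds ab by linarith
  have "run_algo cl \<mu> (locate n d r k) =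
    run_algo cl \<mu> (bsearch r (\<lambda>s. r(0 := Suc n - s)) f (Suc n - r 0) (Suc n) (\<lambda>a'.
     let a = Suc n - a' in
     explore n d r (2 * d * n ^ (d - 1) * 3 ^ d) {r(0 := a), r(0 := nat b)}
       {r(0 := a), r(0 := nat b), r(0 := a - 1), r(0 := Suc (nat b))} k))"
    unfolding locate_def f_def[symmetric] Let_def
    by (subst run_bsearch[where e = "nat b"]) (use lab ab bnds r0 nf in auto)
  also have "\<dots> = run_algo cl \<mu> (explore n d r (2 * d * n ^ (d - 1) * 3 ^ d) (C \<inter> ?K) ?K k)"
    unfolding K
    by (subst run_bsearch[where e = "Suc n - nat a"])
      (use lab ab bnds r0 nf e in \<open>auto simp: Let_def\<close>)
  also have "\<dots> = run_algo cl \<mu> (k C)"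
    unfolding r_def
  proof (rule run_explore[OF d cl])
    show "line_known n C {(snd cl C)(0 := nat a), (snd cl C)(0 := nat b), (snd cl C)(0 := nat a - 1),
        (snd cl C)(0 := Suc (nat b))} (snd cl C)"
      using lk unfolding r_def .
    have "card (vicinity n d C - K) \<le> card (vicinity n d C)" for K
      using card_vicinity[OF reg] by (intro card_mono) auto
    then show "card (vicinity n d C - {(snd cl C)(0 := nat a), (snd cl C)(0 := nat b),
        (snd cl C)(0 := nat a - 1), (snd cl C)(0 := Suc (nat b))}) \<le> 2 * d * n ^ (d - 1) * 3 ^ d"
      using card_vicinity[OF reg] le_trans by blast
  qed
  finally show ?thesis unfolding r_def .
qed

lemma uses_locate:
  assumes d: "0 < d" and r: "r \<in> grid n d" and k: "\<And>S. uses_at_most (grid n d) m q (k S)"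
  shows "uses_at_most (grid n d) m (q + locate_cost n d) (locate n d r k)"
proof -
  have r0: "1 \<le> r 0" using grid_bounds[OF r d] by auto
  have *: "q + locate_cost n d = q + 2 * d * n ^ (d - 1) * 3 ^ d + nat \<lceil>log 2 (real n)\<rceil> + nat \<lceil>log 2 (real n)\<rceil>"
    by (simp add: locate_cost_def)
  show ?thesis unfolding locate_def Let_def *
    by (intro uses_bsearch uses_explore k) (use r0 in \<open>auto simp: grid_fun_upd_iff[OF r d]\<close>)
qed

text \<open>The factor \<open>d\<close> disappears in the exponential through
  \<open>d \<le> 2 ^ d\<close>. Rounding the two logarithms up costs 2, which is charged to the
  power of \<open>n\<close> because \<open>log 2 n\<close> vanishes for
  \<open>n = 1\<close>.\<close>

lemma locate_cost_bound:
  assumes "1 \<le> n" "1 \<le> d"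
  shows "real (locate_cost n d) \<le> 2 powr (3 * real d) * (4 * real n ^ (d - 1)) + 2 * log 2 (real n)"
proof -
  have log: "log 2 (real n) \<ge> 0" using assms by simp
  have n1: "1 \<le> real n ^ (d - 1)" using assms by (intro one_le_power) simp
  have d2: "real d \<le> 2 ^ d" using of_nat_less_two_power[of d] by (metis less_imp_le of_nat_le_iff of_nat_numeral of_nat_power)
  have "real d * 3 ^ d \<le> 2 ^ d * 4 ^ d" by (intro mult_mono d2 power_mono) auto
  then have d8: "real d * 3 ^ d \<le> 8 ^ d" by (simp add: power_mult_distrib[symmetric])
  have p: "2 powr (3 * real d) = 8 ^ d"
    by (simp add: powr_powr[symmetric] powr_realpow)
  have "real (nat \<lceil>log 2 (real n)\<rceil>) \<le> log 2 (real n) + 1"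
    using log by linarith
  then have "real (locate_cost n d) \<le> 2 * log 2 (real n) + 2 + 2 * (real d * 3 ^ d) * real n ^ (d - 1)"
    unfolding locate_cost_def by (simp add: algebra_simps)
  also have "\<dots> \<le> 2 * log 2 (real n) + 2 * (8 ^ d * real n ^ (d - 1)) + 2 * 8 ^ d * real n ^ (d - 1)"
  proof -
    have "1 * 1 \<le> 8 ^ d * real n ^ (d - 1)" by (intro mult_mono n1) auto
    moreover have "2 * (real d * 3 ^ d) * real n ^ (d - 1) \<le> 2 * 8 ^ d * real n ^ (d - 1)"
      by (intro mult_right_mono mult_left_mono d8) auto
    ultimately show ?thesis by linarith
  qed
  finally show ?thesis unfolding p by (simp add: algebra_simps)
qed

section \<open>A quadratic statistic\<close>

abbreviation E :: "'a pmf \<Rightarrow> ('a \<Rightarrow> real) \<Rightarrow> real" where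
  "E p f \<equiv> measure_pmf.expectation p f"

context
  fixes p :: "'a pmf"
  assumes fin: "finite (set_pmf p)"
begin

lemma int_fin: "integrable (measure_pmf p) (f :: 'a \<Rightarrow> real)"
  by (rule integrable_measure_pmf_finite[OF fin])

lemma E_add: "E p (\<lambda>x. f x + g x) = E p f + E p g"
  by (simp add: int_fin)

lemma E_diff: "E p (\<lambda>x. f x - g x) = E p f - E p g"
  by (simp add: int_fin)

lemma E_mono: "(\<And>x. x \<in> set_pmf p \<Longrightarrow> f x \<le> g x) \<Longrightarrow> E p f \<le> E p g"
  by (intro integral_mono_AE int_fin) (simp add: AE_measure_pmf_iff)

lemma E_bind:
  assumes "\<And>x. x \<in> set_pmf p \<Longrightarrow> finite (set_pmf (F x))"
  shows "E (bind_pmf p F) g = E p (\<lambda>x. E (F x) g)"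
  by (subst pmf_expectation_bind[OF fin assms], assumption, simp)
    (simp add: integral_measure_pmf[OF fin])

lemma E_swap:
  assumes "finite (set_pmf q)"
  shows "E p (\<lambda>x. E q (\<lambda>y. f x y)) = E q (\<lambda>y. E p (\<lambda>x. f x y))"
proof -
  have "E p (\<lambda>x. E q (\<lambda>y. f x y)) = (\<Sum>x\<in>set_pmf p. \<Sum>y\<in>set_pmf q. pmf p x * (pmf q y * f x y))"
    by (simp add: integral_measure_pmf[OF fin] integral_measure_pmf[OF assms] sum_distrib_left)
  also have "\<dots> = (\<Sum>y\<in>set_pmf q. \<Sum>x\<in>set_pmf p. pmf p x * (pmf q y * f x y))"
    by (rule sum.swap)
  also have "\<dots> = E q (\<lambda>y. E p (\<lambda>x. f x y))"
    by (simp add: integral_measure_pmf[OF fin] integral_measure_pmf[OF assms] sum_distrib_left mult_ac)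
  finally show ?thesis .
qed

lemma markov_pmf:
  assumes "\<And>x. x \<in> set_pmf p \<Longrightarrow> 0 \<le> f x" "\<And>x. x \<in> set_pmf p \<Longrightarrow> x \<in> A \<Longrightarrow> c \<le> f x" "0 < c"
  shows "measure_pmf.prob p A \<le> E p f / c"
proof -
  have "measure_pmf.prob p A = E p (indicator A)" by simp
  also have "\<dots> \<le> E p (\<lambda>x. f x / c)"
    by (rule E_mono) (use assms in \<open>auto simp: indicator_def divide_simps\<close>)
  finally show ?thesis by simp
qed

lemma finite_replicate: "finite (set_pmf (replicate_pmf m p))"
proof -
  have "set_pmf (replicate_pmf m p) = {xs. set xs \<subseteq> set_pmf p \<and> length xs = m}"
    by (auto simp: set_replicate_pmf)
  then show ?thesis using finite_lists_length_eq[OF fin] by simp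
qed

end

section \<open>Moments of sums and double sums over independent samples\<close>

lemma replicate_moments:
  assumes fin: "finite (set_pmf p)"
  shows "E (replicate_pmf m p) (\<lambda>xs. \<Sum>x\<leftarrow>xs. g x) = m * E p g"
    and "E (replicate_pmf m p) (\<lambda>xs. (\<Sum>x\<leftarrow>xs. g x)\<^sup>2) =
      m * E p (\<lambda>x. (g x)\<^sup>2) + m * (real m - 1) * (E p g)\<^sup>2"
\<comment> \<open>Both claims are proved together: expanding the square after one further sample
  produces the first moment of the rest.\<close>
proof (induction m)
  case 0
  { case 1 then show ?case by simp next case 2 then show ?case by simp }
next
  case (Suc m)
  let ?R = "replicate_pmf m p"
  note finR = finite_replicate[OF fin, of m]
  have step: "E (replicate_pmf (Suc m) p) f = E p (\<lambda>x. E ?R (\<lambda>xs. f (x # xs)))" for f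
  proof -
    have "E (replicate_pmf (Suc m) p) f = E p (\<lambda>x. E (bind_pmf ?R (\<lambda>xs. return_pmf (x # xs))) f)"
      unfolding replicate_pmf.simps by (rule E_bind[OF fin]) (simp add: finR)
    also have "\<dots> = E p (\<lambda>x. E ?R (\<lambda>xs. f (x # xs)))"
      by (simp add: E_bind[OF finR])
    finally show ?thesis .
  qed
  {
    case 1
    show ?case unfolding step
      by (simp add: E_add[OF finR] E_add[OF fin] Suc algebra_simps)
  next
    case 2
    have "(\<Sum>y\<leftarrow>x # xs. g y)\<^sup>2 = (g x)\<^sup>2 + (2 * g x * (\<Sum>y\<leftarrow>xs. g y) + (\<Sum>y\<leftarrow>xs. g y)\<^sup>2)" for x xs
      by (simp add: power2_eq_square algebra_simps)
    then have "E (replicate_pmf (Suc m) p) (\<lambda>xs. (\<Sum>x\<leftarrow>xs. g x)\<^sup>2) =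
      E p (\<lambda>x. E ?R (\<lambda>xs. (g x)\<^sup>2 + (2 * g x * (\<Sum>y\<leftarrow>xs. g y) + (\<Sum>y\<leftarrow>xs. g y)\<^sup>2)))"
      unfolding step by simp
    also have "\<dots> = E p (\<lambda>x. (g x)\<^sup>2 + (2 * (m * E p g) * g x +
        (m * E p (\<lambda>x. (g x)\<^sup>2) + m * (real m - 1) * (E p g)\<^sup>2)))"
      by (simp add: E_add[OF finR] Suc mult_ac)
    also have "\<dots> = E p (\<lambda>x. (g x)\<^sup>2) + (2 * (m * E p g) * E p g +
        (m * E p (\<lambda>x. (g x)\<^sup>2) + m * (real m - 1) * (E p g)\<^sup>2))"
      by (simp add: E_add[OF fin])
    also have "\<dots> = Suc m * E p (\<lambda>x. (g x)\<^sup>2) + Suc m * (real (Suc m) - 1) * (E p g)\<^sup>2"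
      by (simp add: power2_eq_square algebra_simps)
    finally show ?case .
  }
qed

lemma replicate_second_moment:
  assumes fin: "finite (set_pmf p)"
  shows "E (replicate_pmf m p) (\<lambda>xs. (\<Sum>x\<leftarrow>xs. g x)\<^sup>2) \<le> m * E p (\<lambda>x. (g x)\<^sup>2) + (real m)\<^sup>2 * (E p g)\<^sup>2"
proof -
  have "m * (real m - 1) * (E p g)\<^sup>2 \<le> m\<^sup>2 * (E p g)\<^sup>2"
    by (intro mult_right_mono) (auto simp: power2_eq_square algebra_simps)
  then show ?thesis using replicate_moments(2)[OF fin, of m g] by simp
qed

lemma replicate_variance:
  assumes fin: "finite (set_pmf p)"
  shows "E (replicate_pmf m p) (\<lambda>xs. ((\<Sum>x\<leftarrow>xs. g x) - m * E p g)\<^sup>2) \<le> m * E p (\<lambda>x. (g x)\<^sup>2)"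
proof -
  let ?R = "replicate_pmf m p" and ?c = "m * E p g"
  note finR = finite_replicate[OF fin, of m]
  have "E ?R (\<lambda>xs. ((\<Sum>x\<leftarrow>xs. g x) - ?c)\<^sup>2) =
      E ?R (\<lambda>xs. (\<Sum>x\<leftarrow>xs. g x)\<^sup>2 + (?c\<^sup>2 - 2 * ?c * (\<Sum>x\<leftarrow>xs. g x)))"
    by (intro Bochner_Integration.integral_cong refl) (simp add: power2_eq_square algebra_simps)
  also have "\<dots> = m * E p (\<lambda>x. (g x)\<^sup>2) - m * (E p g)\<^sup>2"
    by (simp add: E_add[OF finR] E_diff[OF finR] replicate_moments[OF fin])
      (simp add: power2_eq_square algebra_simps)
  finally show ?thesis by simp
qed

text \<open>Two separate batches take the place of all pairs from one batch. There are no diagonal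
  terms to exclude, and for fixed \<open>xs\<close> this is a sum of independent terms over
  \<open>ys\<close>.\<close>

definition cross_sum :: "('a \<Rightarrow> 'a \<Rightarrow> real) \<Rightarrow> 'a list \<Rightarrow> 'a list \<Rightarrow> real" where
  "cross_sum h xs ys = (\<Sum>y\<leftarrow>ys. \<Sum>x\<leftarrow>xs. h x y)"

lemma E_sum_list:
  assumes "finite (set_pmf p)"
  shows "E p (\<lambda>y. \<Sum>x\<leftarrow>xs. h x y) = (\<Sum>x\<leftarrow>xs. E p (h x))"
  by (induction xs) (simp_all add: E_add[OF assms])

text \<open>The deviation splits into the fluctuation of \<open>ys\<close> around its conditional
  mean \<open>m * S xs\<close> and the fluctuation of that mean. Each part is the variance of a sum
  of independent terms; \<open>V\<close> bounds the one-sided projections of \<open>h\<close> and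
  \<open>H\<close> its full second moment.\<close>

lemma cross_sum_deviation:
  fixes h :: "'a \<Rightarrow> 'a \<Rightarrow> real"
  assumes fin: "finite (set_pmf p)"
    and V: "E p (\<lambda>x. (E p (\<lambda>y. h x y))\<^sup>2) \<le> V" "E p (\<lambda>y. (E p (\<lambda>x. h x y))\<^sup>2) \<le> V"
    and H: "E p (\<lambda>x. E p (\<lambda>y. (h x y)\<^sup>2)) \<le> H"
  shows "E (pair_pmf (replicate_pmf m p) (replicate_pmf m p))
      (\<lambda>(xs, ys). (cross_sum h xs ys - (real m)\<^sup>2 * E p (\<lambda>x. E p (\<lambda>y. h x y)))\<^sup>2)
    \<le> 2 * (real m)\<^sup>2 * H + 4 * real m ^ 3 * V"
proof -
  let ?R = "replicate_pmf m p"
  define \<theta> where "\<theta> = E p (\<lambda>x. E p (\<lambda>y. h x y))"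
  define a where "a x = E p (\<lambda>y. h x y)" for x
  define b where "b y = E p (\<lambda>x. h x y)" for y
  note finR = finite_replicate[OF fin, of m]
  have pair: "E (pair_pmf ?R ?R) f = E ?R (\<lambda>xs. E ?R (\<lambda>ys. f (xs, ys)))" for f
  proof -
    have "E (pair_pmf ?R ?R) f = E ?R (\<lambda>xs. E (bind_pmf ?R (\<lambda>ys. return_pmf (xs, ys))) f)"
      unfolding pair_pmf_def by (rule E_bind[OF finR]) (simp add: finR)
    also have "\<dots> = E ?R (\<lambda>xs. E ?R (\<lambda>ys. f (xs, ys)))"
      by (simp add: E_bind[OF finR])
    finally show ?thesis .
  qed
  define S where "S xs = (\<Sum>x\<leftarrow>xs. a x)" for xs
  have Eg: "E p (\<lambda>y. \<Sum>x\<leftarrow>xs. h x y) = S xs" for xs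
    unfolding S_def a_def by (rule E_sum_list[OF fin])
  have first: "E ?R (\<lambda>ys. (cross_sum h xs ys - m * S xs)\<^sup>2) \<le> m * E p (\<lambda>y. (\<Sum>x\<leftarrow>xs. h x y)\<^sup>2)" for xs
    using replicate_variance[OF fin, of m "\<lambda>y. \<Sum>x\<leftarrow>xs. h x y"] unfolding Eg cross_sum_def .
  have "E ?R (\<lambda>xs. E p (\<lambda>y. (\<Sum>x\<leftarrow>xs. h x y)\<^sup>2)) = E p (\<lambda>y. E ?R (\<lambda>xs. (\<Sum>x\<leftarrow>xs. h x y)\<^sup>2))"
    by (rule E_swap[OF finR fin])
  also have "\<dots> \<le> E p (\<lambda>y. m * E p (\<lambda>x. (h x y)\<^sup>2) + m\<^sup>2 * (b y)\<^sup>2)"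
    unfolding b_def
  proof (rule E_mono[OF fin])
    show "E ?R (\<lambda>xs. (\<Sum>x\<leftarrow>xs. h x y)\<^sup>2) \<le> m * E p (\<lambda>x. (h x y)\<^sup>2) + m\<^sup>2 * (E p (\<lambda>x. h x y))\<^sup>2" for y
      using replicate_second_moment[OF fin, of m "\<lambda>x. h x y"] by simp
  qed
  also have "\<dots> = m * E p (\<lambda>y. E p (\<lambda>x. (h x y)\<^sup>2)) + m\<^sup>2 * E p (\<lambda>y. (b y)\<^sup>2)"
    by (simp add: E_add[OF fin])
  also have "\<dots> \<le> m * H + m\<^sup>2 * V"
    using V(2) H E_swap[OF fin fin, of "\<lambda>x y. (h x y)\<^sup>2"]
    by (intro add_mono mult_left_mono) (auto simp: b_def)
  finally have second: "E ?R (\<lambda>xs. E p (\<lambda>y. (\<Sum>x\<leftarrow>xs. h x y)\<^sup>2)) \<le> m * H + m\<^sup>2 * V" .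
  have "E ?R (\<lambda>xs. (S xs - m * \<theta>)\<^sup>2) \<le> m * E p (\<lambda>x. (a x)\<^sup>2)"
    using replicate_variance[OF fin, of m a] unfolding S_def \<theta>_def a_def .
  also have "\<dots> \<le> m * V" using V(1) unfolding a_def by (intro mult_left_mono) auto
  finally have third: "E ?R (\<lambda>xs. (S xs - m * \<theta>)\<^sup>2) \<le> m * V" .
  have "E (pair_pmf ?R ?R) (\<lambda>(xs, ys). (cross_sum h xs ys - m\<^sup>2 * \<theta>)\<^sup>2) =
      E ?R (\<lambda>xs. E ?R (\<lambda>ys. (cross_sum h xs ys - m\<^sup>2 * \<theta>)\<^sup>2))"
    unfolding pair by simp
  also have "\<dots> \<le> E ?R (\<lambda>xs. E ?R (\<lambda>ys. 2 * (cross_sum h xs ys - m * S xs)\<^sup>2 + 2 * m\<^sup>2 * (S xs - m * \<theta>)\<^sup>2))"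
  proof (intro E_mono[OF finR])
    fix xs ys
    have *: "(u + v)\<^sup>2 \<le> 2 * u\<^sup>2 + 2 * v\<^sup>2" for u v :: real
      using zero_le_power2[of "u - v"] by (simp add: power2_eq_square algebra_simps)
    show "(cross_sum h xs ys - m\<^sup>2 * \<theta>)\<^sup>2 \<le> 2 * (cross_sum h xs ys - m * S xs)\<^sup>2 + 2 * m\<^sup>2 * (S xs - m * \<theta>)\<^sup>2"
      using *[of "cross_sum h xs ys - m * S xs" "m * (S xs - m * \<theta>)"]
      by (simp add: power_mult_distrib) (simp add: power2_eq_square algebra_simps)
  qed
  also have "\<dots> \<le> E ?R (\<lambda>xs. 2 * (m * E p (\<lambda>y. (\<Sum>x\<leftarrow>xs. h x y)\<^sup>2)) + 2 * m\<^sup>2 * (S xs - m * \<theta>)\<^sup>2)"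
    using first by (intro E_mono[OF finR]) (simp add: E_add[OF finR])
  also have "\<dots> = 2 * m * E ?R (\<lambda>xs. E p (\<lambda>y. (\<Sum>x\<leftarrow>xs. h x y)\<^sup>2)) + 2 * m\<^sup>2 * E ?R (\<lambda>xs. (S xs - m * \<theta>)\<^sup>2)"
    by (simp add: E_add[OF finR])
  also have "\<dots> \<le> 2 * m * (m * H + m\<^sup>2 * V) + 2 * m\<^sup>2 * (m * V)"
    by (intro add_mono mult_left_mono second third) auto
  also have "\<dots> = 2 * m\<^sup>2 * H + 4 * m ^ 3 * V"
    by (simp add: power2_eq_square power3_eq_cube algebra_simps)
  finally show ?thesis unfolding \<theta>_def by simp
qed

section \<open>The chi-square kernel and its moments\<close>

text \<open>Mixing with the uniform distribution keeps both \<open>q / w\<close> and \<open>1 / w\<close> bounded.\<close>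

definition weight :: "nat \<Rightarrow> 'b pmf \<Rightarrow> 'b \<Rightarrow> real" where
  "weight k q j = (pmf q j + 1 / real k) / 2"

text \<open>The inner product with weights \<open>1 / w\<close> of the centred indicator vectors of
  \<open>x\<close> and \<open>y\<close>; for independent \<open>x\<close> and \<open>y\<close> its
  mean is the squared weighted distance \<open>chi2\<close>.\<close>

definition chi2_kernel :: "'b set \<Rightarrow> 'b pmf \<Rightarrow> 'b \<Rightarrow> 'b \<Rightarrow> real" where
  "chi2_kernel J q x y =
     (\<Sum>j\<in>J. (indicator {j} x - pmf q j) * (indicator {j} y - pmf q j) / weight (card J) q j)"

definition chi2 :: "'b set \<Rightarrow> 'b pmf \<Rightarrow> 'b pmf \<Rightarrow> real" where
  "chi2 J p q = (\<Sum>j\<in>J. (pmf p j - pmf q j)\<^sup>2 / weight (card J) q j)"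

context
  fixes J :: "'b set" and p q :: "'b pmf"
  assumes J: "finite J" and p: "set_pmf p \<subseteq> J" and q: "set_pmf q \<subseteq> J"
begin

private abbreviation (input) "k \<equiv> card J"
private abbreviation (input) "w \<equiv> weight k q"

lemma k_pos: "0 < k"
  using J p set_pmf_not_empty[of p] by (auto simp: card_gt_0_iff)

lemma w_pos: "0 < w j"
  using k_pos by (auto simp: weight_def intro!: divide_pos_pos add_nonneg_pos)

lemma inverse_w: "1 / w j \<le> 2 * real k"
proof -
  have "1 / (2 * real k) \<le> w j" by (simp add: weight_def)
  then have "1 / w j \<le> 1 / (1 / (2 * real k))"
    using k_pos by (intro divide_left_mono) (auto intro!: mult_pos_pos simp: w_pos)
  then show ?thesis by simp
qed

lemma q_over_w: "0 \<le> pmf q j / w j" "pmf q j / w j \<le> 2"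
  using w_pos[of j] by (auto simp: divide_simps) (simp add: weight_def)

lemma sum_w: "(\<Sum>j\<in>J. w j) = 1"
  using k_pos sum_pmf_eq_1[OF J q] by (simp add: weight_def sum.distrib sum_divide_distrib[symmetric])

lemma E_eq: "E p f = (\<Sum>j\<in>J. pmf p j * f j)"
  using p by (subst integral_measure_pmf[OF J]) auto

lemma fin_p: "finite (set_pmf p)"
  using finite_subset[OF p J] .

lemma E_indicator_diff: "E p (\<lambda>y. (indicator {j} y - c)) = pmf p j - c"
  by (simp add: E_diff[OF fin_p] pmf.rep_eq)

lemma kernel_commute: "chi2_kernel J q x y = chi2_kernel J q y x"
  by (simp add: chi2_kernel_def mult_ac)

lemma E_kernel: "E p (\<lambda>y. chi2_kernel J q x y) =
    (\<Sum>j\<in>J. (indicator {j} x - pmf q j) * (pmf p j - pmf q j) / w j)"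
proof -
  have "E p (\<lambda>y. chi2_kernel J q x y) =
    (\<Sum>j\<in>J. E p (\<lambda>y. (indicator {j} x - pmf q j) / w j * (indicator {j} y - pmf q j)))"
    unfolding chi2_kernel_def by (subst Bochner_Integration.integral_sum) (auto intro!: int_fin[OF fin_p])
  also have "\<dots> = (\<Sum>j\<in>J. (indicator {j} x - pmf q j) / w j * (pmf p j - pmf q j))"
    by (intro sum.cong refl) (subst integral_mult_right_zero, simp only: E_indicator_diff)
  finally show ?thesis by simp
qed

lemma E_E_kernel: "E p (\<lambda>x. E p (\<lambda>y. chi2_kernel J q x y)) = chi2 J p q"
proof -
  have "E p (\<lambda>x. E p (\<lambda>y. chi2_kernel J q x y)) =
    (\<Sum>j\<in>J. E p (\<lambda>x. (pmf p j - pmf q j) / w j * (indicator {j} x - pmf q j)))"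
    unfolding E_kernel by (subst Bochner_Integration.integral_sum)
      (auto intro!: int_fin[OF fin_p] sum.cong arg_cong[of _ _ "E p"])
  also have "\<dots> = (\<Sum>j\<in>J. (pmf p j - pmf q j) / w j * (pmf p j - pmf q j))"
    by (intro sum.cong refl) (subst integral_mult_right_zero, simp only: E_indicator_diff)
  finally show ?thesis by (simp add: chi2_def power2_eq_square)
qed

lemma chi2_nonneg: "0 \<le> chi2 J p q"
  unfolding chi2_def by (intro sum_nonneg divide_nonneg_pos w_pos) auto

text \<open>Cauchy-Schwarz after inserting \<open>sqrt (w j)\<close> on both sides; the weights sum
  to 1.\<close>

lemma chi2_ge: "(\<Sum>j\<in>J. \<bar>pmf p j - pmf q j\<bar>)\<^sup>2 \<le> chi2 J p q"
proof -
  have "(\<Sum>j\<in>J. \<bar>pmf p j - pmf q j\<bar>)\<^sup>2 = (\<Sum>j\<in>J. \<bar>pmf p j - pmf q j\<bar> / sqrt (w j) * sqrt (w j))\<^sup>2"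
    using w_pos by (intro arg_cong[of _ _ "\<lambda>x. x\<^sup>2"] sum.cong) (auto simp: less_imp_neq[THEN not_sym])
  also have "\<dots> \<le> (\<Sum>j\<in>J. (\<bar>pmf p j - pmf q j\<bar> / sqrt (w j))\<^sup>2) * (\<Sum>j\<in>J. (sqrt (w j))\<^sup>2)"
    by (rule Cauchy_Schwarz_ineq_sum)
  also have "\<dots> = chi2 J p q"
    using w_pos sum_w by (simp add: chi2_def power_divide less_imp_le)
  finally show ?thesis .
qed

text \<open>A pointwise bound that controls \<open>p / w\<close> through
  \<open>q / w \<le> 2\<close> when the projections are estimated under \<open>p\<close> instead of
  \<open>q\<close>.\<close>

lemma diff_over_w: "\<bar>pmf p j - pmf q j\<bar> / w j \<le> sqrt (2 * real k * chi2 J p q)" if "j \<in> J"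
proof -
  have "(\<bar>pmf p j - pmf q j\<bar> / w j)\<^sup>2 = 1 / w j * ((pmf p j - pmf q j)\<^sup>2 / w j)"
    by (simp add: power2_eq_square)
  also have "\<dots> \<le> (2 * real k) * chi2 J p q"
  proof (intro mult_mono inverse_w)
    show "(pmf p j - pmf q j)\<^sup>2 / w j \<le> chi2 J p q"
      unfolding chi2_def using w_pos by (intro member_le_sum that J) (auto simp: less_imp_le)
  qed (use w_pos in \<open>auto simp: less_imp_le\<close>)
  finally show ?thesis by (rule real_le_rsqrt)
qed

lemma sum_indicator_singleton: "x \<in> J \<Longrightarrow> (\<Sum>j\<in>J. indicator {j} x * f j) = f x" for f :: "'b \<Rightarrow> real"
  by (subst sum.remove[OF J]) (auto intro!: sum.neutral simp: indicator_def)

lemma sum_q_sq: "0 \<le> (\<Sum>j\<in>J. pmf q j * (pmf q j / w j))" "(\<Sum>j\<in>J. pmf q j * (pmf q j / w j)) \<le> 2"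
proof -
  have "(\<Sum>j\<in>J. pmf q j * (pmf q j / w j)) \<le> (\<Sum>j\<in>J. pmf q j * 2)"
    by (intro sum_mono mult_left_mono q_over_w) auto
  then show "(\<Sum>j\<in>J. pmf q j * (pmf q j / w j)) \<le> 2"
    using sum_pmf_eq_1[OF J q] by (simp add: sum_distrib_right[symmetric])
  show "0 \<le> (\<Sum>j\<in>J. pmf q j * (pmf q j / w j))"
    by (intro sum_nonneg mult_nonneg_nonneg q_over_w) auto
qed

text \<open>Up to a bounded error the kernel is diagonal with entries \<open>1 / w x\<close>, so its
  second moment is governed by the collision term, the sum of \<open>(p / w)\<^sup>2\<close>.
  Comparing \<open>p\<close> with \<open>q\<close> there leaves \<open>chi2\<close> times
  \<open>1 / w \<le> 2 * k\<close> and a constant for each \<open>j\<close>.\<close>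

lemma kernel_second_moment: "E p (\<lambda>x. E p (\<lambda>y. (chi2_kernel J q x y)\<^sup>2)) \<le> 8 * real k * chi2 J p q + 48 * real k"
proof -
  \<comment> \<open>The off-diagonal part consists of two terms between -2 and 0 and one between 0
    and 2.\<close>
  have ker: "\<bar>chi2_kernel J q x y - indicator {x} y / w x\<bar> \<le> 4" if xy: "x \<in> J" "y \<in> J" for x y
  proof -
    have "chi2_kernel J q x y = (\<Sum>j\<in>J. indicator {j} x * (indicator {j} y / w j) - indicator {j} x * (pmf q j / w j)
        - indicator {j} y * (pmf q j / w j) + pmf q j * (pmf q j / w j))"
      unfolding chi2_kernel_def by (intro sum.cong refl) (simp add: algebra_simps diff_divide_distrib add_divide_distrib)
    also have "\<dots> = indicator {x} y / w x - pmf q x / w x - pmf q y / w y + (\<Sum>j\<in>J. pmf q j * (pmf q j / w j))"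
      by (simp only: sum.distrib sum_subtractf sum_indicator_singleton[OF xy(1)] sum_indicator_singleton[OF xy(2)])
    finally show ?thesis using q_over_w[of x] q_over_w[of y] sum_q_sq by linarith
  qed
  have "E p (\<lambda>x. E p (\<lambda>y. (chi2_kernel J q x y)\<^sup>2)) \<le>
      E p (\<lambda>x. E p (\<lambda>y. 2 / (w x)\<^sup>2 * indicator {x} y + 32))"
  proof (intro E_mono[OF fin_p])
    fix x y assume "x \<in> set_pmf p" "y \<in> set_pmf p"
    define u where "u = chi2_kernel J q x y - indicator {x} y / w x"
    have "\<bar>u\<bar> \<le> 4" unfolding u_def using ker p \<open>x \<in> set_pmf p\<close> \<open>y \<in> set_pmf p\<close> by blast
    then have "u\<^sup>2 \<le> 16" using abs_le_square_iff[of u 4] by simp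
    moreover have "(chi2_kernel J q x y)\<^sup>2 = (indicator {x} y / w x + u)\<^sup>2" by (simp add: u_def)
    moreover have "(indicator {x} y / w x + u)\<^sup>2 \<le> 2 * (indicator {x} y / w x)\<^sup>2 + 2 * u\<^sup>2"
      using zero_le_power2[of "indicator {x} y / w x - u"] by (simp add: power2_sum power2_diff)
    moreover have "2 * (indicator {x} y / w x)\<^sup>2 = 2 / (w x)\<^sup>2 * indicator {x} y"
      by (simp add: indicator_def power_divide)
    ultimately show "(chi2_kernel J q x y)\<^sup>2 \<le> 2 / (w x)\<^sup>2 * indicator {x} y + 32" by linarith
  qed
  also have "\<dots> = E p (\<lambda>x. 2 / (w x)\<^sup>2 * pmf p x + 32)"
    by (simp add: E_add[OF fin_p] pmf.rep_eq)
  also have "\<dots> = (\<Sum>j\<in>J. pmf p j * (2 / (w j)\<^sup>2 * pmf p j)) + 32"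
    by (subst E_add[OF fin_p]) (simp add: E_eq)
  also have "\<dots> \<le> (\<Sum>j\<in>J. 8 * real k * ((pmf p j - pmf q j)\<^sup>2 / w j) + 16) + 32"
  proof (intro add_mono sum_mono order_refl)
    fix j
    have "(pmf p j)\<^sup>2 \<le> 2 * (pmf p j - pmf q j)\<^sup>2 + 2 * (pmf q j)\<^sup>2"
      using zero_le_power2[of "pmf p j - 2 * pmf q j"] by (simp add: power2_diff algebra_simps)
    then have "2 / (w j)\<^sup>2 * (pmf p j)\<^sup>2 \<le> 2 / (w j)\<^sup>2 * (2 * (pmf p j - pmf q j)\<^sup>2 + 2 * (pmf q j)\<^sup>2)"
      by (intro mult_left_mono) auto
    also have "\<dots> = 4 * (1 / w j) * ((pmf p j - pmf q j)\<^sup>2 / w j) + 4 * (pmf q j / w j)\<^sup>2"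
      using w_pos[of j] by (simp add: field_simps power2_eq_square)
    also have "\<dots> \<le> 4 * (2 * real k) * ((pmf p j - pmf q j)\<^sup>2 / w j) + 4 * 2\<^sup>2"
      using w_pos[of j] by (intro add_mono mult_mono mult_left_mono power_mono inverse_w q_over_w) auto
    finally show "pmf p j * (2 / (w j)\<^sup>2 * pmf p j) \<le> 8 * real k * ((pmf p j - pmf q j)\<^sup>2 / w j) + 16"
      by (simp add: power2_eq_square mult_ac)
  qed
  also have "\<dots> = 8 * real k * chi2 J p q + 16 * real k + 32"
    by (simp add: chi2_def sum.distrib sum_distrib_left)
  also have "\<dots> \<le> 8 * real k * chi2 J p q + 48 * real k"
    using k_pos by simp
  finally show ?thesis .
qed

text \<open>The projection is \<open>(p - q) / w\<close> minus a constant \<open>c\<close>, and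
  Cauchy-Schwarz bounds \<open>c\<^sup>2\<close> by \<open>2 * chi2\<close>. The resulting bound has
  the factor \<open>chi2\<close>, so the cubic term of the variance vanishes for
  \<open>p = q\<close>.\<close>

lemma kernel_projection_moment:
  "E p (\<lambda>x. (E p (\<lambda>y. chi2_kernel J q x y))\<^sup>2) \<le> chi2 J p q * (8 + 2 * sqrt (2 * real k * chi2 J p q))"
proof -
  define c where "c = (\<Sum>j\<in>J. pmf q j * ((pmf p j - pmf q j) / w j))"
  let ?r = "sqrt (2 * real k * chi2 J p q)"
  have proj: "E p (\<lambda>y. chi2_kernel J q x y) = (pmf p x - pmf q x) / w x - c" if "x \<in> J" for x
  proof -
    have "E p (\<lambda>y. chi2_kernel J q x y) =
        (\<Sum>j\<in>J. indicator {j} x * ((pmf p j - pmf q j) / w j) - pmf q j * ((pmf p j - pmf q j) / w j))"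
      unfolding E_kernel by (intro sum.cong refl) (simp add: algebra_simps diff_divide_distrib add_divide_distrib)
    then show ?thesis
      by (simp only: sum_subtractf sum_indicator_singleton[OF that] c_def)
  qed
  have "c = (\<Sum>j\<in>J. pmf q j / sqrt (w j) * ((pmf p j - pmf q j) / sqrt (w j)))"
    unfolding c_def using w_pos by (intro sum.cong refl) (simp add: less_imp_le)
  then have "c\<^sup>2 \<le> (\<Sum>j\<in>J. (pmf q j / sqrt (w j))\<^sup>2) * (\<Sum>j\<in>J. ((pmf p j - pmf q j) / sqrt (w j))\<^sup>2)"
    using Cauchy_Schwarz_ineq_sum[of "\<lambda>j. pmf q j / sqrt (w j)" "\<lambda>j. (pmf p j - pmf q j) / sqrt (w j)" J] by simp
  also have "\<dots> = (\<Sum>j\<in>J. pmf q j * (pmf q j / w j)) * chi2 J p q"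
    using w_pos by (simp add: chi2_def power_divide less_imp_le power2_eq_square)
  also have "\<dots> \<le> 2 * chi2 J p q" by (intro mult_right_mono sum_q_sq chi2_nonneg)
  finally have c: "c\<^sup>2 \<le> 2 * chi2 J p q" .
  have "E p (\<lambda>x. (E p (\<lambda>y. chi2_kernel J q x y))\<^sup>2) \<le> E p (\<lambda>x. 2 * ((pmf p x - pmf q x) / w x)\<^sup>2 + 4 * chi2 J p q)"
  proof (rule E_mono[OF fin_p])
    fix x assume "x \<in> set_pmf p"
    then have "x \<in> J" using p by blast
    have "((pmf p x - pmf q x) / w x - c)\<^sup>2 \<le> 2 * ((pmf p x - pmf q x) / w x)\<^sup>2 + 2 * c\<^sup>2"
      using zero_le_power2[of "(pmf p x - pmf q x) / w x + c"] by (simp add: power2_sum power2_diff)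
    then show "(E p (\<lambda>y. chi2_kernel J q x y))\<^sup>2 \<le> 2 * ((pmf p x - pmf q x) / w x)\<^sup>2 + 4 * chi2 J p q"
      unfolding proj[OF \<open>x \<in> J\<close>] using c by linarith
  qed
  also have "\<dots> = (\<Sum>j\<in>J. pmf p j * (2 * ((pmf p j - pmf q j) / w j)\<^sup>2)) + 4 * chi2 J p q"
    by (subst E_add[OF fin_p]) (simp add: E_eq sum_distrib_left mult_ac)
  also have "\<dots> \<le> (\<Sum>j\<in>J. (4 + 2 * ?r) * ((pmf p j - pmf q j)\<^sup>2 / w j)) + 4 * chi2 J p q"
  proof (intro add_mono sum_mono order_refl)
    fix j assume j: "j \<in> J"
    have "pmf p j / w j \<le> pmf q j / w j + \<bar>pmf p j - pmf q j\<bar> / w j"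
      using w_pos[of j] by (simp add: divide_simps)
    also have "\<dots> \<le> 2 + ?r" by (intro add_mono q_over_w diff_over_w j)
    finally have "2 * (pmf p j / w j) \<le> 4 + 2 * ?r" by simp
    then have "2 * (pmf p j / w j) * ((pmf p j - pmf q j)\<^sup>2 / w j) \<le> (4 + 2 * ?r) * ((pmf p j - pmf q j)\<^sup>2 / w j)"
      using w_pos[of j] by (intro mult_right_mono) auto
    then show "pmf p j * (2 * ((pmf p j - pmf q j) / w j)\<^sup>2) \<le> (4 + 2 * ?r) * ((pmf p j - pmf q j)\<^sup>2 / w j)"
      by (simp add: power2_eq_square mult_ac)
  qed
  also have "\<dots> = (4 + 2 * ?r) * chi2 J p q + 4 * chi2 J p q"
    unfolding sum_distrib_left[symmetric] chi2_def ..
  also have "\<dots> = chi2 J p q * (8 + 2 * ?r)"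
    by (simp add: algebra_simps)
  finally show ?thesis .
qed

end

section \<open>Deciding closeness in l1 by the statistic\<close>

text \<open>The threshold is half of the smallest mean that the statistic can have when the two
  distributions are \<open>\<delta>\<close>-far in \<open>\<ell>\<^sub>1\<close>.\<close>

definition far_test :: "'b set \<Rightarrow> 'b pmf \<Rightarrow> real \<Rightarrow> 'b list \<Rightarrow> 'b list \<Rightarrow> bool" where
  "far_test J q \<delta> xs ys \<longleftrightarrow> cross_sum (chi2_kernel J q) xs ys \<ge> (real (length xs))\<^sup>2 * \<delta>\<^sup>2 / 2"

lemma kernel_deviation:
  fixes J :: "'b set" and p q :: "'b pmf"
  assumes J: "finite J" and p: "set_pmf p \<subseteq> J" and q: "set_pmf q \<subseteq> J"
  shows "E (pair_pmf (replicate_pmf m p) (replicate_pmf m p))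
      (\<lambda>(xs, ys). (cross_sum (chi2_kernel J q) xs ys - (real m)\<^sup>2 * chi2 J p q)\<^sup>2)
    \<le> 2 * (real m)\<^sup>2 * (8 * real (card J) * chi2 J p q + 48 * real (card J))
      + 4 * real m ^ 3 * (chi2 J p q * (8 + 2 * sqrt (2 * real (card J) * chi2 J p q)))"
proof -
  have "E p (\<lambda>y. chi2_kernel J q y x) = E p (\<lambda>y. chi2_kernel J q x y)" for x
    by (intro Bochner_Integration.integral_cong refl kernel_commute[OF J p q])
  then have "E p (\<lambda>y. (E p (\<lambda>x. chi2_kernel J q x y))\<^sup>2)
      \<le> chi2 J p q * (8 + 2 * sqrt (2 * real (card J) * chi2 J p q))"
    using kernel_projection_moment[OF J p q] by simp
  from cross_sum_deviation[OF fin_p[OF J p q] kernel_projection_moment[OF J p q] this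
      kernel_second_moment[OF J p q], of m]
  show ?thesis by (simp only: E_E_kernel[OF J p q])
qed

lemma finite_pair_replicate:
  "finite (set_pmf p) \<Longrightarrow> finite (set_pmf (pair_pmf (replicate_pmf m p) (replicate_pmf m p)))"
  by (simp add: finite_replicate)

lemma far_test_null:
  fixes J :: "'b set" and q :: "'b pmf"
  assumes J: "finite J" and q: "set_pmf q \<subseteq> J" and \<delta>: "0 < \<delta>" and m: "0 < m"
  shows "measure_pmf.prob (pair_pmf (replicate_pmf m q) (replicate_pmf m q)) {(xs, ys). far_test J q \<delta> xs ys}
    \<le> 384 * real (card J) / ((real m)\<^sup>2 * \<delta> ^ 4)"
proof -
  let ?D = "pair_pmf (replicate_pmf m q) (replicate_pmf m q)"
  define c where "c = (real m)\<^sup>2 * \<delta>\<^sup>2 / 2"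
  have c: "0 < c" using \<delta> m by (simp add: c_def)
  have chi: "chi2 J q q = 0" by (simp add: chi2_def)
  have "measure_pmf.prob ?D {(xs, ys). far_test J q \<delta> xs ys} \<le>
      E ?D (\<lambda>(xs, ys). (cross_sum (chi2_kernel J q) xs ys)\<^sup>2) / c\<^sup>2"
  proof (rule markov_pmf[OF finite_pair_replicate])
    show "finite (set_pmf q)" using finite_subset[OF q J] .
    fix z assume z: "z \<in> set_pmf ?D" "z \<in> {(xs, ys). far_test J q \<delta> xs ys}"
    then have "length (fst z) = m" by (auto simp: set_replicate_pmf)
    then have "c \<le> cross_sum (chi2_kernel J q) (fst z) (snd z)"
      using z(2) by (auto simp: far_test_def c_def)
    then show "c\<^sup>2 \<le> (case z of (xs, ys) \<Rightarrow> (cross_sum (chi2_kernel J q) xs ys)\<^sup>2)"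
      using c by (auto simp: split_beta intro: power_mono)
  qed (use c in auto)
  \<comment> \<open>With \<open>chi2 = 0\<close> only the constant part of the second moment of the
    kernel survives.\<close>
  also have "\<dots> \<le> 2 * (real m)\<^sup>2 * (48 * real (card J)) / c\<^sup>2"
    using kernel_deviation[OF J q q, of m] c unfolding chi by (intro divide_right_mono) auto
  also have "\<dots> = 384 * real (card J) / ((real m)\<^sup>2 * \<delta> ^ 4)"
    using \<delta> m by (simp add: c_def field_simps power2_eq_square power4_eq_xxxx)
  finally show ?thesis .
qed

text \<open>Chebyshev with deviation \<open>c\<close>, half of the mean: the threshold is at most
  \<open>c\<close>, so acceptance means falling short of the mean by at least \<open>c\<close>. The
  factor \<open>B\<close> is left free so that a sample size chosen for many simultaneous tests
  fits.\<close>

lemma far_test_far: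
  fixes J :: "'b set" and p q :: "'b pmf"
  assumes J: "finite J" and p: "set_pmf p \<subseteq> J" and q: "set_pmf q \<subseteq> J" and \<delta>: "0 < \<delta>"
    and far: "\<delta> \<le> (\<Sum>j\<in>J. \<bar>pmf p j - pmf q j\<bar>)"
    and B: "2000 \<le> B" "B * sqrt (real (card J)) / \<delta>\<^sup>2 \<le> real m"
  shows "measure_pmf.prob (pair_pmf (replicate_pmf m p) (replicate_pmf m p)) {(xs, ys). \<not> far_test J q \<delta> xs ys}
    \<le> 1 / 6"
proof -
  let ?D = "pair_pmf (replicate_pmf m p) (replicate_pmf m p)"
  define \<theta> where "\<theta> = chi2 J p q"
  define k where "k = real (card J)"
  define c where "c = (real m)\<^sup>2 * \<theta> / 2"
  have k1: "1 \<le> k" using k_pos[OF J p q] by (simp add: k_def)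
  have \<theta>\<delta>: "\<delta>\<^sup>2 \<le> \<theta>"
    unfolding \<theta>_def using chi2_ge[OF J p q] power_mono[OF far, of 2] \<delta> by linarith
  then have \<theta>: "0 < \<theta>" using zero_less_power[OF \<delta>, of 2] by linarith
  \<comment> \<open>Two distributions differ by at most 2, so \<open>\<delta> \<le> 2\<close>. This
    later turns \<open>\<delta>\<^sup>2\<close> into at most
    \<open>2 * sqrt \<theta>\<close>.\<close>
  have "(\<Sum>j\<in>J. \<bar>pmf p j - pmf q j\<bar>) \<le> (\<Sum>j\<in>J. pmf p j + pmf q j)"
    by (intro sum_mono) (simp add: abs_le_iff add_increasing add_increasing2)
  also have "\<dots> = 2" using sum_pmf_eq_1[OF J p] sum_pmf_eq_1[OF J q] by (simp add: sum.distrib)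
  finally have \<delta>2: "\<delta> \<le> 2" using far by linarith
  have sk: "1 \<le> sqrt k" "0 < sqrt k" using k1 by (auto simp: real_le_rsqrt)
  have B0: "0 < B" using B by simp
  have m1: "B * sqrt k \<le> real m * \<delta>\<^sup>2" using B(2) \<delta> by (simp add: k_def divide_simps)
  have m0: "0 < real m"
  proof -
    have "0 < real m * \<delta>\<^sup>2" using m1 sk B0 by (smt (verit) mult_pos_pos)
    then show ?thesis using \<delta> by (simp add: zero_less_mult_iff)
  qed
  have c: "0 < c" using m0 \<theta> by (simp add: c_def)
  have "measure_pmf.prob ?D {(xs, ys). \<not> far_test J q \<delta> xs ys} \<le>
      E ?D (\<lambda>(xs, ys). (cross_sum (chi2_kernel J q) xs ys - (real m)\<^sup>2 * \<theta>)\<^sup>2) / c\<^sup>2"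
  proof (rule markov_pmf[OF finite_pair_replicate])
    show "finite (set_pmf p)" using finite_subset[OF p J] .
    fix z assume z: "z \<in> set_pmf ?D" "z \<in> {(xs, ys). \<not> far_test J q \<delta> xs ys}"
    then have "length (fst z) = m" by (auto simp: set_replicate_pmf)
    then have "cross_sum (chi2_kernel J q) (fst z) (snd z) < (real m)\<^sup>2 * \<delta>\<^sup>2 / 2"
      using z(2) by (auto simp: far_test_def)
    also have "\<dots> \<le> c" unfolding c_def using \<theta>\<delta> by (intro divide_right_mono mult_left_mono) auto
    finally have "cross_sum (chi2_kernel J q) (fst z) (snd z) < c" .
    then have "c \<le> (real m)\<^sup>2 * \<theta> - cross_sum (chi2_kernel J q) (fst z) (snd z)"
      unfolding c_def by linarith
    then have "c\<^sup>2 \<le> ((real m)\<^sup>2 * \<theta> - cross_sum (chi2_kernel J q) (fst z) (snd z))\<^sup>2"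
      using c by (intro power_mono) auto
    then show "c\<^sup>2 \<le> (case z of (xs, ys) \<Rightarrow> (cross_sum (chi2_kernel J q) xs ys - (real m)\<^sup>2 * \<theta>)\<^sup>2)"
      by (simp add: split_beta power2_commute)
  qed (use c in auto)
  also have "\<dots> \<le> (2 * (real m)\<^sup>2 * (8 * k * \<theta> + 48 * k)
      + 4 * real m ^ 3 * (\<theta> * (8 + 2 * sqrt (2 * k * \<theta>)))) / c\<^sup>2"
    using kernel_deviation[OF J p q, of m] c unfolding \<theta>_def k_def by (intro divide_right_mono) auto
  also have "\<dots> = 64 * (k / ((real m)\<^sup>2 * \<theta>)) + 384 * (k / ((real m)\<^sup>2 * \<theta>\<^sup>2))
      + 128 * (1 / (real m * \<theta>)) + 32 * sqrt 2 * (sqrt k / (real m * sqrt \<theta>))"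
  proof -
    have t: "\<theta> = sqrt \<theta> * sqrt \<theta>" using \<theta> by simp
    have s: "sqrt (2 * k * \<theta>) = sqrt 2 * sqrt k * sqrt \<theta>" by (simp add: real_sqrt_mult)
    have "4 * real m ^ 3 * (\<theta> * (2 * sqrt (2 * k * \<theta>))) / c\<^sup>2 = 32 * sqrt 2 * (sqrt k * sqrt \<theta> / (real m * \<theta>))"
      using m0 \<theta> unfolding s c_def by (simp add: field_simps power2_eq_square power3_eq_cube)
    also have "sqrt k * sqrt \<theta> / (real m * \<theta>) = sqrt k / (real m * sqrt \<theta>)"
    proof -
      have "real m * \<theta> = (real m * sqrt \<theta>) * sqrt \<theta>" using t by (simp only: mult.assoc)
      moreover have "sqrt \<theta> \<noteq> 0" using \<theta> by simp
      ultimately show ?thesis by (metis nonzero_mult_divide_mult_cancel_right)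
    qed
    finally have 1: "4 * real m ^ 3 * (\<theta> * (2 * sqrt (2 * k * \<theta>))) / c\<^sup>2 = 32 * sqrt 2 * (sqrt k / (real m * sqrt \<theta>))" .
    have 2: "2 * (real m)\<^sup>2 * (8 * k * \<theta>) / c\<^sup>2 = 64 * (k / ((real m)\<^sup>2 * \<theta>))"
      using m0 \<theta> unfolding c_def by (simp add: field_simps power2_eq_square)
    have 3: "2 * (real m)\<^sup>2 * (48 * k) / c\<^sup>2 = 384 * (k / ((real m)\<^sup>2 * \<theta>\<^sup>2))"
      using m0 \<theta> unfolding c_def by (simp add: field_simps power2_eq_square)
    have 4: "4 * real m ^ 3 * (\<theta> * 8) / c\<^sup>2 = 128 * (1 / (real m * \<theta>))"
      using m0 \<theta> unfolding c_def by (simp add: field_simps power2_eq_square power3_eq_cube)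
    show ?thesis unfolding 1[symmetric] 2[symmetric] 3[symmetric] 4[symmetric]
      by (simp only: add_divide_distrib[symmetric]) (simp only: distrib_left add_ac)
  qed
  \<comment> \<open>The last two terms need only \<open>m * \<theta> \<ge> B * sqrt k\<close> or the
    weaker \<open>2 * m * sqrt \<theta> \<ge> B * sqrt k\<close>; the first two use the squares of
    these inequalities.\<close>
  also have "\<dots> \<le> 64 * (4 / B\<^sup>2) + 384 * (1 / B\<^sup>2) + 128 * (1 / B) + 32 * sqrt 2 * (2 / B)"
  proof (intro add_mono mult_left_mono)
    have m\<theta>: "B * sqrt k \<le> real m * \<theta>"
      using m1 mult_left_mono[OF \<theta>\<delta>, of "real m"] by linarith
    have "(B * sqrt k)\<^sup>2 \<le> (real m * \<theta>)\<^sup>2" using m\<theta> B0 sk by (intro power_mono) auto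
    then have m\<theta>2: "B\<^sup>2 * k \<le> (real m)\<^sup>2 * \<theta>\<^sup>2" using k1 by (simp add: power_mult_distrib)
    show "k / ((real m)\<^sup>2 * \<theta>\<^sup>2) \<le> 1 / B\<^sup>2"
      using m\<theta>2 m0 \<theta> B0 by (simp add: divide_simps mult_ac)
    have "B * 1 \<le> B * sqrt k" using B0 sk by (intro mult_left_mono) auto
    then have "B \<le> real m * \<theta>" using m\<theta> by linarith
    then show "1 / (real m * \<theta>) \<le> 1 / B" using B0 by (intro divide_left_mono) (auto simp: m0 \<theta>)
    have sq: "\<delta> \<le> sqrt \<theta>" using \<theta>\<delta> by (rule real_le_rsqrt)
    have "B * sqrt k \<le> real m * (\<delta> * \<delta>)" using m1 by (simp add: power2_eq_square)
    also have "\<dots> \<le> real m * (sqrt \<theta> * 2)" using sq \<delta>2 \<delta> \<theta> by (intro mult_left_mono mult_mono) auto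
    finally have ms: "B * sqrt k \<le> 2 * (real m * sqrt \<theta>)" by simp
    then show "sqrt k / (real m * sqrt \<theta>) \<le> 2 / B"
      using B0 m0 \<theta> by (simp add: divide_simps mult_ac)
    have "(B * sqrt k)\<^sup>2 \<le> (2 * (real m * sqrt \<theta>))\<^sup>2" using ms B0 sk by (intro power_mono) auto
    then have "B\<^sup>2 * k \<le> 4 * ((real m)\<^sup>2 * \<theta>)" using k1 \<theta> by (simp add: power_mult_distrib)
    then show "k / ((real m)\<^sup>2 * \<theta>) \<le> 4 / B\<^sup>2"
      using m0 \<theta> B0 by (simp add: divide_simps mult_ac)
  qed auto
  also have "\<dots> \<le> 64 * (4 / (2000 * B)) + 384 * (1 / (2000 * B)) + 128 * (1 / B) + 32 * 2 * (2 / B)"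
  proof -
    have "2000 * B \<le> B\<^sup>2" using B by (simp add: power2_eq_square)
    then have "1 / B\<^sup>2 \<le> 1 / (2000 * B)" using B0 by (intro divide_left_mono) auto
    moreover have "sqrt 2 * (2 / B) \<le> 2 * (2 / B)"
      using B0 by (intro mult_right_mono) (auto intro: real_le_lsqrt)
    ultimately show ?thesis by simp
  qed
  also have "\<dots> \<le> 1 / 6"
    using B B0 by (simp add: divide_simps)
  finally show ?thesis .
qed

lemma map_replicate_pmf: "replicate_pmf m (map_pmf f p) = map_pmf (map f) (replicate_pmf m p)"
  by (induction m) (simp_all add: map_pmf_def bind_assoc_pmf bind_return_pmf)

section \<open>Hierarchical transport plans\<close>

definition cell_mass :: "'a set \<Rightarrow> ('a \<Rightarrow> 'c) \<Rightarrow> ('a \<Rightarrow> real) \<Rightarrow> 'c \<Rightarrow> real" where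
  "cell_mass X f a c = (\<Sum>x\<in>{x\<in>X. f x = c}. a x)"

lemma sum_cell_mass: "finite X \<Longrightarrow> (\<Sum>c\<in>f ` X. cell_mass X f a c) = (\<Sum>x\<in>X. a x)"
  unfolding cell_mass_def by (rule sum.image_gen[symmetric])

lemma cell_mass_diff: "cell_mass X f (\<lambda>x. a x - b x) c = cell_mass X f a c - cell_mass X f b c"
  by (simp add: cell_mass_def sum_subtractf)

lemma cell_mass_add: "cell_mass X f (\<lambda>x. a x + b x) c = cell_mass X f a c + cell_mass X f b c"
  by (simp add: cell_mass_def sum.distrib)

lemma cell_mass_nonneg: "(\<And>x. x \<in> X \<Longrightarrow> 0 \<le> a x) \<Longrightarrow> 0 \<le> cell_mass X f a c"
  unfolding cell_mass_def by (intro sum_nonneg) auto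

definition cell_l1 :: "'a set \<Rightarrow> ('a \<Rightarrow> 'c) \<Rightarrow> ('a \<Rightarrow> real) \<Rightarrow> ('a \<Rightarrow> real) \<Rightarrow> real" where
  "cell_l1 X f a b = (\<Sum>c\<in>f ` X. \<bar>cell_mass X f a c - cell_mass X f b c\<bar>)"

text \<open>A partial transport plan inside the classes of \<open>f\<close>. The last clause makes
  it maximal: after it, no class has unmatched mass on both sides.\<close>

definition cell_plan :: "'a set \<Rightarrow> ('a \<Rightarrow> 'c) \<Rightarrow> ('a \<Rightarrow> real) \<Rightarrow> ('a \<Rightarrow> real) \<Rightarrow> ('a \<Rightarrow> 'a \<Rightarrow> real) \<Rightarrow> bool" where
  "cell_plan X f a b \<pi> \<longleftrightarrow>
     (\<forall>x\<in>X. \<forall>y\<in>X. 0 \<le> \<pi> x y \<and> (f x \<noteq> f y \<longrightarrow> \<pi> x y = 0)) \<and>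
     (\<forall>x\<in>X. (\<Sum>y\<in>X. \<pi> x y) \<le> a x) \<and> (\<forall>y\<in>X. (\<Sum>x\<in>X. \<pi> x y) \<le> b y) \<and>
     (\<forall>c. cell_mass X f (\<lambda>x. \<Sum>y\<in>X. \<pi> x y) c = min (cell_mass X f a c) (cell_mass X f b c))"

definition plan_cost :: "'a set \<Rightarrow> ('a \<Rightarrow> 'a \<Rightarrow> real) \<Rightarrow> ('a \<Rightarrow> 'a \<Rightarrow> real) \<Rightarrow> real" where
  "plan_cost X \<delta> \<pi> = (\<Sum>x\<in>X. \<Sum>y\<in>X. \<pi> x y * \<delta> x y)"

lemma cell_mass_rows_cols:
  assumes X: "finite X" and supp: "\<And>x y. x \<in> X \<Longrightarrow> y \<in> X \<Longrightarrow> f x \<noteq> f y \<Longrightarrow> \<pi> x y = 0"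
  shows "cell_mass X f (\<lambda>x. \<Sum>y\<in>X. \<pi> x y) c = cell_mass X f (\<lambda>y. \<Sum>x\<in>X. \<pi> x y) c"
proof -
  let ?C = "{x \<in> X. f x = c}"
  have "(\<Sum>y\<in>X. \<pi> x y) = (\<Sum>y\<in>?C. \<pi> x y)" if "x \<in> ?C" for x
    using that X by (intro sum.mono_neutral_right) (auto intro!: supp)
  moreover have "(\<Sum>x\<in>X. \<pi> x y) = (\<Sum>x\<in>?C. \<pi> x y)" if "y \<in> ?C" for y
    using that X by (intro sum.mono_neutral_right) (auto intro!: supp)
  ultimately show ?thesis unfolding cell_mass_def
    using sum.swap[of "\<lambda>x y. \<pi> x y" ?C ?C] by simp
qed

text \<open>In each class a multiple of the product measure works; dividing by the larger of the two
  masses makes the total equal to the smaller one. A class without mass on either side causes no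
  trouble, as division by 0 yields 0.\<close>

lemma cell_plan_exists:
  assumes X: "finite X" and nonneg: "\<And>x. x \<in> X \<Longrightarrow> 0 \<le> a x" "\<And>x. x \<in> X \<Longrightarrow> 0 \<le> b x"
    and \<delta>: "\<And>x y. x \<in> X \<Longrightarrow> y \<in> X \<Longrightarrow> f x = f y \<Longrightarrow> \<delta> x y \<le> D" and D: "0 \<le> D"
  shows "\<exists>\<pi>. cell_plan X f a b \<pi> \<and> plan_cost X \<delta> \<pi> \<le> D * (\<Sum>x\<in>X. a x)"
proof -
  define A where "A c = cell_mass X f a c" for c
  define B where "B c = cell_mass X f b c" for c
  define M where "M c = max (A c) (B c)" for c
  define \<pi> where "\<pi> x y = (if f x = f y then a x * b y / M (f x) else 0)" for x y
  have AB: "0 \<le> A c" "0 \<le> B c" "0 \<le> M c" "A c \<le> M c" "B c \<le> M c" for c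
    unfolding M_def A_def B_def using cell_mass_nonneg[of X a f c] cell_mass_nonneg[of X b f c] nonneg
    by auto
  have row: "(\<Sum>y\<in>X. \<pi> x y) = a x * (B (f x) / M (f x))" for x
  proof -
    have "(\<Sum>y\<in>X. \<pi> x y) = (\<Sum>y\<in>{y\<in>X. f y = f x}. a x / M (f x) * b y)"
      unfolding \<pi>_def by (subst sum.inter_filter[OF X]) (auto intro!: sum.cong)
    also have "\<dots> = a x / M (f x) * B (f x)" unfolding B_def cell_mass_def sum_distrib_left ..
    finally show ?thesis by simp
  qed
  have col: "(\<Sum>x\<in>X. \<pi> x y) = b y * (A (f y) / M (f y))" for y
  proof -
    have "(\<Sum>x\<in>X. \<pi> x y) = (\<Sum>x\<in>{x\<in>X. f x = f y}. b y / M (f y) * a x)"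
      unfolding \<pi>_def by (subst sum.inter_filter[OF X]) (auto intro!: sum.cong)
    also have "\<dots> = b y / M (f y) * A (f y)" unfolding A_def cell_mass_def sum_distrib_left ..
    finally show ?thesis by simp
  qed
  have ratio: "A c / M c \<le> 1" "B c / M c \<le> 1" for c
    using AB[of c] by (auto simp: divide_le_eq_1)
  have rows: "(\<Sum>y\<in>X. \<pi> x y) \<le> a x" if "x \<in> X" for x
    unfolding row using mult_left_mono[OF ratio(2) nonneg(1)[OF that]] by simp
  have pos: "0 \<le> \<pi> x y" if "x \<in> X" "y \<in> X" for x y
    using that nonneg AB(3) by (auto simp: \<pi>_def)
  have "cell_plan X f a b \<pi>"
    unfolding cell_plan_def
  proof (intro conjI ballI allI)
    show "(\<Sum>x\<in>X. \<pi> x y) \<le> b y" if "y \<in> X" for y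
      unfolding col using mult_left_mono[OF ratio(1) nonneg(2)[OF that]] by simp
    fix c
    have "cell_mass X f (\<lambda>x. \<Sum>y\<in>X. \<pi> x y) c = A c * (B c / M c)"
      unfolding row A_def cell_mass_def sum_distrib_right by (intro sum.cong) auto
    also have "\<dots> = min (A c) (B c)"
      using AB[of c] unfolding M_def by (cases "A c \<le> B c") auto
    finally show "cell_mass X f (\<lambda>x. \<Sum>y\<in>X. \<pi> x y) c = min (cell_mass X f a c) (cell_mass X f b c)"
      by (simp add: A_def B_def)
  qed (use pos rows in \<open>auto simp: \<pi>_def\<close>)
  moreover have "plan_cost X \<delta> \<pi> \<le> D * (\<Sum>x\<in>X. a x)"
  proof -
    have "plan_cost X \<delta> \<pi> \<le> (\<Sum>x\<in>X. \<Sum>y\<in>X. \<pi> x y * D)"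
      unfolding plan_cost_def
    proof (intro sum_mono)
      fix x y assume xy: "x \<in> X" "y \<in> X"
      show "\<pi> x y * \<delta> x y \<le> \<pi> x y * D"
      proof (cases "f x = f y")
        case True
        then show ?thesis by (intro mult_left_mono \<delta> pos xy)
      qed (simp add: \<pi>_def)
    qed
    also have "\<dots> = D * (\<Sum>x\<in>X. \<Sum>y\<in>X. \<pi> x y)" by (simp add: sum_distrib_left mult.commute)
    also have "\<dots> \<le> D * (\<Sum>x\<in>X. a x)" by (intro mult_left_mono sum_mono rows D)
    finally show ?thesis .
  qed
  ultimately show ?thesis by blast
qed

lemma cell_plan_residual:
  assumes "finite X" "cell_plan X f a b \<pi>"
  shows "(\<Sum>x\<in>X. a x - (\<Sum>y\<in>X. \<pi> x y)) \<le> cell_l1 X f a b"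
proof -
  have "(\<Sum>x\<in>X. a x - (\<Sum>y\<in>X. \<pi> x y)) = (\<Sum>c\<in>f ` X. cell_mass X f (\<lambda>x. a x - (\<Sum>y\<in>X. \<pi> x y)) c)"
    by (rule sum_cell_mass[OF assms(1), symmetric])
  also have "\<dots> = (\<Sum>c\<in>f ` X. cell_mass X f a c - min (cell_mass X f a c) (cell_mass X f b c))"
    using assms(2) by (simp add: cell_mass_diff cell_plan_def)
  also have "\<dots> \<le> cell_l1 X f a b"
    unfolding cell_l1_def by (intro sum_mono) (auto simp: min_def)
  finally show ?thesis .
qed

text \<open>The old plan is kept and the leftovers are matched inside the coarser classes. Both
  leftovers lack the same mass \<open>m\<close> in a class, and
  \<open>m + min (A - m) (B - m) = min A B\<close>, so maximality persists. The new mass is at most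
  the l1-distance at the finer level.\<close>

lemma cell_plan_coarsen:
  assumes X: "finite X" and nested: "\<And>x y. x \<in> X \<Longrightarrow> y \<in> X \<Longrightarrow> f x = f y \<Longrightarrow> g x = g y"
    and \<pi>: "cell_plan X f a b \<pi>"
    and \<delta>: "\<And>x y. x \<in> X \<Longrightarrow> y \<in> X \<Longrightarrow> g x = g y \<Longrightarrow> \<delta> x y \<le> D" and D: "0 \<le> D"
  shows "\<exists>\<pi>'. cell_plan X g a b \<pi>' \<and> plan_cost X \<delta> \<pi>' \<le> plan_cost X \<delta> \<pi> + D * cell_l1 X f a b"
proof -
  define a' where "a' x = a x - (\<Sum>y\<in>X. \<pi> x y)" for x
  define b' where "b' y = b y - (\<Sum>x\<in>X. \<pi> x y)" for y
  have nn: "0 \<le> a' x" "0 \<le> b' x" if "x \<in> X" for x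
    using \<pi> that by (auto simp: cell_plan_def a'_def b'_def)
  have "\<exists>\<rho>. cell_plan X g a' b' \<rho> \<and> plan_cost X \<delta> \<rho> \<le> D * (\<Sum>x\<in>X. a' x)"
    by (rule cell_plan_exists[OF X]) (use nn \<delta> D in auto)
  then obtain \<rho> where \<rho>: "cell_plan X g a' b' \<rho>" "plan_cost X \<delta> \<rho> \<le> D * (\<Sum>x\<in>X. a' x)"
    by blast
  define \<pi>' where "\<pi>' x y = \<pi> x y + \<rho> x y" for x y
  define m where "m c = cell_mass X g (\<lambda>x. \<Sum>y\<in>X. \<pi> x y) c" for c
  have supp: "\<pi> x y = 0" if "x \<in> X" "y \<in> X" "g x \<noteq> g y" for x y
    using that nested \<pi> unfolding cell_plan_def by metis
  have m: "cell_mass X g (\<lambda>y. \<Sum>x\<in>X. \<pi> x y) c = m c" for c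
    unfolding m_def by (rule cell_mass_rows_cols[OF X supp, symmetric])
  have "cell_plan X g a b \<pi>'"
    unfolding cell_plan_def
  proof (intro conjI ballI allI)
    fix c
    have "cell_mass X g (\<lambda>x. \<Sum>y\<in>X. \<pi>' x y) c = m c + min (cell_mass X g a' c) (cell_mass X g b' c)"
      using \<rho>(1) unfolding \<pi>'_def sum.distrib cell_mass_add m_def by (simp add: cell_plan_def)
    also have "cell_mass X g a' c = cell_mass X g a c - m c"
      unfolding a'_def cell_mass_diff m_def ..
    also have "cell_mass X g b' c = cell_mass X g b c - m c"
      unfolding b'_def cell_mass_diff m ..
    finally show "cell_mass X g (\<lambda>x. \<Sum>y\<in>X. \<pi>' x y) c = min (cell_mass X g a c) (cell_mass X g b c)"
      by (simp add: min_def split: if_splits)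
  next
    fix x assume x: "x \<in> X"
    have "(\<Sum>y\<in>X. \<rho> x y) \<le> a' x" using \<rho>(1) x by (simp add: cell_plan_def)
    then show "(\<Sum>y\<in>X. \<pi>' x y) \<le> a x" by (simp add: \<pi>'_def sum.distrib a'_def)
    have "(\<Sum>y\<in>X. \<rho> y x) \<le> b' x" using \<rho>(1) x by (simp add: cell_plan_def)
    then show "(\<Sum>y\<in>X. \<pi>' y x) \<le> b x" by (simp add: \<pi>'_def sum.distrib b'_def)
    fix y assume y: "y \<in> X"
    show "0 \<le> \<pi>' x y" using \<pi> \<rho>(1) x y by (simp add: cell_plan_def \<pi>'_def)
    show "g x \<noteq> g y \<longrightarrow> \<pi>' x y = 0" using supp \<rho>(1) x y by (simp add: cell_plan_def \<pi>'_def)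
  qed
  moreover have "plan_cost X \<delta> \<pi>' \<le> plan_cost X \<delta> \<pi> + D * cell_l1 X f a b"
  proof -
    have "plan_cost X \<delta> \<pi>' = plan_cost X \<delta> \<pi> + plan_cost X \<delta> \<rho>"
      by (simp add: plan_cost_def \<pi>'_def distrib_right sum.distrib)
    moreover have "D * (\<Sum>x\<in>X. a' x) \<le> D * cell_l1 X f a b"
      unfolding a'_def by (intro mult_left_mono cell_plan_residual[OF X \<pi>] D)
    ultimately show ?thesis using \<rho>(2) by linarith
  qed
  ultimately show ?thesis by blast
qed

text \<open>The index is shifted by one: mass left over at level \<open>Suc j\<close> travels inside
  a class of level \<open>j\<close>, and therefore pays \<open>D j\<close>.\<close>

lemma hierarchical_plan:
  fixes F :: "nat \<Rightarrow> 'a \<Rightarrow> 'c"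
  assumes X: "finite X" and nonneg: "\<And>x. x \<in> X \<Longrightarrow> 0 \<le> a x" "\<And>x. x \<in> X \<Longrightarrow> 0 \<le> b x"
    and nested: "\<And>i x y. x \<in> X \<Longrightarrow> y \<in> X \<Longrightarrow> F (Suc i) x = F (Suc i) y \<Longrightarrow> F i x = F i y"
    and \<delta>: "\<And>i x y. x \<in> X \<Longrightarrow> y \<in> X \<Longrightarrow> F i x = F i y \<Longrightarrow> \<delta> x y \<le> D i" and D: "\<And>i. 0 \<le> D i"
    and "i \<le> L"
  shows "\<exists>\<pi>. cell_plan X (F i) a b \<pi> \<and>
    plan_cost X \<delta> \<pi> \<le> D L * (\<Sum>x\<in>X. a x) + (\<Sum>j\<in>{i..<L}. D j * cell_l1 X (F (Suc j)) a b)"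
  using \<open>i \<le> L\<close>
proof (induction rule: inc_induct)
  case base
  have "\<exists>\<pi>. cell_plan X (F L) a b \<pi> \<and> plan_cost X \<delta> \<pi> \<le> D L * (\<Sum>x\<in>X. a x)"
    by (rule cell_plan_exists[OF X]) (use nonneg \<delta> D in auto)
  then show ?case by simp
next
  case (step i)
  then obtain \<pi> where \<pi>: "cell_plan X (F (Suc i)) a b \<pi>"
    "plan_cost X \<delta> \<pi> \<le> D L * (\<Sum>x\<in>X. a x) + (\<Sum>j\<in>{Suc i..<L}. D j * cell_l1 X (F (Suc j)) a b)"
    by blast
  have "\<exists>\<pi>'. cell_plan X (F i) a b \<pi>' \<and>
      plan_cost X \<delta> \<pi>' \<le> plan_cost X \<delta> \<pi> + D i * cell_l1 X (F (Suc i)) a b"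
    by (rule cell_plan_coarsen[OF X _ \<pi>(1)]) (use nested \<delta> D in blast)+
  then obtain \<pi>' where \<pi>': "cell_plan X (F i) a b \<pi>'"
    "plan_cost X \<delta> \<pi>' \<le> plan_cost X \<delta> \<pi> + D i * cell_l1 X (F (Suc i)) a b"
    by blast
  have "(\<Sum>j\<in>{i..<L}. D j * cell_l1 X (F (Suc j)) a b) =
      D i * cell_l1 X (F (Suc i)) a b + (\<Sum>j\<in>{Suc i..<L}. D j * cell_l1 X (F (Suc j)) a b)"
    using step.hyps by (simp add: sum.atLeast_Suc_lessThan)
  then show ?case using \<pi> \<pi>' by (intro exI[of _ \<pi>']) auto
qed

section \<open>From plans to couplings, and gluing of couplings\<close>

lemma plan_coupling:
  fixes \<mu> \<nu> :: "'a pmf"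
  assumes X: "finite X" and \<mu>: "set_pmf \<mu> \<subseteq> X" and \<nu>: "set_pmf \<nu> \<subseteq> X"
    and nonneg: "\<And>x y. x \<in> X \<Longrightarrow> y \<in> X \<Longrightarrow> 0 \<le> \<pi> x y"
    and rows: "\<And>x. x \<in> X \<Longrightarrow> (\<Sum>y\<in>X. \<pi> x y) = pmf \<mu> x" and cols: "\<And>y. y \<in> X \<Longrightarrow> (\<Sum>x\<in>X. \<pi> x y) = pmf \<nu> y"
  shows "\<exists>\<tau>\<in>couplings \<mu> \<nu>. measure_pmf.expectation \<tau> (\<lambda>(x, y). \<delta> x y) = plan_cost X \<delta> \<pi>"
proof -
  define g where "g z = (if z \<in> X \<times> X then \<pi> (fst z) (snd z) else 0)" for z
  have g0: "0 \<le> g z" for z using nonneg by (auto simp: g_def)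
  have "(\<integral>\<^sup>+z. ennreal (g z) \<partial>count_space UNIV) = (\<Sum>z\<in>X \<times> X. ennreal (g z))"
    using X by (intro nn_integral_count_space') (auto simp: g_def split: if_splits)
  also have "\<dots> = ennreal (\<Sum>z\<in>X \<times> X. g z)" by (intro sum_ennreal g0)
  also have "(\<Sum>z\<in>X \<times> X. g z) = (\<Sum>x\<in>X. \<Sum>y\<in>X. \<pi> x y)"
    by (simp add: sum.cartesian_product g_def split_beta)
  also have "\<dots> = 1" using rows sum_pmf_eq_1[OF X \<mu>] by simp
  finally have int: "(\<integral>\<^sup>+z. ennreal (g z) \<partial>count_space UNIV) = 1" by simp
  define \<tau> where "\<tau> = embed_pmf g"
  have pmf: "pmf \<tau> z = g z" for z
    unfolding \<tau>_def using g0 int by (intro pmf_embed_pmf) auto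
  have set: "set_pmf \<tau> \<subseteq> X \<times> X" by (auto simp: set_pmf_iff pmf g_def split: if_splits)
  have "map_pmf fst \<tau> = \<mu>"
  proof (rule pmf_eqI)
    fix x
    have "pmf (map_pmf fst \<tau>) x = measure \<tau> (fst -` {x} \<inter> set_pmf \<tau>)"
      by (simp add: pmf_map measure_Int_set_pmf)
    also have "\<dots> = measure \<tau> ({x} \<times> X)"
      using set by (subst (2) measure_Int_set_pmf[symmetric]) (auto intro!: arg_cong[of _ _ "measure \<tau>"])
    also have "\<dots> = (\<Sum>z\<in>{x} \<times> X. g z)" using X by (simp add: measure_measure_pmf_finite pmf)
    also have "\<dots> = (\<Sum>y\<in>X. g (x, y))"
      by (rule sum.reindex_bij_witness[of _ "Pair x" snd]) auto
    also have "\<dots> = pmf \<mu> x"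
    proof (cases "x \<in> X")
      case True
      then show ?thesis using rows by (simp add: g_def)
    next
      case False
      then have "pmf \<mu> x = 0" using \<mu> by (auto simp: set_pmf_iff)
      then show ?thesis using False by (simp add: g_def)
    qed
    finally show "pmf (map_pmf fst \<tau>) x = pmf \<mu> x" .
  qed
  moreover have "map_pmf snd \<tau> = \<nu>"
  proof (rule pmf_eqI)
    fix y
    have "pmf (map_pmf snd \<tau>) y = measure \<tau> (snd -` {y} \<inter> set_pmf \<tau>)"
      by (simp add: pmf_map measure_Int_set_pmf)
    also have "\<dots> = measure \<tau> (X \<times> {y})"
      using set by (subst (2) measure_Int_set_pmf[symmetric]) (auto intro!: arg_cong[of _ _ "measure \<tau>"])
    also have "\<dots> = (\<Sum>z\<in>X \<times> {y}. g z)" using X by (simp add: measure_measure_pmf_finite pmf)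
    also have "\<dots> = (\<Sum>x\<in>X. g (x, y))"
      by (rule sum.reindex_bij_witness[of _ "\<lambda>x. (x, y)" fst]) auto
    also have "\<dots> = pmf \<nu> y"
    proof (cases "y \<in> X")
      case True
      then show ?thesis using cols by (simp add: g_def)
    next
      case False
      then have "pmf \<nu> y = 0" using \<nu> by (auto simp: set_pmf_iff)
      then show ?thesis using False by (simp add: g_def)
    qed
    finally show "pmf (map_pmf snd \<tau>) y = pmf \<nu> y" .
  qed
  moreover have "measure_pmf.expectation \<tau> (\<lambda>(x, y). \<delta> x y) = plan_cost X \<delta> \<pi>"
  proof -
    have "measure_pmf.expectation \<tau> (\<lambda>(x, y). \<delta> x y) = (\<Sum>z\<in>X \<times> X. pmf \<tau> z * (case z of (x, y) \<Rightarrow> \<delta> x y))"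
      using X set by (subst integral_measure_pmf[of "X \<times> X"]) auto
    also have "\<dots> = plan_cost X \<delta> \<pi>"
      by (simp add: plan_cost_def pmf g_def sum.cartesian_product split_beta)
    finally show ?thesis .
  qed
  ultimately show ?thesis by (auto simp: couplings_def)
qed

lemma cell_mass_pmf:
  assumes "finite X" "set_pmf p \<subseteq> X"
  shows "cell_mass X f (pmf p) c = pmf (map_pmf f p) c"
proof -
  have "pmf (map_pmf f p) c = measure p (f -` {c} \<inter> set_pmf p)"
    by (simp add: pmf_map measure_Int_set_pmf)
  also have "\<dots> = measure p {x \<in> X. f x = c}"
    using assms(2) by (subst (2) measure_Int_set_pmf[symmetric]) (auto intro!: arg_cong[of _ _ "measure p"])
  finally show ?thesis using assms(1) by (simp add: cell_mass_def measure_measure_pmf_finite)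
qed

lemma hierarchical_coupling:
  fixes F :: "nat \<Rightarrow> 'a \<Rightarrow> 'c" and \<mu> \<nu> :: "'a pmf"
  assumes X: "finite X" and \<mu>: "set_pmf \<mu> \<subseteq> X" and \<nu>: "set_pmf \<nu> \<subseteq> X"
    and nested: "\<And>i x y. x \<in> X \<Longrightarrow> y \<in> X \<Longrightarrow> F (Suc i) x = F (Suc i) y \<Longrightarrow> F i x = F i y"
    and top: "\<And>x y. x \<in> X \<Longrightarrow> y \<in> X \<Longrightarrow> F 0 x = F 0 y"
    and \<delta>: "\<And>i x y. x \<in> X \<Longrightarrow> y \<in> X \<Longrightarrow> F i x = F i y \<Longrightarrow> \<delta> x y \<le> D i" and D: "\<And>i. 0 \<le> D i"
  shows "\<exists>\<tau>\<in>couplings \<mu> \<nu>. measure_pmf.expectation \<tau> (\<lambda>(x, y). \<delta> x y) \<le>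
    D L + (\<Sum>j<L. D j * (\<Sum>c\<in>F (Suc j) ` X. \<bar>pmf (map_pmf (F (Suc j)) \<mu>) c - pmf (map_pmf (F (Suc j)) \<nu>) c\<bar>))"
proof -
  have "\<exists>\<pi>. cell_plan X (F 0) (pmf \<mu>) (pmf \<nu>) \<pi> \<and> plan_cost X \<delta> \<pi>
      \<le> D L * (\<Sum>x\<in>X. pmf \<mu> x) + (\<Sum>j\<in>{0..<L}. D j * cell_l1 X (F (Suc j)) (pmf \<mu>) (pmf \<nu>))"
  proof (rule hierarchical_plan[OF X])
    show "F i x = F i y" if "x \<in> X" "y \<in> X" "F (Suc i) x = F (Suc i) y" for i x y
      using nested that .
    show "\<delta> x y \<le> D i" if "x \<in> X" "y \<in> X" "F i x = F i y" for i x y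
      using \<delta> that .
  qed (simp_all add: D)
  then obtain \<pi> where \<pi>: "cell_plan X (F 0) (pmf \<mu>) (pmf \<nu>) \<pi>"
    "plan_cost X \<delta> \<pi> \<le> D L * (\<Sum>x\<in>X. pmf \<mu> x) + (\<Sum>j\<in>{0..<L}. D j * cell_l1 X (F (Suc j)) (pmf \<mu>) (pmf \<nu>))"
    by blast
  obtain x0 where "x0 \<in> X" using \<mu> set_pmf_not_empty[of \<mu>] by blast
  then have all: "{x \<in> X. F 0 x = F 0 x0} = X" using top by blast
  have tot: "(\<Sum>x\<in>X. pmf \<mu> x) = 1" "(\<Sum>x\<in>X. pmf \<nu> x) = 1" using sum_pmf_eq_1[OF X] \<mu> \<nu> by auto
  have "cell_mass X (F 0) (\<lambda>x. \<Sum>y\<in>X. \<pi> x y) (F 0 x0) =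
      min (cell_mass X (F 0) (pmf \<mu>) (F 0 x0)) (cell_mass X (F 0) (pmf \<nu>) (F 0 x0))"
    using \<pi>(1) by (simp add: cell_plan_def)
  then have mass: "(\<Sum>x\<in>X. \<Sum>y\<in>X. \<pi> x y) = 1"
    unfolding cell_mass_def all tot by simp
  \<comment> \<open>Level 0 is a single class of mass 1 on both sides, so the maximal plan carries
    total mass 1. Marginals that are dominated and have equal totals must then be exact.\<close>
  have exact: "\<forall>x\<in>X. r x = s x" if "\<And>x. x \<in> X \<Longrightarrow> r x \<le> s x" "sum r X = 1" "sum s X = 1" for r s :: "'a \<Rightarrow> real"
  proof -
    have "(\<Sum>x\<in>X. s x - r x) = 0" using that by (simp add: sum_subtractf)
    then show ?thesis using that(1) X by (subst (asm) sum_nonneg_eq_0_iff) auto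
  qed
  have r: "\<forall>x\<in>X. (\<Sum>y\<in>X. \<pi> x y) = pmf \<mu> x"
    using \<pi>(1) mass tot by (intro exact) (auto simp: cell_plan_def)
  have c: "\<forall>y\<in>X. (\<Sum>x\<in>X. \<pi> x y) = pmf \<nu> y"
    using \<pi>(1) mass tot sum.swap[of \<pi> X X] by (intro exact) (auto simp: cell_plan_def)
  obtain \<tau> where \<tau>: "\<tau> \<in> couplings \<mu> \<nu>" "measure_pmf.expectation \<tau> (\<lambda>(x, y). \<delta> x y) = plan_cost X \<delta> \<pi>"
    using plan_coupling[OF X \<mu> \<nu>, of \<pi> \<delta>] \<pi>(1) r c by (auto simp: cell_plan_def)
  show ?thesis
    by (rule bexI[OF _ \<tau>(1)], subst \<tau>(2))
      (use \<pi>(2) tot in \<open>simp add: cell_l1_def cell_mass_pmf[OF X \<mu>] cell_mass_pmf[OF X \<nu>] atLeast0LessThan\<close>)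
qed

lemma EMD_le_coupling:
  assumes "\<And>x y. 0 \<le> \<delta> x y" "\<pi> \<in> couplings \<mu> \<nu>"
  shows "EMD \<delta> \<mu> \<nu> \<le> measure_pmf.expectation \<pi> (\<lambda>(x, y). \<delta> x y)"
  unfolding EMD_def
  by (intro cINF_lower bdd_belowI2[of _ 0] assms(2) integral_nonneg_AE) (use assms(1) in auto)

lemma set_coupling_subset:
  assumes "\<pi> \<in> couplings \<mu> \<nu>" "set_pmf \<mu> \<subseteq> X" "set_pmf \<nu> \<subseteq> X" 
  shows "set_pmf \<pi> \<subseteq> X \<times> X"
proof
  fix z assume "z \<in> set_pmf \<pi>"
  then have "fst z \<in> set_pmf (map_pmf fst \<pi>)" "snd z \<in> set_pmf (map_pmf snd \<pi>)"
    unfolding set_map_pmf by blast+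
  moreover have "map_pmf fst \<pi> = \<mu>" "map_pmf snd \<pi> = \<nu>" using assms(1) by (auto simp: couplings_def)
  ultimately show "z \<in> X \<times> X" using assms(2,3) by (simp add: mem_Times_iff subset_iff)
qed

text \<open>The gluing behind the triangle inequality: \<open>\<pi>2\<close> is redrawn conditioned
  on the middle point that \<open>\<pi>1\<close> produced. It is stated for given couplings, so no
  coupling attaining an infimum has to be found.\<close>

lemma EMD_glue:
  fixes \<mu> \<mu>' \<nu> :: "'a pmf"
  assumes X: "finite X" "set_pmf \<mu> \<subseteq> X" "set_pmf \<mu>' \<subseteq> X" "set_pmf \<nu> \<subseteq> X"
    and \<pi>1: "\<pi>1 \<in> couplings \<mu> \<mu>'" and \<pi>2: "\<pi>2 \<in> couplings \<mu>' \<nu>"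
    and nonneg: "\<And>x y. 0 \<le> \<delta> x y"
    and tri: "\<And>x y z. x \<in> X \<Longrightarrow> y \<in> X \<Longrightarrow> z \<in> X \<Longrightarrow> \<delta> x z \<le> \<delta> x y + \<delta> y z"
  shows "EMD \<delta> \<mu> \<nu> \<le> E \<pi>1 (\<lambda>(x, y). \<delta> x y) + E \<pi>2 (\<lambda>(x, y). \<delta> x y)"
proof -
  define N where "N y = cond_pmf \<pi>2 {w. fst w = y}" for y
  define \<tau> where "\<tau> = bind_pmf \<pi>1 (\<lambda>z. map_pmf (\<lambda>w. (z, w)) (N (snd z)))"
  have s1: "set_pmf \<pi>1 \<subseteq> X \<times> X" by (rule set_coupling_subset[OF \<pi>1 X(2,3)])
  have s2: "set_pmf \<pi>2 \<subseteq> X \<times> X" by (rule set_coupling_subset[OF \<pi>2 X(3,4)])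
  have m1: "map_pmf fst \<pi>1 = \<mu>" "map_pmf snd \<pi>1 = \<mu>'" using \<pi>1 by (auto simp: couplings_def)
  have m2: "map_pmf fst \<pi>2 = \<mu>'" "map_pmf snd \<pi>2 = \<nu>" using \<pi>2 by (auto simp: couplings_def)
  have ne: "set_pmf \<pi>2 \<inter> {w. fst w = y} \<noteq> {}" if "y \<in> set_pmf \<mu>'" for y
    using that unfolding m2(1)[symmetric] by auto
  have setN: "set_pmf (N y) = set_pmf \<pi>2 \<inter> {w. fst w = y}" if "y \<in> set_pmf \<mu>'" for y
    unfolding N_def by (rule set_cond_pmf[OF ne[OF that]])
  have snd1: "snd z \<in> set_pmf \<mu>'" if "z \<in> set_pmf \<pi>1" for z
    using that unfolding m1(2)[symmetric] by simp
  have set\<tau>: "fst t \<in> set_pmf \<pi>1 \<and> snd t \<in> set_pmf \<pi>2 \<and> fst (snd t) = snd (fst t)" if "t \<in> set_pmf \<tau>" for t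
    using that snd1 by (auto simp: \<tau>_def setN)
  \<comment> \<open>Disintegration: averaging the conditional laws of \<open>\<pi>2\<close> over its
    first marginal recovers \<open>\<pi>2\<close>.\<close>
  have bindN: "bind_pmf \<mu>' N = \<pi>2"
    unfolding N_def
  proof (rule bind_cond_pmf_cancel)
    show "set_pmf \<mu>' \<inter> {x. fst w = x} \<noteq> {}" if "w \<in> set_pmf \<pi>2" for w
      using that unfolding m2(1)[symmetric] by auto
    fix x :: 'a and w :: "'a \<times> 'a" assume "fst w = x"
    then have sing: "{x. fst w = x} = {x}" by auto
    have "measure \<mu>' {x} = measure \<pi>2 (fst -` {x})" unfolding m2(1)[symmetric] by simp
    also have "fst -` {x} = {w :: 'a \<times> 'a. fst w = x}" by auto
    finally show "measure \<pi>2 {w. fst w = x} = measure \<mu>' {x. fst w = x}"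
      unfolding sing by (rule sym)
  qed (use ne in auto)
  have \<tau>1: "map_pmf fst \<tau> = \<pi>1"
    unfolding \<tau>_def by (simp add: map_bind_pmf map_pmf_comp bind_return_pmf')
  have \<tau>2: "map_pmf snd \<tau> = \<pi>2"
  proof -
    have "map_pmf snd \<tau> = bind_pmf \<pi>1 (\<lambda>z. N (snd z))"
      unfolding \<tau>_def by (simp add: map_bind_pmf map_pmf_comp)
    also have "\<dots> = bind_pmf \<mu>' N" unfolding m1(2)[symmetric] by (simp add: bind_map_pmf)
    finally show ?thesis using bindN by simp
  qed
  have fin: "finite (set_pmf \<tau>)"
  proof (rule finite_subset)
    show "set_pmf \<tau> \<subseteq> (X \<times> X) \<times> (X \<times> X)"
    proof
      fix t assume "t \<in> set_pmf \<tau>"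
      then show "t \<in> (X \<times> X) \<times> (X \<times> X)" using set\<tau> s1 s2 by (metis mem_Times_iff subsetD)
    qed
  qed (use X in simp)
  let ?\<pi> = "map_pmf (\<lambda>t. (fst (fst t), snd (snd t))) \<tau>"
  have "?\<pi> \<in> couplings \<mu> \<nu>"
  proof -
    have "map_pmf fst ?\<pi> = map_pmf fst (map_pmf fst \<tau>)" "map_pmf snd ?\<pi> = map_pmf snd (map_pmf snd \<tau>)"
      by (simp_all add: map_pmf_comp)
    then show ?thesis unfolding \<tau>1 \<tau>2 m1 m2 by (simp add: couplings_def)
  qed
  then have "EMD \<delta> \<mu> \<nu> \<le> E ?\<pi> (\<lambda>(x, y). \<delta> x y)" by (intro EMD_le_coupling nonneg)
  also have "\<dots> = E \<tau> (\<lambda>t. \<delta> (fst (fst t)) (snd (snd t)))" by simp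
  also have "\<dots> \<le> E \<tau> (\<lambda>t. \<delta> (fst (fst t)) (snd (fst t)) + \<delta> (fst (snd t)) (snd (snd t)))"
  proof (rule E_mono[OF fin])
    fix t assume "t \<in> set_pmf \<tau>"
    then have "fst t \<in> X \<times> X" "snd t \<in> X \<times> X" "fst (snd t) = snd (fst t)" using set\<tau> s1 s2 by blast+
    then show "\<delta> (fst (fst t)) (snd (snd t)) \<le> \<delta> (fst (fst t)) (snd (fst t)) + \<delta> (fst (snd t)) (snd (snd t))"
      using tri by (simp add: mem_Times_iff)
  qed
  also have "\<dots> = E (map_pmf fst \<tau>) (\<lambda>(x, y). \<delta> x y) + E (map_pmf snd \<tau>) (\<lambda>(x, y). \<delta> x y)"
    by (subst E_add[OF fin]) (simp add: split_beta)
  finally show ?thesis unfolding \<tau>1 \<tau>2 .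
qed

section \<open>The normalized metric on the grid\<close>

text \<open>Convexity of the power function for positive arguments, extended to 0. There the claim
  becomes \<open>(s * w) powr p \<le> s * w powr p\<close>, which follows from
  \<open>s powr p \<le> s\<close> on the unit interval.\<close>

lemma powr_mean_le:
  assumes p: "1 \<le> p" and u: "0 \<le> u" and v: "0 \<le> v" and t: "0 \<le> t" "t \<le> (1::real)"
  shows "((1 - t) * u + t * v) powr p \<le> (1 - t) * u powr p + t * v powr p"
proof -
  have shrink: "(s * w) powr p \<le> s * w powr p" if "0 \<le> s" "s \<le> 1" "0 \<le> w" for s w :: real
  proof (cases "s = 0")
    case False
    then have "s powr p \<le> s" using that p by (intro powr_le_one_le) auto
    then have "s powr p * w powr p \<le> s * w powr p" by (intro mult_right_mono) auto
    then show ?thesis using that by (simp add: powr_mult)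
  qed simp
  consider "u = 0" | "v = 0" | "0 < u" "0 < v" using u v by linarith
  then show ?thesis
  proof cases
    case 1
    then show ?thesis using shrink[of t v] t v by simp
  next
    case 2
    then show ?thesis using shrink[of "1 - t" u] t u by simp
  next
    case 3
    then show ?thesis using convex_onD[OF powr_convex[OF p] t, of u v] by simp
  qed
qed

lemma Minkowski_powr:
  fixes f g :: "nat \<Rightarrow> real"
  assumes p: "1 \<le> p" and f: "\<And>i. 0 \<le> f i" and g: "\<And>i. 0 \<le> g i"
  shows "(\<Sum>i<d. (f i + g i) powr p) powr (1 / p) \<le>
    (\<Sum>i<d. f i powr p) powr (1 / p) + (\<Sum>i<d. g i powr p) powr (1 / p)"
proof -
  define A where "A = (\<Sum>i<d. f i powr p) powr (1 / p)"
  define B where "B = (\<Sum>i<d. g i powr p) powr (1 / p)"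
  have Ap: "(\<Sum>i<d. f i powr p) = A powr p" and Bp: "(\<Sum>i<d. g i powr p) = B powr p"
    using p by (simp_all add: A_def B_def powr_powr sum_nonneg)
  have zero: "\<forall>i<d. h i = 0" if "(\<Sum>i<d. h i powr p) = 0" for h :: "nat \<Rightarrow> real"
    using that by (subst (asm) sum_nonneg_eq_0_iff) auto
  have A0: "0 \<le> A" and B0: "0 \<le> B" by (auto simp: A_def B_def)
  consider "A = 0" | "B = 0" | "0 < A" "0 < B" using A0 B0 by linarith
  then show ?thesis
  proof cases
    case 1
    then show ?thesis using zero[of f] Ap by simp
  next
    case 2
    then show ?thesis using zero[of g] Bp by simp
  next
    case 3
    \<comment> \<open>The sum is \<open>A + B\<close> times a convex combination of the normalized
      functions \<open>f / A\<close> and \<open>g / B\<close>, so convexity applies coordinatewise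
      with this weight.\<close>
    define t where "t = B / (A + B)"
    have t: "0 \<le> t" "t \<le> 1" "1 - t = A / (A + B)" using 3 by (auto simp: t_def field_simps)
    have "(\<Sum>i<d. (f i + g i) powr p) = (\<Sum>i<d. (A + B) powr p * ((1 - t) * (f i / A) + t * (g i / B)) powr p)"
    proof (intro sum.cong refl)
      fix i
      have "f i + g i = (A + B) * ((1 - t) * (f i / A) + t * (g i / B))"
      proof -
        have "(1 - t) * (f i / A) = f i / (A + B)" "t * (g i / B) = g i / (A + B)"
          unfolding t(3) unfolding t_def using 3 by simp_all
        then show ?thesis using 3 by (simp add: add_divide_distrib[symmetric])
      qed
      then show "(f i + g i) powr p = (A + B) powr p * ((1 - t) * (f i / A) + t * (g i / B)) powr p"
        using 3 t f[of i] g[of i] by (simp only: powr_mult)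
    qed
    also have "\<dots> \<le> (\<Sum>i<d. (A + B) powr p * ((1 - t) * (f i / A) powr p + t * (g i / B) powr p))"
      using 3 t f g p by (intro sum_mono mult_left_mono powr_mean_le) auto
    also have "\<dots> = (A + B) powr p * ((1 - t) * ((\<Sum>i<d. f i powr p) / A powr p) + t * ((\<Sum>i<d. g i powr p) / B powr p))"
      using 3 f g by (simp add: powr_divide sum.distrib sum_distrib_left sum_divide_distrib distrib_left)
    also have "\<dots> = (A + B) powr p" unfolding Ap Bp using 3 by simp
    finally have "(\<Sum>i<d. (f i + g i) powr p) powr (1 / p) \<le> ((A + B) powr p) powr (1 / p)"
      using p by (intro powr_mono2 sum_nonneg) auto
    also have "\<dots> = A + B" using 3 p by (simp add: powr_powr)
    finally show ?thesis by (simp add: A_def B_def)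
  qed
qed

lemma ndist_nonneg: "0 \<le> ndist p n d x y"
  by (simp add: ndist_def lp_dist_def)

lemma ndist_triangle:
  assumes "1 \<le> p"
  shows "ndist p n d x z \<le> ndist p n d x y + ndist p n d y z"
proof -
  have "lp_dist p d x z \<le> (\<Sum>i<d. (\<bar>real (x i) - real (y i)\<bar> + \<bar>real (y i) - real (z i)\<bar>) powr p) powr (1 / p)"
    unfolding lp_dist_def using assms by (intro powr_mono2 sum_mono sum_nonneg) auto
  also have "\<dots> \<le> lp_dist p d x y + lp_dist p d y z"
    unfolding lp_dist_def by (intro Minkowski_powr assms) auto
  finally show ?thesis
    unfolding ndist_def add_divide_distrib[symmetric] by (intro divide_right_mono) auto
qed

text \<open>The normalization by \<open>d powr (1 / p)\<close> is exactly the norm of the all-ones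
  vector, so the bound is the same for all \<open>p\<close> and \<open>d\<close>.\<close>

lemma ndist_le:
  assumes "1 \<le> p" "1 \<le> d" "0 \<le> t" "\<And>i. i < d \<Longrightarrow> \<bar>real (x i) - real (y i)\<bar> \<le> t"
  shows "ndist p n d x y \<le> t / real n"
proof -
  have "lp_dist p d x y \<le> (\<Sum>i<d. t powr p) powr (1 / p)"
    unfolding lp_dist_def using assms by (intro powr_mono2 sum_mono sum_nonneg) auto
  also have "\<dots> = real d powr (1 / p) * t"
    using assms by (simp add: powr_mult powr_powr)
  finally have "ndist p n d x y \<le> (real d powr (1 / p) * t) / (real d powr (1 / p) * real n)"
    unfolding ndist_def by (intro divide_right_mono) auto
  also have "\<dots> = t / real n" using assms(2) by simp
  finally show ?thesis .
qed

lemma ndist_le_1: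
  assumes "1 \<le> p" "1 \<le> d" "x \<in> grid n d" "y \<in> grid n d"
  shows "ndist p n d x y \<le> 1"
proof -
  have "ndist p n d x y \<le> real n / real n"
  proof (rule ndist_le[OF assms(1,2)])
    show "\<bar>real (x i) - real (y i)\<bar> \<le> real n" if "i < d" for i
      using grid_bounds[OF assms(3) that] grid_bounds[OF assms(4) that] by linarith
  qed simp
  also have "\<dots> \<le> 1" by simp
  finally show ?thesis .
qed

section \<open>Dyadic cubes\<close>

definition dyadic :: "nat \<Rightarrow> nat \<Rightarrow> nat \<Rightarrow> point \<Rightarrow> point" where
  "dyadic n d j x = (\<lambda>i\<in>{..<d}. (x i - 1) * 2 ^ j div n)"

lemma dyadic_eqD:
  assumes "dyadic n d j x = dyadic n d j y" "i < d"
  shows "(x i - 1) * 2 ^ j div n = (y i - 1) * 2 ^ j div n"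
  using fun_cong[OF assms(1), of i] assms(2) by (simp add: dyadic_def)

text \<open>Coordinates are scaled before the integer division, which covers every \<open>n\<close>,
  not only powers of two. The index at level \<open>j\<close> is the halved index at level
  \<open>Suc j\<close>, as iterated floor division shows.\<close>

lemma dyadic_nested:
  assumes "dyadic n d (Suc j) x = dyadic n d (Suc j) y"
  shows "dyadic n d j x = dyadic n d j y"
proof -
  have half: "a * 2 ^ j div n = (a * 2 ^ Suc j div n) div 2" for a :: nat
  proof -
    have "(a * 2 ^ Suc j div n) div 2 = (a * 2 ^ j * 2) div (n * 2)"
      by (simp add: div_mult2_eq mult_ac)
    then show ?thesis by simp
  qed
  show ?thesis unfolding dyadic_def
    by (intro restrict_ext) (use dyadic_eqD[OF assms] half in auto)
qed

lemma card_dyadic: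
  assumes "1 \<le> n"
  shows "finite (dyadic n d j ` grid n d) \<and> card (dyadic n d j ` grid n d) \<le> 2 ^ (j * d)"
proof -
  let ?S = "\<Pi>\<^sub>E i\<in>{..<d}. {..<(2::nat) ^ j}"
  have "dyadic n d j ` grid n d \<subseteq> ?S"
  proof (rule image_subsetI)
    fix x assume x: "x \<in> grid n d"
    have "(x i - 1) * 2 ^ j div n < 2 ^ j" if "i < d" for i
    proof -
      have "x i - 1 < n" using grid_bounds[OF x that] by linarith
      then have "(x i - 1) * 2 ^ j < n * 2 ^ j" by simp
      then show ?thesis by (simp add: less_mult_imp_div_less mult.commute)
    qed
    then show "dyadic n d j x \<in> ?S" by (auto simp: dyadic_def)
  qed
  moreover have "finite ?S" by (intro finite_PiE) auto
  moreover have "card ?S = 2 ^ (j * d)" by (subst card_PiE) (auto simp: power_mult)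
  ultimately show ?thesis using card_mono finite_subset by metis
qed

lemma dyadic_0:
  assumes "x \<in> grid n d" "y \<in> grid n d"
  shows "dyadic n d 0 x = dyadic n d 0 y"
  unfolding dyadic_def
proof (intro restrict_ext)
  fix i assume "i \<in> {..<d}"
  then have "x i - 1 < n" "y i - 1 < n"
    using grid_bounds[OF assms(1), of i] grid_bounds[OF assms(2), of i] by auto
  then show "(x i - 1) * 2 ^ 0 div n = (y i - 1) * 2 ^ 0 div n" by simp
qed

lemma ndist_dyadic:
  assumes "1 \<le> p" "1 \<le> d" "1 \<le> n" "x \<in> grid n d" "y \<in> grid n d" "dyadic n d j x = dyadic n d j y"
  shows "ndist p n d x y \<le> 1 / 2 ^ j"
proof -
  have "ndist p n d x y \<le> (real n / 2 ^ j) / real n"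
  proof (rule ndist_le[OF assms(1,2)])
    fix i assume i: "i < d"
    define u v where "u = x i - 1" and "v = y i - 1"
    let ?a = "u * 2 ^ j" and ?b = "v * 2 ^ j"
    have "?a div n = ?b div n" using dyadic_eqD[OF assms(6) i] unfolding u_def v_def .
    moreover have "?a = n * (?a div n) + ?a mod n" "?b = n * (?b div n) + ?b mod n" by simp_all
    moreover have "?a mod n < n" "?b mod n < n" using assms(3) by simp_all
    ultimately have "?a < ?b + n" "?b < ?a + n" by (smt (verit) add.assoc add_less_cancel_left le_add2 order.strict_trans2 add.commute)+
    then have "real ?a < real ?b + real n" "real ?b < real ?a + real n" by linarith+
    then have "\<bar>(real u - real v) * 2 ^ j\<bar> \<le> real n"
      by (simp add: algebra_simps abs_le_iff)
    then have "\<bar>real u - real v\<bar> \<le> real n / 2 ^ j"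
      by (simp add: abs_mult pos_le_divide_eq)
    then show "\<bar>real (x i) - real (y i)\<bar> \<le> real n / 2 ^ j"
      using grid_bounds[OF assms(4) i] grid_bounds[OF assms(5) i] by (simp add: of_nat_diff u_def v_def)
  qed simp
  then show ?thesis using assms(3) by simp
qed

section \<open>Testing identity under the earth mover's distance\<close>

text \<open>Chosen so that \<open>2 ^ levels \<epsilon>\<close> is at least
  \<open>4 / \<epsilon>\<close>: the finest cubes then contribute at most
  \<open>\<epsilon> / 4\<close>.\<close>

definition levels :: "real \<Rightarrow> nat" where
  "levels \<epsilon> = nat \<lceil>log 2 (4 / \<epsilon>)\<rceil>"

text \<open>The solution of 2^(1-j) * gap = \<epsilon> / (2L): if every level stays below its gap,
  all of them together cost at most \<open>\<epsilon> / 2\<close>.\<close>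

definition level_gap :: "real \<Rightarrow> nat \<Rightarrow> real" where
  "level_gap \<epsilon> j = 2 ^ j * \<epsilon> / (4 * real (levels \<epsilon>))"

text \<open>The constant is 2000 * 16, where 16 comes from the squared denominator
  \<open>4 * L\<close> of the gap. Two factors \<open>L\<close> come from there as well, the third
  pays for testing all levels. The power of 8 stems from
  \<open>2 ^ j \<le> 8 / \<epsilon>\<close>.\<close>

definition batch :: "nat \<Rightarrow> real \<Rightarrow> nat" where
  "batch d \<epsilon> = nat \<lceil>32000 * real (levels \<epsilon>) ^ 3 * 8 ^ d * \<epsilon> powr (- max 2 (real d / 2))\<rceil>"

definition emd_reject :: "nat \<Rightarrow> nat \<Rightarrow> real \<Rightarrow> point pmf \<Rightarrow> point list \<Rightarrow> point list \<Rightarrow> bool" where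
  "emd_reject n d \<epsilon> \<nu> xs ys \<longleftrightarrow> (\<exists>j\<in>{1..levels \<epsilon>}.
     far_test (dyadic n d j ` grid n d) (map_pmf (dyadic n d j) \<nu>) (level_gap \<epsilon> j)
       (map (dyadic n d j) xs) (map (dyadic n d j) ys))"

lemma levels_bounds:
  assumes "0 < \<epsilon>" "\<epsilon> < 1"
  shows "1 \<le> levels \<epsilon>" "4 / \<epsilon> \<le> 2 ^ levels \<epsilon>" "2 ^ levels \<epsilon> \<le> 8 / \<epsilon>"
    "real (levels \<epsilon>) \<le> log 2 (4 / \<epsilon>) + 1"
proof -
  have four: "4 \<le> 4 / \<epsilon>" using assms by (simp add: divide_simps)
  then have "log 2 4 \<le> log 2 (4 / \<epsilon>)" using assms by (subst log_le_cancel_iff) auto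
  moreover have "log 2 4 = (2::real)" using log_pow_cancel[of 2 2] by simp
  ultimately have l: "2 \<le> log 2 (4 / \<epsilon>)" by simp
  then have b: "log 2 (4 / \<epsilon>) \<le> real (levels \<epsilon>)" "real (levels \<epsilon>) \<le> log 2 (4 / \<epsilon>) + 1"
    unfolding levels_def by linarith+
  then show "1 \<le> levels \<epsilon>" "real (levels \<epsilon>) \<le> log 2 (4 / \<epsilon>) + 1" using l by linarith+
  have p: "2 ^ levels \<epsilon> = 2 powr real (levels \<epsilon>)" by (simp add: powr_realpow)
  have "2 powr (log 2 (4 / \<epsilon>)) \<le> 2 powr real (levels \<epsilon>)" using b by simp
  then show "4 / \<epsilon> \<le> 2 ^ levels \<epsilon>" unfolding p using assms by simp
  have "2 powr real (levels \<epsilon>) \<le> 2 powr (log 2 (4 / \<epsilon>) + 1)" using b by simp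
  also have "\<dots> = 8 / \<epsilon>" using assms by (simp add: powr_add)
  finally show "2 ^ levels \<epsilon> \<le> 8 / \<epsilon>" unfolding p .
qed

text \<open>The square root of \<open>2 ^ (j * d)\<close> splits into
  \<open>(2 ^ j)\<^sup>2\<close>, which cancels against the squared gap, and a remaining power with
  exponent \<open>d / 2 - 2\<close>. The latter is largest at the finest level for
  \<open>d \<ge> 4\<close> and at most 1 otherwise; the exponent \<open>e\<close> treats both cases
  at once.\<close>

lemma batch_sufficient:
  assumes \<epsilon>: "0 < \<epsilon>" "\<epsilon> < 1" and n: "1 \<le> n" and j: "j \<le> levels \<epsilon>"
  shows "2000 * real (levels \<epsilon>) * sqrt (real (card (dyadic n d j ` grid n d))) / (level_gap \<epsilon> j)\<^sup>2
    \<le> real (batch d \<epsilon>)"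
proof -
  define L where "L = real (levels \<epsilon>)"
  define e where "e = max 2 (real d / 2) - 2"
  have L: "1 \<le> L" using levels_bounds[OF \<epsilon>] by (simp add: L_def)
  have "(2::real) ^ j \<le> 2 ^ levels \<epsilon>" using j by (intro power_increasing) auto
  then have j2: "2 ^ j \<le> 8 / \<epsilon>" using levels_bounds(3)[OF \<epsilon>] by linarith
  have e: "0 \<le> e" "real d / 2 - 2 \<le> e" "e \<le> real d" by (auto simp: e_def)
  have "sqrt (real (card (dyadic n d j ` grid n d))) \<le> sqrt (2 ^ (j * d))"
    using card_dyadic[OF n, of d j] by (metis of_nat_le_iff of_nat_numeral of_nat_power real_sqrt_le_iff)
  also have "\<dots> = (2 ^ j) powr (real d / 2)"
    by (simp add: powr_half_sqrt[symmetric] powr_realpow[symmetric] powr_powr)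
  also have "\<dots> = (2 ^ j) powr (real d / 2 - 2) * (2 ^ j)\<^sup>2"
    by (simp add: powr_diff powr_realpow[of "2 ^ j" 2, simplified])
  also have "(2 ^ j :: real) powr (real d / 2 - 2) \<le> (2 ^ j) powr e"
    using e(2) by (intro powr_mono) auto
  also have "(2 ^ j :: real) powr e \<le> (8 / \<epsilon>) powr e"
    using j2 e by (intro powr_mono2) auto
  also have "(8 / \<epsilon>) powr e = 8 powr e * \<epsilon> powr (- e)"
    using \<epsilon> by (simp add: powr_divide powr_minus_divide)
  also have "8 powr e \<le> 8 powr real d" using e by (intro powr_mono) auto
  also have "8 powr real d = 8 ^ d" by (simp add: powr_realpow)
  finally have card: "sqrt (real (card (dyadic n d j ` grid n d))) \<le> 8 ^ d * \<epsilon> powr (- e) * (2 ^ j)\<^sup>2"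
    by (simp add: mult_right_mono)
  have "2000 * L * sqrt (real (card (dyadic n d j ` grid n d))) / (level_gap \<epsilon> j)\<^sup>2
      \<le> 2000 * L * (8 ^ d * \<epsilon> powr (- e) * (2 ^ j)\<^sup>2) / (level_gap \<epsilon> j)\<^sup>2"
    using L by (intro divide_right_mono mult_left_mono card) auto
  also have "\<dots> = 32000 * L ^ 3 * 8 ^ d * (\<epsilon> powr (- e) / \<epsilon>\<^sup>2)"
    using \<epsilon> L by (simp add: level_gap_def L_def[symmetric] field_simps power2_eq_square power3_eq_cube)
  also have "\<epsilon> powr (- e) / \<epsilon>\<^sup>2 = \<epsilon> powr (- max 2 (real d / 2))"
    using \<epsilon> powr_diff[of \<epsilon> "- e" 2] by (simp add: e_def)
  also have "32000 * L ^ 3 * 8 ^ d * \<epsilon> powr (- max 2 (real d / 2)) \<le> real (batch d \<epsilon>)"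
    unfolding batch_def L_def by linarith
  finally show ?thesis unfolding L_def .
qed

lemma batch_pos:
  assumes "0 < \<epsilon>" "\<epsilon> < 1"
  shows "0 < batch d \<epsilon>"
  using assms levels_bounds(1)[OF assms] unfolding batch_def by simp

lemma level_gap_pos: "0 < \<epsilon> \<Longrightarrow> \<epsilon> < 1 \<Longrightarrow> 0 < level_gap \<epsilon> j"
  using levels_bounds(1)[of \<epsilon>] by (simp add: level_gap_def)

lemma prob_map_replicate_pair:
  "measure_pmf.prob (pair_pmf (replicate_pmf m p) (replicate_pmf m p)) {(xs, ys). R (map f xs) (map f ys)} =
   measure_pmf.prob (pair_pmf (replicate_pmf m (map_pmf f p)) (replicate_pmf m (map_pmf f p))) {(xs, ys). R xs ys}"
proof -
  have "pair_pmf (replicate_pmf m (map_pmf f p)) (replicate_pmf m (map_pmf f p)) =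
      map_pmf (\<lambda>(xs, ys). (map f xs, map f ys)) (pair_pmf (replicate_pmf m p) (replicate_pmf m p))"
    by (simp add: map_replicate_pmf map_pair)
  moreover have "(\<lambda>(xs, ys). (map f xs, map f ys)) -` {(xs, ys). R xs ys} = {(xs, ys). R (map f xs) (map f ys)}"
    by auto
  ultimately show ?thesis by simp
qed

text \<open>All levels share one pair of batches, so a union bound is used; the factor
  \<open>L\<close> in the sample size brings each level below \<open>1 / (6 * L)\<close>. On the far
  side a single level suffices.\<close>

lemma emd_reject_null:
  assumes \<epsilon>: "0 < \<epsilon>" "\<epsilon> < 1" and n: "1 \<le> n" and \<nu>: "set_pmf \<nu> \<subseteq> grid n d"
  shows "measure_pmf.prob (pair_pmf (replicate_pmf (batch d \<epsilon>) \<nu>) (replicate_pmf (batch d \<epsilon>) \<nu>))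
    {(xs, ys). emd_reject n d \<epsilon> \<nu> xs ys} \<le> 1 / 6"
proof -
  let ?m = "batch d \<epsilon>" and ?L = "levels \<epsilon>"
  let ?D = "pair_pmf (replicate_pmf ?m \<nu>) (replicate_pmf ?m \<nu>)"
  let ?R = "\<lambda>j xs ys. far_test (dyadic n d j ` grid n d) (map_pmf (dyadic n d j) \<nu>) (level_gap \<epsilon> j) xs ys"
  let ?S = "\<lambda>j. {(xs, ys). ?R j (map (dyadic n d j) xs) (map (dyadic n d j) ys)}"
  have L: "1 \<le> real ?L" using levels_bounds(1)[OF \<epsilon>] by simp
  have "{(xs, ys). emd_reject n d \<epsilon> \<nu> xs ys} = (\<Union>j\<in>{1..?L}. ?S j)"
    by (auto simp: emd_reject_def)
  then have "measure_pmf.prob ?D {(xs, ys). emd_reject n d \<epsilon> \<nu> xs ys} \<le> (\<Sum>j\<in>{1..?L}. measure_pmf.prob ?D (?S j))"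
    by (simp add: measure_pmf.finite_measure_subadditive_finite)
  also have "\<dots> \<le> (\<Sum>j\<in>{1..?L}. 1 / (6 * real ?L))"
  proof (rule sum_mono)
    fix j assume j: "j \<in> {1..?L}"
    define k where "k = real (card (dyadic n d j ` grid n d))"
    define \<delta> where "\<delta> = level_gap \<epsilon> j"
    have \<delta>: "0 < \<delta>" using level_gap_pos[OF \<epsilon>] by (simp add: \<delta>_def)
    have "2000 * real ?L * sqrt k / \<delta>\<^sup>2 \<le> real ?m"
      unfolding k_def \<delta>_def using batch_sufficient[OF \<epsilon> n] j by simp
    then have "2000 * real ?L * sqrt k \<le> real ?m * \<delta>\<^sup>2" using \<delta> by (simp add: pos_divide_le_eq)
    then have "(2000 * real ?L * sqrt k)\<^sup>2 \<le> (real ?m * \<delta>\<^sup>2)\<^sup>2" using L by (intro power_mono) (auto simp: k_def)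
    then have sq: "2000\<^sup>2 * (real ?L)\<^sup>2 * k \<le> (real ?m)\<^sup>2 * \<delta> ^ 4"
      by (simp add: power_mult_distrib k_def)
    have "real ?L \<le> (real ?L)\<^sup>2" using L by (simp add: power2_eq_square)
    then have "real ?L * k \<le> (real ?L)\<^sup>2 * k" by (intro mult_right_mono) (auto simp: k_def)
    moreover have "0 \<le> (real ?L)\<^sup>2 * k" by (simp add: k_def)
    moreover have "384 * k * (6 * real ?L) = 2304 * (real ?L * k)" by simp
    moreover have "2000\<^sup>2 * (real ?L)\<^sup>2 * k = 4000000 * ((real ?L)\<^sup>2 * k)" by simp
    ultimately have "384 * k * (6 * real ?L) \<le> (real ?m)\<^sup>2 * \<delta> ^ 4" using sq by linarith
    then have "384 * k / ((real ?m)\<^sup>2 * \<delta> ^ 4) \<le> 1 / (6 * real ?L)"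
      using \<delta> L batch_pos[OF \<epsilon>, of d] by (simp add: divide_simps mult_ac)
    moreover have "measure_pmf.prob ?D (?S j) \<le> 384 * k / ((real ?m)\<^sup>2 * \<delta> ^ 4)"
      unfolding prob_map_replicate_pair[of ?m \<nu> "?R j" "dyadic n d j"] k_def \<delta>_def
      using card_dyadic[OF n] \<nu> level_gap_pos[OF \<epsilon>] batch_pos[OF \<epsilon>, of d]
      by (intro far_test_null) auto
    ultimately show "measure_pmf.prob ?D (?S j) \<le> 1 / (6 * real ?L)" by linarith
  qed
  also have "\<dots> \<le> 1 / 6" using L by simp
  finally show ?thesis .
qed

lemma emd_reject_far:
  assumes \<epsilon>: "0 < \<epsilon>" "\<epsilon> < 1" and n: "1 \<le> n" and d: "1 \<le> d" and p: "1 \<le> p"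
    and \<nu>: "set_pmf \<nu> \<subseteq> grid n d" and \<mu>: "set_pmf \<mu> \<subseteq> grid n d"
    and far: "\<And>\<tau>. \<tau> \<in> couplings \<mu> \<nu> \<Longrightarrow> E \<tau> (\<lambda>(x, y). ndist p n d x y) > 3 * \<epsilon> / 4"
  shows "measure_pmf.prob (pair_pmf (replicate_pmf (batch d \<epsilon>) \<mu>) (replicate_pmf (batch d \<epsilon>) \<mu>))
    {(xs, ys). \<not> emd_reject n d \<epsilon> \<nu> xs ys} \<le> 1 / 6"
proof -
  let ?m = "batch d \<epsilon>" and ?L = "levels \<epsilon>"
  let ?D = "pair_pmf (replicate_pmf ?m \<mu>) (replicate_pmf ?m \<mu>)"
  define J where "J j = dyadic n d j ` grid n d" for j
  define gap where "gap j = (\<Sum>c\<in>J j. \<bar>pmf (map_pmf (dyadic n d j) \<mu>) c - pmf (map_pmf (dyadic n d j) \<nu>) c\<bar>)" for j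
  have L: "1 \<le> real ?L" using levels_bounds(1)[OF \<epsilon>] by simp
  have "\<exists>j<?L. level_gap \<epsilon> (Suc j) \<le> gap (Suc j)"
  proof (rule ccontr)
    assume "\<not> ?thesis"
    then have small: "gap (Suc j) \<le> level_gap \<epsilon> (Suc j)" if "j < ?L" for j using that by force
    have "\<exists>\<tau>\<in>couplings \<mu> \<nu>. E \<tau> (\<lambda>(x, y). ndist p n d x y) \<le> 1 / 2 ^ ?L + (\<Sum>j<?L. 1 / 2 ^ j *
        (\<Sum>c\<in>dyadic n d (Suc j) ` grid n d. \<bar>pmf (map_pmf (dyadic n d (Suc j)) \<mu>) c - pmf (map_pmf (dyadic n d (Suc j)) \<nu>) c\<bar>))"
    proof (rule hierarchical_coupling[OF finite_grid \<mu> \<nu>])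
      show "dyadic n d j x = dyadic n d j y" if "dyadic n d (Suc j) x = dyadic n d (Suc j) y" for j x y
        using that by (rule dyadic_nested)
      show "dyadic n d 0 x = dyadic n d 0 y" if "x \<in> grid n d" "y \<in> grid n d" for x y
        using that by (rule dyadic_0)
      show "ndist p n d x y \<le> 1 / 2 ^ j"
        if "x \<in> grid n d" "y \<in> grid n d" "dyadic n d j x = dyadic n d j y" for j x y
        using ndist_dyadic[OF p d n that] .
    qed simp
    then obtain \<tau> where \<tau>: "\<tau> \<in> couplings \<mu> \<nu>"
      "E \<tau> (\<lambda>(x, y). ndist p n d x y) \<le> 1 / 2 ^ ?L + (\<Sum>j<?L. 1 / 2 ^ j * gap (Suc j))"
      unfolding gap_def J_def by blast
    have "(\<Sum>j<?L. 1 / 2 ^ j * gap (Suc j)) \<le> (\<Sum>j<?L. \<epsilon> / (2 * real ?L))"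
    proof (rule sum_mono)
      fix j assume "j \<in> {..<?L}"
      then have "1 / 2 ^ j * gap (Suc j) \<le> 1 / 2 ^ j * level_gap \<epsilon> (Suc j)"
        using small by (intro mult_left_mono) auto
      also have "\<dots> = \<epsilon> / (2 * real ?L)" by (simp add: level_gap_def)
      finally show "1 / 2 ^ j * gap (Suc j) \<le> \<epsilon> / (2 * real ?L)" .
    qed
    also have "\<dots> = \<epsilon> / 2" using L by simp
    finally have "(\<Sum>j<?L. 1 / 2 ^ j * gap (Suc j)) \<le> \<epsilon> / 2" .
    moreover have "1 / 2 ^ ?L \<le> \<epsilon> / 4"
      using levels_bounds(2)[OF \<epsilon>] \<epsilon> by (simp add: divide_simps mult_ac)
    ultimately show False using far[OF \<tau>(1)] \<tau>(2) by linarith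
  qed
  then obtain j where j: "j \<in> {1..?L}" "level_gap \<epsilon> j \<le> gap j"
    using Suc_leI by (metis atLeastAtMost_iff le_add1 plus_1_eq_Suc)
  let ?R = "\<lambda>xs ys. \<not> far_test (J j) (map_pmf (dyadic n d j) \<nu>) (level_gap \<epsilon> j) xs ys"
  have "measure_pmf.prob ?D {(xs, ys). \<not> emd_reject n d \<epsilon> \<nu> xs ys} \<le>
      measure_pmf.prob ?D {(xs, ys). ?R (map (dyadic n d j) xs) (map (dyadic n d j) ys)}"
    using j(1) by (intro measure_pmf.finite_measure_mono) (auto simp: emd_reject_def J_def)
  also have "\<dots> \<le> 1 / 6"
    unfolding prob_map_replicate_pair[of ?m \<mu> ?R "dyadic n d j"]
  proof (rule far_test_far)
    show "2000 * real ?L * sqrt (real (card (J j))) / (level_gap \<epsilon> j)\<^sup>2 \<le> real ?m"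
      unfolding J_def using batch_sufficient[OF \<epsilon> n] j by simp
  qed (use L j(2) card_dyadic[OF n] \<mu> \<nu> level_gap_pos[OF \<epsilon>] in \<open>auto simp: J_def gap_def\<close>)
  finally show ?thesis .
qed

section \<open>The tester\<close>

text \<open>The algorithm type has no sequencing operator; procedures take a continuation, and
  repetition nests them.\<close>

primrec gather :: "nat \<Rightarrow> (('b \<Rightarrow> 'a algo) \<Rightarrow> 'a algo) \<Rightarrow> ('b list \<Rightarrow> 'a algo) \<Rightarrow> 'a algo" where
  "gather 0 g k = k []"
| "gather (Suc n) g k = g (\<lambda>b. gather n g (\<lambda>bs. k (b # bs)))"

lemma run_gather:
  assumes "\<And>k. run_algo cl \<mu> (g k) = bind_pmf P (\<lambda>b. run_algo cl \<mu> (k b))"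
  shows "run_algo cl \<mu> (gather n g k) = bind_pmf (replicate_pmf n P) (\<lambda>bs. run_algo cl \<mu> (k bs))"
proof (induction n arbitrary: k)
  case 0
  show ?case by (simp add: bind_return_pmf)
next
  case (Suc n)
  have "run_algo cl \<mu> (gather (Suc n) g k) =
      bind_pmf P (\<lambda>b. bind_pmf (replicate_pmf n P) (\<lambda>bs. run_algo cl \<mu> (k (b # bs))))"
    unfolding gather.simps assms[of "\<lambda>b. gather n g (\<lambda>bs. k (b # bs))"] Suc.IH ..
  then show ?case by (simp add: bind_return_pmf bind_assoc_pmf)
qed

text \<open>The assumption on \<open>g\<close> is uniform in continuation and budget, since each
  nested call leaves a different remaining budget.\<close>

lemma uses_gather:
  assumes "\<And>k m q. (\<And>b. uses_at_most X m q (k b)) \<Longrightarrow> uses_at_most X (Suc m) (q + c) (g k)"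
    and "\<And>bs. uses_at_most X m q (k bs)"
  shows "uses_at_most X (n + m) (n * c + q) (gather n g k)"
  using assms(2)
proof (induction n arbitrary: k)
  case (Suc n)
  have "uses_at_most X (n + m) (n * c + q) (gather n g (\<lambda>bs. k (b # bs)))" for b
    by (rule Suc.IH) (rule Suc.prems)
  then have "uses_at_most X (Suc (n + m)) (n * c + q + c) (gather (Suc n) g k)"
    unfolding gather.simps by (rule assms(1))
  then show ?case by (simp only: add_Suc add_Suc_right mult_Suc add.commute add.left_commute)
qed simp

definition draw_cell :: "nat \<Rightarrow> nat \<Rightarrow> (point set \<Rightarrow> point algo) \<Rightarrow> point algo" where
  "draw_cell n d k = Sample (\<lambda>r. locate n d r k)"

text \<open>If \<open>\<nu>\<close> gives the cell no mass, any point of the cell will do: this cannot happen for \<open>\<mu> = \<nu>\<close>.\<close>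

definition resample :: "'a pmf \<Rightarrow> 'a set \<Rightarrow> 'a pmf" where
  "resample \<nu> C = (if set_pmf \<nu> \<inter> C \<noteq> {} then cond_pmf \<nu> C else return_pmf (SOME x. x \<in> C))"

text \<open>Internal randomness consists of naturals, so points of the grid are drawn through an
  enumeration and decoded afterwards.\<close>

definition draw_point :: "nat \<Rightarrow> nat \<Rightarrow> point pmf \<Rightarrow> (point \<Rightarrow> point algo) \<Rightarrow> point algo" where
  "draw_point n d \<nu> k = draw_cell n d (\<lambda>C.
     Random (map_pmf (to_nat_on (grid n d)) (resample \<nu> C)) (\<lambda>i. k (from_nat_into (grid n d) i)))"

definition resampled :: "'a clustering \<Rightarrow> 'a pmf \<Rightarrow> 'a pmf \<Rightarrow> 'a pmf" where
  "resampled cl \<nu> \<mu> = bind_pmf \<mu> (\<lambda>x. resample \<nu> (cell_of cl x))"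

lemma run_draw_cell:
  assumes d: "0 < d" and cl: "cl \<in> CC n d" and \<mu>: "set_pmf \<mu> \<subseteq> grid n d"
  shows "run_algo cl \<mu> (draw_cell n d k) = bind_pmf (map_pmf (cell_of cl) \<mu>) (\<lambda>C. run_algo cl \<mu> (k C))"
proof -
  have c: "is_clustering (grid n d) cl" using cl by (simp add: CC_def)
  have "run_algo cl \<mu> (locate n d (label cl x) k) = run_algo cl \<mu> (k (cell_of cl x))" if "x \<in> set_pmf \<mu>" for x
    using run_locate[OF d cl cell_of_in(1)[OF c]] that \<mu> unfolding label_def by blast
  then show ?thesis unfolding draw_cell_def by (simp add: bind_map_pmf cong: bind_pmf_cong)
qed

lemma set_resample:
  assumes "C \<noteq> {}"
  shows "set_pmf (resample \<nu> C) \<subseteq> C"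
  using assms some_in_eq[of C] by (auto simp: resample_def)

lemma finite_resample:
  assumes "finite C" "C \<noteq> {}"
  shows "finite (set_pmf (resample \<nu> C))"
  using set_resample[OF assms(2)] assms(1) finite_subset by blast

lemma run_draw_point:
  assumes d: "0 < d" and cl: "cl \<in> CC n d" and \<mu>: "set_pmf \<mu> \<subseteq> grid n d"
  shows "run_algo cl \<mu> (draw_point n d \<nu> k) = bind_pmf (resampled cl \<nu> \<mu>) (\<lambda>x. run_algo cl \<mu> (k x))"
proof -
  have c: "is_clustering (grid n d) cl" using cl by (simp add: CC_def)
  have "bind_pmf (resample \<nu> (cell_of cl x)) (\<lambda>y. run_algo cl \<mu> (k (from_nat_into (grid n d) (to_nat_on (grid n d) y)))) =
      bind_pmf (resample \<nu> (cell_of cl x)) (\<lambda>y. run_algo cl \<mu> (k y))" if "x \<in> set_pmf \<mu>" for x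
  proof (rule bind_pmf_cong[OF refl])
    fix y assume y: "y \<in> set_pmf (resample \<nu> (cell_of cl x))"
    have "x \<in> grid n d" using that \<mu> by blast
    then have "y \<in> grid n d" using y set_resample[of "cell_of cl x" \<nu>] cell_of_in[OF c, of x] by blast
    then show "run_algo cl \<mu> (k (from_nat_into (grid n d) (to_nat_on (grid n d) y))) = run_algo cl \<mu> (k y)"
      using countable_finite[OF finite_grid] by simp
  qed
  then show ?thesis
    unfolding draw_point_def run_draw_cell[OF d cl \<mu>] resampled_def
    by (simp add: bind_map_pmf bind_assoc_pmf cong: bind_pmf_cong)
qed

lemma uses_draw_cell:
  assumes "0 < d" "\<And>C. uses_at_most (grid n d) m q (k C)"
  shows "uses_at_most (grid n d) (Suc m) (q + locate_cost n d) (draw_cell n d k)"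
  unfolding draw_cell_def using assms by (intro uses_at_most.intros(2) uses_locate)

lemma uses_draw_point:
  assumes "0 < d" "\<And>x. uses_at_most (grid n d) m q (k x)"
  shows "uses_at_most (grid n d) (Suc m) (q + locate_cost n d) (draw_point n d \<nu> k)"
  unfolding draw_point_def using assms by (intro uses_draw_cell uses_at_most.intros(4))

section \<open>The effect of replacing samples inside their cells\<close>

lemma set_resampled:
  assumes "is_clustering X cl" "set_pmf \<mu> \<subseteq> X"
  shows "set_pmf (resampled cl \<nu> \<mu>) \<subseteq> X"
proof
  fix y assume "y \<in> set_pmf (resampled cl \<nu> \<mu>)"
  then obtain x where x: "x \<in> set_pmf \<mu>" "y \<in> set_pmf (resample \<nu> (cell_of cl x))"
    by (auto simp: resampled_def)
  then have "x \<in> X" using assms(2) by blast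
  then show "y \<in> X" using x set_resample[of "cell_of cl x" \<nu>] cell_of_in[OF assms(1), of x] by blast
qed

text \<open>The law of total probability over the cells. In the cancellation rule the relation is
  membership in a common cell, whose slices in either argument are the same cell and hence have the
  same mass.\<close>

lemma resampled_self:
  assumes cl: "is_clustering X cl" and \<nu>: "set_pmf \<nu> \<subseteq> X"
  shows "resampled cl \<nu> \<nu> = \<nu>"
proof -
  let ?R = "\<lambda>x y. x \<in> X \<and> y \<in> cell_of cl x"
  have same: "cell_of cl y = cell_of cl x" if "x \<in> X" "y \<in> cell_of cl x" for x y
    using cell_of_eq[OF cl cell_of_in(1)[OF cl that(1)] that(2)] .
  have sub: "y \<in> X" if "x \<in> X" "y \<in> cell_of cl x" for x y
    using cell_of_in(3)[OF cl that(1)] that(2) by blast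
  have cond: "resample \<nu> (cell_of cl x) = cond_pmf \<nu> {y. ?R x y}" if "x \<in> set_pmf \<nu>" for x
  proof -
    have "x \<in> X" using that \<nu> by blast
    then show ?thesis using cell_of_in(2)[OF cl, of x] that by (auto simp: resample_def)
  qed
  have "resampled cl \<nu> \<nu> = bind_pmf \<nu> (\<lambda>x. cond_pmf \<nu> {y. ?R x y})"
    unfolding resampled_def using cond by (intro bind_pmf_cong) auto
  also have "\<dots> = \<nu>"
  proof (rule bind_cond_pmf_cancel)
    show "set_pmf \<nu> \<inter> {y. ?R x y} \<noteq> {}" "set_pmf \<nu> \<inter> {y. ?R y x} \<noteq> {}" if "x \<in> set_pmf \<nu>" for x
      using that \<nu> cell_of_in(2)[OF cl, of x] by blast+
    fix x y assume R: "?R x y"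
    have "{x'. ?R x' y} = cell_of cl x"
    proof (intro set_eqI iffI)
      fix x' assume "x' \<in> {x'. ?R x' y}"
      then have "cell_of cl x' = cell_of cl x" using same R by (metis mem_Collect_eq)
      then show "x' \<in> cell_of cl x" using cell_of_in(2)[OF cl, of x'] \<open>x' \<in> _\<close> by simp
    next
      fix x' assume x': "x' \<in> cell_of cl x"
      have "x' \<in> X" "cell_of cl x' = cell_of cl x"
        using sub[OF conjunct1[OF R] x'] same[OF conjunct1[OF R] x'] .
      then show "x' \<in> {x'. ?R x' y}" using R by simp
    qed
    moreover have "{y. ?R x y} = cell_of cl x" using R by simp
    ultimately show "measure \<nu> {y. ?R x y} = measure \<nu> {x. ?R x y}" by simp
  qed
  finally show ?thesis .
qed

lemma diam_upper:
  assumes "finite C" "x \<in> C" "y \<in> C"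
  shows "\<delta> x y \<le> diam \<delta> C"
  unfolding diam_def
  using assms by (intro cSUP_upper2[of "\<lambda>(x, y). \<delta> x y" _ "(x, y)"] bdd_above_finite finite_imageI) auto

text \<open>The coupling pairs each point with its own replacement. They share a cell, so their
  distance is at most \<open>\<Delta>\<close> unless the cell is wide, and at most 1 in any
  case.\<close>

lemma resampled_close:
  assumes cl: "is_clustering X cl" and X: "finite X" and \<mu>: "set_pmf \<mu> \<subseteq> X" and \<Delta>: "0 \<le> \<Delta>"
    and \<delta>: "\<And>x y. x \<in> X \<Longrightarrow> y \<in> X \<Longrightarrow> \<delta> x y \<le> 1"
  shows "\<exists>\<pi>\<in>couplings \<mu> (resampled cl \<nu> \<mu>). E \<pi> (\<lambda>(x, y). \<delta> x y)
    \<le> \<Delta> + measure_pmf.prob \<mu> {x. diam \<delta> (cell_of cl x) > \<Delta>}"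
proof -
  let ?bad = "{x. diam \<delta> (cell_of cl x) > \<Delta>}"
  let ?\<pi> = "bind_pmf \<mu> (\<lambda>x. map_pmf (Pair x) (resample \<nu> (cell_of cl x)))"
  have fin: "finite (set_pmf \<mu>)" using finite_subset[OF \<mu> X] .
  have cell: "finite (cell_of cl x)" "x \<in> cell_of cl x" "cell_of cl x \<subseteq> X" if "x \<in> set_pmf \<mu>" for x
    using cell_of_in[OF cl, of x] that \<mu> finite_subset[OF _ X] by blast+
  have finC: "finite (set_pmf (resample \<nu> (cell_of cl x)))" if "x \<in> set_pmf \<mu>" for x
    using finite_resample cell[OF that] by blast
  have "?\<pi> \<in> couplings \<mu> (resampled cl \<nu> \<mu>)"
    by (simp add: couplings_def resampled_def map_bind_pmf map_pmf_comp bind_return_pmf' map_pmf_const)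
  moreover have "E ?\<pi> (\<lambda>(x, y). \<delta> x y) = E \<mu> (\<lambda>x. E (resample \<nu> (cell_of cl x)) (\<lambda>y. \<delta> x y))"
    using finC by (subst E_bind[OF fin]) auto
  moreover have "\<dots> \<le> E \<mu> (\<lambda>x. \<Delta> + indicator ?bad x)"
  proof (rule E_mono[OF fin])
    fix x assume x: "x \<in> set_pmf \<mu>"
    have "E (resample \<nu> (cell_of cl x)) (\<lambda>y. \<delta> x y) \<le> E (resample \<nu> (cell_of cl x)) (\<lambda>y. \<Delta> + indicator ?bad x)"
    proof (rule E_mono[OF finC[OF x]])
      fix y assume "y \<in> set_pmf (resample \<nu> (cell_of cl x))"
      then have y: "y \<in> cell_of cl x" using set_resample[of "cell_of cl x" \<nu>] cell[OF x] by blast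
      show "\<delta> x y \<le> \<Delta> + indicator ?bad x"
      proof (cases "x \<in> ?bad")
        case True
        have "\<delta> x y \<le> 1" using \<delta> cell[OF x] y by blast
        then show ?thesis using True \<Delta> by simp
      next
        case False
        then show ?thesis using diam_upper[OF cell(1)[OF x] cell(2)[OF x] y, of \<delta>] by simp
      qed
    qed
    then show "E (resample \<nu> (cell_of cl x)) (\<lambda>y. \<delta> x y) \<le> \<Delta> + indicator ?bad x" by simp
  qed
  moreover have "\<dots> = \<Delta> + measure_pmf.prob \<mu> ?bad" by (simp add: E_add[OF fin])
  ultimately show ?thesis by (intro bexI[of _ ?\<pi>]) auto
qed

section \<open>The guard and the complete tester\<close>

lemma prob_bind:
  assumes "finite (set_pmf p)" "\<And>x. x \<in> set_pmf p \<Longrightarrow> finite (set_pmf (F x))"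
  shows "measure_pmf.prob (bind_pmf p F) A = E p (\<lambda>x. measure_pmf.prob (F x) A)"
  using E_bind[OF assms, where g = "indicator A"] by simp

lemma prob_replicate_avoid:
  assumes fin: "finite (set_pmf p)"
  shows "measure_pmf.prob (replicate_pmf t p) {xs. set xs \<inter> S = {}} = (1 - measure_pmf.prob p S) ^ t"
proof (induction t)
  case (Suc t)
  have "measure_pmf.prob (replicate_pmf (Suc t) p) {xs. set xs \<inter> S = {}} =
    E p (\<lambda>x. measure_pmf.prob (map_pmf ((#) x) (replicate_pmf t p)) {xs. set xs \<inter> S = {}})"
    using finite_replicate[OF fin] by (simp add: map_pmf_def[symmetric] prob_bind[OF fin])
  also have "\<dots> = E p (\<lambda>x. indicator (- S) x * (1 - measure_pmf.prob p S) ^ t)"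
  proof (intro Bochner_Integration.integral_cong refl)
    fix x
    have "(#) x -` {xs. set xs \<inter> S = {}} = (if x \<in> S then {} else {xs. set xs \<inter> S = {}})" by auto
    then show "measure_pmf.prob (map_pmf ((#) x) (replicate_pmf t p)) {xs. set xs \<inter> S = {}} =
        indicator (- S) x * (1 - measure_pmf.prob p S) ^ t"
      using Suc by (simp add: indicator_def)
  qed
  also have "\<dots> = (1 - measure_pmf.prob p S) * (1 - measure_pmf.prob p S) ^ t"
    using measure_pmf.prob_compl[of S p] by (simp add: Compl_eq_Diff_UNIV)
  finally show ?case by simp
qed simp

text \<open>Rounded down because the guard condition has no slack:
  \<open>64 * ln 24 / \<epsilon>\<close> times \<open>guard_const * \<epsilon>\<close> is exactly
  1/6.\<close>

definition rounds :: "real \<Rightarrow> nat" where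
  "rounds \<epsilon> = nat \<lfloor>64 * ln 24 / \<epsilon>\<rfloor>"

definition tester :: "nat \<Rightarrow> nat \<Rightarrow> real \<Rightarrow> real \<Rightarrow> real \<Rightarrow> point pmf \<Rightarrow> point algo" where
  "tester n d p \<epsilon> \<Delta> \<nu> =
    gather (rounds \<epsilon>) (draw_cell n d) (\<lambda>Cs.
      if \<exists>C\<in>set Cs. diam (ndist p n d) C > \<Delta> then Output Cluster_Reject
      else gather (batch d \<epsilon>) (draw_point n d \<nu>) (\<lambda>xs. gather (batch d \<epsilon>) (draw_point n d \<nu>) (\<lambda>ys.
        Output (if emd_reject n d \<epsilon> \<nu> xs ys then Reject else Accept))))"

definition num_samples :: "nat \<Rightarrow> real \<Rightarrow> nat" where
  "num_samples d \<epsilon> = (if \<epsilon> < 1 then rounds \<epsilon> + 2 * batch d \<epsilon> else 0)"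

lemma uses_tester:
  assumes d: "0 < d" and "\<epsilon> < 1"
  shows "uses_at_most (grid n d) (num_samples d \<epsilon>) (num_samples d \<epsilon> * locate_cost n d) (tester n d p \<epsilon> \<Delta> \<nu>)"
proof -
  let ?m = "batch d \<epsilon>" and ?c = "locate_cost n d"
  let ?k = "\<lambda>xs ys. Output (if emd_reject n d \<epsilon> \<nu> xs ys then Reject else Accept) :: point algo"
  have "uses_at_most (grid n d) (?m + (?m + 0)) (?m * ?c + (?m * ?c + 0))
      (gather ?m (draw_point n d \<nu>) (\<lambda>xs. gather ?m (draw_point n d \<nu>) (?k xs)))"
    by (intro uses_gather uses_draw_point[OF d] uses_at_most.intros(1))
  then have "uses_at_most (grid n d) (2 * ?m) (2 * ?m * ?c)
      (gather ?m (draw_point n d \<nu>) (\<lambda>xs. gather ?m (draw_point n d \<nu>) (?k xs)))"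
    by (simp add: mult_2 distrib_right)
  then have "uses_at_most (grid n d) (rounds \<epsilon> + 2 * ?m) (rounds \<epsilon> * ?c + 2 * ?m * ?c) (tester n d p \<epsilon> \<Delta> \<nu>)"
    unfolding tester_def
    by (intro uses_gather uses_draw_cell[OF d]) (auto intro: uses_at_most.intros(1))
  then show ?thesis using assms(2) by (simp add: num_samples_def algebra_simps)
qed

lemma ln_24_ge_1: "1 \<le> ln (24::real)"
proof -
  have "exp 1 \<le> (24::real)" using exp_le by linarith
  then show ?thesis by (simp add: ln_ge_iff)
qed

lemma tester_correct:
  assumes n: "1 \<le> n" and d: "1 \<le> d" and p: "1 \<le> p" and \<Delta>: "8 * \<Delta> \<le> \<epsilon>" "0 < \<Delta>" and \<epsilon>: "\<epsilon> < 1"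
    and \<nu>: "set_pmf \<nu> \<subseteq> grid n d"
  shows "diameter_guarded_tester (grid n d) (ndist p n d) (CC n d) (CC n d) \<Delta> \<epsilon> \<nu> (tester n d p \<epsilon> \<Delta> \<nu>)"
  unfolding diameter_guarded_tester_def
proof (intro ballI allI impI)
  fix cl \<mu>
  assume cl: "cl \<in> CC n d" and \<mu>: "set_pmf \<mu> \<subseteq> grid n d"
  let ?\<delta> = "ndist p n d" and ?t = "rounds \<epsilon>" and ?m = "batch d \<epsilon>" and ?\<mu>' = "resampled cl \<nu> \<mu>"
  have d0: "0 < d" and \<epsilon>0: "0 < \<epsilon>" using d \<Delta> by auto
  have c: "is_clustering (grid n d) cl" using cl by (simp add: CC_def)
  have \<mu>': "set_pmf ?\<mu>' \<subseteq> grid n d" by (rule set_resampled[OF c \<mu>])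
  have fin: "finite (set_pmf \<mu>)" "finite (set_pmf ?\<mu>')" using \<mu> \<mu>' finite_subset finite_grid by blast+
  define bad where "bad = {C. diam ?\<delta> C > \<Delta>}"
  define \<beta> where "\<beta> = measure_pmf.prob \<mu> {x. diam ?\<delta> (cell_of cl x) > \<Delta>}"
  define Z where "Z = replicate_pmf ?t (map_pmf (cell_of cl) \<mu>)"
  define D where "D = pair_pmf (replicate_pmf ?m ?\<mu>') (replicate_pmf ?m ?\<mu>')"
  define R where "R = map_pmf (\<lambda>(xs, ys). if emd_reject n d \<epsilon> \<nu> xs ys then Reject else Accept) D"
  define F where "F Cs = (if set Cs \<inter> bad = {} then R else return_pmf Cluster_Reject)" for Cs
  define \<rho> where "\<rho> = run_algo cl \<mu> (tester n d p \<epsilon> \<Delta> \<nu>)"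
  have \<rho>: "\<rho> = bind_pmf Z F"
  proof -
    have "run_algo cl \<mu> (if \<exists>C\<in>set Cs. diam ?\<delta> C > \<Delta> then Output Cluster_Reject
      else gather ?m (draw_point n d \<nu>) (\<lambda>xs. gather ?m (draw_point n d \<nu>) (\<lambda>ys.
        Output (if emd_reject n d \<epsilon> \<nu> xs ys then Reject else Accept)))) = F Cs" for Cs
      by (auto simp: F_def bad_def R_def D_def run_gather[OF run_draw_point[OF d0 cl \<mu>]]
          pair_pmf_def map_bind_pmf map_return_pmf)
    then show ?thesis
      unfolding \<rho>_def tester_def Z_def by (simp only: run_gather[OF run_draw_cell[OF d0 cl \<mu>]])
  qed
  have finD: "finite (set_pmf D)" unfolding D_def by (rule finite_pair_replicate[OF fin(2)])
  have finZ: "finite (set_pmf Z)" unfolding Z_def using fin(1) by (intro finite_replicate) simp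
  have finF: "finite (set_pmf (F Cs))" for Cs using finD by (simp add: F_def R_def)
  have prob: "measure_pmf.prob \<rho> A = E Z (\<lambda>Cs. measure_pmf.prob (F Cs) A)" for A
    unfolding \<rho> by (rule prob_bind[OF finZ finF])
  have R: "measure_pmf.prob R {Reject} = measure_pmf.prob D {(xs, ys). emd_reject n d \<epsilon> \<nu> xs ys}"
    "measure_pmf.prob R {Accept} = measure_pmf.prob D {(xs, ys). \<not> emd_reject n d \<epsilon> \<nu> xs ys}"
    "measure_pmf.prob R {Cluster_Reject} = 0"
  proof -
    let ?v = "\<lambda>(xs, ys). if emd_reject n d \<epsilon> \<nu> xs ys then Reject else Accept"
    have "?v -` {Reject} = {(xs, ys). emd_reject n d \<epsilon> \<nu> xs ys}"
      "?v -` {Accept} = {(xs, ys). \<not> emd_reject n d \<epsilon> \<nu> xs ys}" "?v -` {Cluster_Reject} = {}"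
      by (auto split: if_splits)
    then show "measure_pmf.prob R {Reject} = measure_pmf.prob D {(xs, ys). emd_reject n d \<epsilon> \<nu> xs ys}"
      "measure_pmf.prob R {Accept} = measure_pmf.prob D {(xs, ys). \<not> emd_reject n d \<epsilon> \<nu> xs ys}"
      "measure_pmf.prob R {Cluster_Reject} = 0"
      unfolding R_def by simp_all
  qed
  have avoid: "measure_pmf.prob Z {Cs. set Cs \<inter> bad = {}} = (1 - \<beta>) ^ ?t"
    unfolding Z_def using fin(1) by (subst prob_replicate_avoid) (auto simp: \<beta>_def bad_def vimage_def)
  have \<beta>: "0 \<le> \<beta>" "\<beta> \<le> 1" by (auto simp: \<beta>_def)
  have t: "real ?t \<le> 64 * ln 24 / \<epsilon>" "64 * ln 24 / \<epsilon> - 1 \<le> real ?t"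
    using \<epsilon>0 ln_24_ge_1 unfolding rounds_def by (auto intro!: of_nat_floor)
  have E_le: "E Z f \<le> c" if "\<And>Cs. f Cs \<le> c" for f c
    using E_mono[OF finZ, of f "\<lambda>_. c"] that by simp
  have compl: "measure_pmf.prob \<rho> (- S) = 1 - measure_pmf.prob \<rho> S" for S
    using measure_pmf.prob_compl[of S \<rho>] by (simp add: Compl_eq_Diff_UNIV)
  have verdicts: "{Accept, Cluster_Reject} = - {Reject}" "{Reject, Cluster_Reject} = - {Accept}"
    by (auto intro: verdict.exhaust)
  have guard: "measure_pmf.prob \<rho> {Cluster_Reject} \<le> 1 / 6" if "\<beta> \<le> guard_const * \<epsilon>"
  proof -
    have "measure_pmf.prob \<rho> {Cluster_Reject} = E Z (\<lambda>Cs. indicator (- {Cs. set Cs \<inter> bad = {}}) Cs)"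
      unfolding prob F_def by (intro Bochner_Integration.integral_cong refl) (auto simp: R)
    also have "\<dots> = 1 - (1 - \<beta>) ^ ?t"
      using measure_pmf.prob_compl[of "{Cs. set Cs \<inter> bad = {}}" Z] avoid by (simp add: Compl_eq_Diff_UNIV)
    also have "\<dots> \<le> real ?t * \<beta>" using Bernoulli_inequality[of "- \<beta>" ?t] \<beta> by simp
    also have "\<dots> \<le> (64 * ln 24 / \<epsilon>) * (guard_const * \<epsilon>)"
      using t(1) that \<beta> \<epsilon>0 ln_24_ge_1 by (intro mult_mono) auto
    also have "\<dots> = 1 / 6" using \<epsilon>0 ln_24_ge_1 by (simp add: guard_const_def)
    finally show ?thesis .
  qed
  have null: "measure_pmf.prob \<rho> {Accept, Cluster_Reject} \<ge> 5 / 6" if "\<mu> = \<nu>"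
  proof -
    have "?\<mu>' = \<nu>" using resampled_self[OF c \<nu>] that by simp
    then have "measure_pmf.prob R {Reject} \<le> 1 / 6"
      unfolding R D_def using emd_reject_null[OF \<epsilon>0 \<epsilon> n \<nu>] by simp
    then have "measure_pmf.prob \<rho> {Reject} \<le> 1 / 6"
      unfolding prob F_def by (intro E_le) auto
    then show ?thesis unfolding verdicts compl by simp
  qed
  have far: "measure_pmf.prob \<rho> {Reject, Cluster_Reject} \<ge> 5 / 6" if "EMD ?\<delta> \<mu> \<nu> > \<epsilon>"
  proof -
    have "measure_pmf.prob \<rho> {Accept} \<le> 1 / 6"
    \<comment> \<open>If wide cells are rare, replacement keeps \<open>\<mu>\<close> far from
      \<open>\<nu>\<close> and the statistic detects it. Otherwise, missing all wide cells in the
      first rounds is unlikely, and this is the only way to accept.\<close>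
    proof (cases "\<beta> \<le> \<epsilon> / 8")
      case True
      obtain \<pi> where \<pi>: "\<pi> \<in> couplings \<mu> ?\<mu>'" "E \<pi> (\<lambda>(x, y). ?\<delta> x y) \<le> \<Delta> + \<beta>"
        using resampled_close[OF c finite_grid \<mu>, of \<Delta> ?\<delta> \<nu>] ndist_le_1[OF p d] \<Delta> unfolding \<beta>_def by auto
      have "measure_pmf.prob R {Accept} \<le> 1 / 6"
        unfolding R D_def
      proof (rule emd_reject_far[OF \<epsilon>0 \<epsilon> n d p \<nu> \<mu>'])
        fix \<tau> assume "\<tau> \<in> couplings ?\<mu>' \<nu>"
        \<comment> \<open>Of the distance \<open>\<epsilon>\<close>, the replacement can remove at
          most \<open>\<Delta> + \<beta> \<le> \<epsilon> / 8 + \<epsilon> / 8\<close>.\<close>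
        from EMD_glue[OF finite_grid \<mu> \<mu>' \<nu> \<pi>(1) this, of ?\<delta>]
        show "E \<tau> (\<lambda>(x, y). ?\<delta> x y) > 3 * \<epsilon> / 4"
          using ndist_nonneg ndist_triangle[OF p] that \<pi>(2) True \<Delta> by force
      qed
      then show ?thesis unfolding prob F_def by (intro E_le) auto
    next
      case False
      have "measure_pmf.prob \<rho> {Accept} \<le> E Z (\<lambda>Cs. indicator {Cs. set Cs \<inter> bad = {}} Cs)"
        unfolding prob F_def by (intro E_mono[OF finZ]) auto
      also have "\<dots> = (1 - \<beta>) ^ ?t" using avoid by simp
      also have "\<dots> \<le> exp (- \<epsilon> / 8) ^ ?t"
      proof (rule power_mono)
        show "1 - \<beta> \<le> exp (- \<epsilon> / 8)" using exp_ge_add_one_self[of "- \<epsilon> / 8"] False by simp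
      qed (use \<beta> in simp)
      also have "\<dots> = exp (- (real ?t * \<epsilon> / 8))" by (simp add: exp_of_nat_mult[symmetric])
      \<comment> \<open>Since \<open>ln 24 \<ge> 1\<close> and rounding down loses less than
        \<open>\<epsilon> < 1\<close>, the exponent is at least 63/8.\<close>
      also have "\<dots> \<le> exp (- 7)"
      proof -
        have "64 * ln 24 - \<epsilon> \<le> real ?t * \<epsilon>"
          using mult_right_mono[OF t(2), of \<epsilon>] \<epsilon>0 by (simp add: algebra_simps)
        then show ?thesis using ln_24_ge_1 \<epsilon> by simp
      qed
      also have "\<dots> \<le> 1 / 6"
      proof -
        have "(6::real) \<le> exp 7" using exp_ge_add_one_self[of 7] by linarith
        then show ?thesis by (simp add: exp_minus divide_simps)
      qed
      finally show ?thesis .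
    qed
    then show ?thesis unfolding verdicts compl by simp
  qed
  show "(cl \<in> CC n d \<and> measure_pmf.prob \<mu> {x. diam ?\<delta> (cell_of cl x) > \<Delta>} \<le> guard_const * \<epsilon> \<longrightarrow>
        measure_pmf.prob (run_algo cl \<mu> (tester n d p \<epsilon> \<Delta> \<nu>)) {Cluster_Reject} \<le> 1 / 6) \<and>
      (\<mu> = \<nu> \<longrightarrow> measure_pmf.prob (run_algo cl \<mu> (tester n d p \<epsilon> \<Delta> \<nu>)) {Accept, Cluster_Reject} \<ge> 5 / 6) \<and>
      (EMD ?\<delta> \<mu> \<nu> > \<epsilon> \<longrightarrow> measure_pmf.prob (run_algo cl \<mu> (tester n d p \<epsilon> \<Delta> \<nu>)) {Reject, Cluster_Reject} \<ge> 5 / 6)"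
    using guard null far unfolding \<beta>_def \<rho>_def by blast
qed

text \<open>The product coupling costs at most 1, so the third condition is vacuous for
  \<open>\<epsilon> \<ge> 1\<close>, and constant acceptance satisfies the other two.\<close>

lemma accept_correct:
  assumes d: "1 \<le> d" and p: "1 \<le> p" and \<epsilon>: "1 \<le> \<epsilon>" and \<nu>: "set_pmf \<nu> \<subseteq> grid n d"
  shows "diameter_guarded_tester (grid n d) (ndist p n d) \<U> \<G> \<Delta> \<epsilon> \<nu> (Output Accept)"
proof -
  have "EMD (ndist p n d) \<mu> \<nu> \<le> 1" if \<mu>: "set_pmf \<mu> \<subseteq> grid n d" for \<mu>
  proof -
    have c: "pair_pmf \<mu> \<nu> \<in> couplings \<mu> \<nu>"
      by (simp add: couplings_def map_fst_pair_pmf map_snd_pair_pmf)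
    have "finite (set_pmf (pair_pmf \<mu> \<nu>))"
      using \<mu> \<nu> finite_subset[OF _ finite_grid] by auto
    then have "E (pair_pmf \<mu> \<nu>) (\<lambda>(x, y). ndist p n d x y) \<le> E (pair_pmf \<mu> \<nu>) (\<lambda>_. 1)"
      by (rule E_mono) (auto intro!: ndist_le_1[OF p d] dest: subsetD[OF \<mu>] subsetD[OF \<nu>])
    then show ?thesis using EMD_le_coupling[where \<delta> = "ndist p n d", OF ndist_nonneg c] by simp
  qed
  then show ?thesis using \<epsilon> unfolding diameter_guarded_tester_def by force
qed

section \<open>Sample and query bounds\<close>

lemma sample_bound_num_samples: "sample_bound num_samples"
  unfolding sample_bound_def
\<comment> \<open>From \<open>levels \<epsilon> \<le> 5 * l\<close> each batch costs at most 32000 *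
  125 + 1 times \<open>W\<close>, the 1 being for rounding; two batches and at most 64 * 23 rounds
  stay below 8002000. The power 3 of the logarithm is that of \<open>levels\<close>, and
  \<open>8 ^ d\<close> gives the factor 3 in the exponent of 2.\<close>
proof (rule exI[of _ "3::real"], rule exI[of _ "8002000::real"], rule exI[of _ "3::nat"], intro allI impI)
  fix d :: nat and \<epsilon> :: real
  assume d: "1 \<le> d" and \<epsilon>0: "0 < \<epsilon>"
  define X where "X = \<epsilon> powr (- max 2 (real d / 2))"
  define l where "l = max 1 (ln (1 / \<epsilon>))"
  have p8: "2 powr (3 * real d) = 8 ^ d" by (simp add: powr_powr[symmetric] powr_realpow)
  have "real (num_samples d \<epsilon>) \<le> 8 ^ d * (8002000 * X * l ^ 3)"
  proof (cases "\<epsilon> < 1")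
    case True
    note \<epsilon> = \<epsilon>0 True
    have "\<epsilon> powr (- 1) \<le> X" unfolding X_def using \<epsilon> by (intro powr_mono') auto
    then have X: "1 / \<epsilon> \<le> X" using \<epsilon> by (simp add: powr_minus_divide)
    have "1 \<le> 1 / \<epsilon>" using \<epsilon> by (simp add: divide_simps)
    then have X1: "1 \<le> X" using X by linarith
    have l1: "1 \<le> l" "ln (1 / \<epsilon>) \<le> l" by (auto simp: l_def)
    have "1 * 1 \<le> l ^ 3 * (8::real) ^ d" using l1 by (intro mult_mono one_le_power) auto
    then have W: "1 \<le> l ^ 3 * 8 ^ d" by simp
    define W where "W = l ^ 3 * 8 ^ d * X"
    have "1 * X \<le> W" unfolding W_def using W X1 by (intro mult_right_mono) auto
    then have XW: "X \<le> W" by simp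
    define r where "r = ln (1 / \<epsilon>) / ln 2"
    have log4: "log 2 (4 / \<epsilon>) = 2 + r"
    proof -
      have "ln 4 = 2 * ln (2::real)" using ln_realpow[of 2 2] by simp
      then show ?thesis using \<epsilon> by (simp add: r_def log_def ln_div diff_divide_distrib)
    qed
    have "r \<le> l / (1 / 2)"
      unfolding r_def
    proof (rule frac_le)
      show "1 / 2 \<le> ln (2::real)" using ln2_ge_two_thirds by simp
    qed (use l1 in auto)
    then have "r \<le> 2 * l" by simp
    moreover have "real (levels \<epsilon>) \<le> 2 + r + 1" using levels_bounds(4)[OF \<epsilon>] unfolding log4 .
    ultimately have "real (levels \<epsilon>) \<le> 5 * l" using l1(1) by linarith
    then have "real (levels \<epsilon>) ^ 3 \<le> (5 * l) ^ 3" by (intro power_mono) auto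
    then have L3: "real (levels \<epsilon>) ^ 3 \<le> 125 * l ^ 3" by (simp add: power_mult_distrib)
    have "32000 * real (levels \<epsilon>) ^ 3 * 8 ^ d * X \<le> 32000 * (125 * l ^ 3) * 8 ^ d * X"
      using L3 X1 by (intro mult_right_mono mult_left_mono) auto
    also have "\<dots> = 4000000 * W" by (simp add: W_def)
    finally have M: "32000 * real (levels \<epsilon>) ^ 3 * 8 ^ d * X \<le> 4000000 * W" .
    have "0 \<le> 32000 * real (levels \<epsilon>) ^ 3 * 8 ^ d * X" using X1 by simp
    then have "real (batch d \<epsilon>) \<le> 32000 * real (levels \<epsilon>) ^ 3 * 8 ^ d * X + 1"
      unfolding batch_def X_def by linarith
    then have B: "real (batch d \<epsilon>) \<le> 4000001 * W" using M XW X1 by linarith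
    have "real (rounds \<epsilon>) \<le> 64 * ln 24 / \<epsilon>"
      using \<epsilon> ln_24_ge_1 unfolding rounds_def by (intro of_nat_floor) auto
    also have "\<dots> = 64 * ln 24 * (1 / \<epsilon>)" by simp
    also have "\<dots> \<le> 64 * 23 * X"
      using ln_le_minus_one[of 24] X \<epsilon> by (intro mult_mono) auto
    finally have "real (rounds \<epsilon>) \<le> 1472 * W" using XW by simp
    then have "real (num_samples d \<epsilon>) \<le> 8002000 * W" using B XW X1 True by (simp add: num_samples_def)
    then show ?thesis by (simp add: W_def mult_ac)
  next
    case False
    then show ?thesis by (simp add: num_samples_def X_def l_def)
  qed
  then show "real (num_samples d \<epsilon>) \<le> 2 powr (3 * real d) *
      (8002000 * \<epsilon> powr (- max 2 (real d / 2)) * max 1 (ln (1 / \<epsilon>)) ^ 3)"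
    unfolding p8 X_def l_def .
qed

lemma query_bound_locate: "query_bound m (\<lambda>n d \<epsilon>. m d \<epsilon> * locate_cost n d)"
  unfolding query_bound_def
proof (rule exI[of _ "3::real"], rule exI[of _ "1::real"], rule exI[of _ "4::real"], rule exI[of _ "2::real"],
    intro allI impI)
  fix n d :: nat and \<epsilon> :: real
  assume "1 \<le> n" "1 \<le> d"
  then show "real (m d \<epsilon> * locate_cost n d)
      \<le> 1 * real (m d \<epsilon>) * (2 powr (3 * real d) * (4 * real n ^ (d - 1)) + 2 * log 2 (real n))"
    using locate_cost_bound by (simp add: mult_left_mono)
qed

theorem theorem3p14:
  shows "\<exists>(m :: nat \<Rightarrow> real \<Rightarrow> nat) (q :: nat \<Rightarrow> nat \<Rightarrow> real \<Rightarrow> nat).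
    sample_bound m \<and> query_bound m q \<and>
    (\<forall>(n :: nat) (d :: nat) (p :: real) (\<epsilon> :: real) (\<Delta> :: real) (\<nu> :: point pmf).
       n \<ge> 1 \<longrightarrow> d \<ge> 1 \<longrightarrow> p \<ge> 1 \<longrightarrow> \<epsilon> \<ge> 8 * \<Delta> \<longrightarrow> \<Delta> > 0 \<longrightarrow> set_pmf \<nu> \<subseteq> grid n d \<longrightarrow>
       (\<exists>A :: point algo.
          diameter_guarded_tester (grid n d) (ndist p n d) (CC n d) (CC n d) \<Delta> \<epsilon> \<nu> A \<and>
          uses_at_most (grid n d) (m d \<epsilon>) (q n d \<epsilon>) A))"
proof (rule exI[of _ num_samples], rule exI[of _ "\<lambda>n d \<epsilon>. num_samples d \<epsilon> * locate_cost n d"],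
    intro conjI allI impI)
  show "sample_bound num_samples" by (rule sample_bound_num_samples)
  show "query_bound num_samples (\<lambda>n d \<epsilon>. num_samples d \<epsilon> * locate_cost n d)" by (rule query_bound_locate)
  fix n d :: nat and p \<epsilon> \<Delta> :: real and \<nu> :: "point pmf"
  assume *: "n \<ge> 1" "d \<ge> 1" "p \<ge> 1" "\<epsilon> \<ge> 8 * \<Delta>" "\<Delta> > 0" "set_pmf \<nu> \<subseteq> grid n d"
  show "\<exists>A. diameter_guarded_tester (grid n d) (ndist p n d) (CC n d) (CC n d) \<Delta> \<epsilon> \<nu> A \<and>
      uses_at_most (grid n d) (num_samples d \<epsilon>) (num_samples d \<epsilon> * locate_cost n d) A"
  proof (cases "\<epsilon> < 1")
    case True
    then show ?thesis using * tester_correct[of n d p \<Delta> \<epsilon> \<nu>] uses_tester[of d \<epsilon> n p \<Delta> \<nu>] by auto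
  next
    case False
    then show ?thesis using * accept_correct[of d p \<epsilon> \<nu> n] uses_at_most.intros(1) by fastforce
  qed
qed

end
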